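(* Let $p$ be a prime, $0<\rho<1$, $c\in\mathbb{R}$, $M=\begin{bmatrix}\rho^{-1} & c\\ 0 & \rho^{-1}\end{bmatrix}$, and let $D=\{d_0,d_1,\dots,d_{p-1}\}\subset\mathbb{Z}^2$ be a set of $p$ distinct vectors such that $\mathcal{Z}(\widehat{\delta}_D)=\bigcup_{j=1}^{p-1}\left(\frac{j\bm{a}}{p}+\mathbb{Z}^2\right)$ for some $\bm{a}\in\mathcal{E}_p$. Let $\mu_{M,D}$ be the associated self-affine measure. Then $\mu_{M,D}$ is a spectral measure if and only if $\rho^{-1}\in p\mathbb{Z}$ and $c\in\left\{\frac{t}{s}: t\in p\mathbb{Z},\ \gcd(t,s)=1\right\}\cup\{0\}$ (here $s,t$ are integers, $s\ne0$).
   Context: $v^*$ denotes the (conjugate) transpose, so $(i_1,i_2)^*$ is a column vector. $\mathcal{E}_p=\{(i_1,i_2)^*: i_1,i_2\in\{1,\dots,p-1\}\}$. For a finite set $E\subset\mathbb{R}^2$, $\delta_E=\frac{1}{\#E}\sum_{e\in E}\delta_e$, where $\delta_e$ is the Dirac measure at $e$. For a compactly supported Borel probability measure $\mu$ on $\mathbb{R}^2$, $\widehat{\mu}(\xi)=\int e^{-2\pi i\langle\xi,x\rangle}\,d\mu(x)$, $\xi\in\mathbb{R}^2$; $\mathcal{Z}(f)$ is the set of zeros of $f$ in $\mathbb{R}^2$. The self-affine measure $\mu_{M,D}$ is the unique Borel probability measure satisfying $\mu=\frac{1}{\#D}\sum_{d\in D}\mu\circ\varphi_d^{-1}$ with $\varphi_d(x)=M^{-1}(x+d)$.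 A compactly supported Borel probability measure $\mu$ is a spectral measure if there is a countable $\Lambda\subset\mathbb{R}^2$ (a spectrum of $\mu$) such that $\{e^{-2\pi i\langle\lambda,x\rangle}:\lambda\in\Lambda\}$ is an orthonormal basis of $L^2(\mu)$. *)

theory Defs
  imports "HOL-Probability.Probability" "HOL-Computational_Algebra.Primes"
begin

definition int_lattice :: "(real^2) set" where
  "int_lattice = {z. \<forall>i. z $ i \<in> \<int>}"

definition E_set :: "nat \<Rightarrow> (real^2) set" where
  "E_set p = {vector [real i1, real i2] | i1 i2. i1 \<in> {1..p - 1} \<and> i2 \<in> {1..p - 1}}"

text \<open>The uniform probability measure on a finite nonempty set, transported to the Borel
  sigma-algebra of the whole plane.\<close>

definition delta_measure :: "(real^2) set \<Rightarrow> (real^2) measure" where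
  "delta_measure E = distr (uniform_count_measure E) borel (\<lambda>x. x)"

definition exp_char :: "real^2 \<Rightarrow> real^2 \<Rightarrow> complex" where
  "exp_char \<xi> x = exp (- 2 * of_real pi * \<i> * of_real (\<xi> \<bullet> x))"

definition fourier :: "(real^2) measure \<Rightarrow> real^2 \<Rightarrow> complex" where
  "fourier \<mu> \<xi> = (\<integral>x. exp_char \<xi> x \<partial>\<mu>)"

definition zero_set :: "(real^2 \<Rightarrow> complex) \<Rightarrow> (real^2) set" where
  "zero_set f = {\<xi>. f \<xi> = 0}"

definition borel_prob :: "(real^2) measure \<Rightarrow> bool" where
  "borel_prob \<mu> \<longleftrightarrow> prob_space \<mu> \<and> sets \<mu> = sets borel"

definition compactly_supported :: "(real^2) measure \<Rightarrow> bool" where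
  "compactly_supported \<mu> \<longleftrightarrow> (\<exists>K. compact K \<and> emeasure \<mu> (- K) = 0)"

definition affine_branch :: "real^2^2 \<Rightarrow> real^2 \<Rightarrow> real^2 \<Rightarrow> real^2" where
  "affine_branch M d x = matrix_inv M *v (x + d)"

text \<open>For an expanding matrix and a finite nonempty digit set there is exactly one such measure.\<close>

definition is_self_affine_measure ::
    "real^2^2 \<Rightarrow> (real^2) set \<Rightarrow> (real^2) measure \<Rightarrow> bool" where
  "is_self_affine_measure M D \<mu> \<longleftrightarrow> borel_prob \<mu> \<and>
     (\<forall>A\<in>sets borel. measure \<mu> A =
        1 / real (card D) * (\<Sum>d\<in>D. measure (distr \<mu> borel (affine_branch M d)) A))"

text \<open>Elements of \<open>L\<^sup>2(\<mu>)\<close> are represented by functions rather than by classes modulo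
  almost everywhere equality; everything below is invariant under that equality.\<close>

definition L2 :: "(real^2) measure \<Rightarrow> (real^2 \<Rightarrow> complex) set" where
  "L2 \<mu> = {f \<in> borel_measurable \<mu>. integrable \<mu> (\<lambda>x. (cmod (f x))\<^sup>2)}"

definition L2_inner ::
    "(real^2) measure \<Rightarrow> (real^2 \<Rightarrow> complex) \<Rightarrow> (real^2 \<Rightarrow> complex) \<Rightarrow> complex" where
  "L2_inner \<mu> f g = (\<integral>x. f x * cnj (g x) \<partial>\<mu>)"

definition L2_norm :: "(real^2) measure \<Rightarrow> (real^2 \<Rightarrow> complex) \<Rightarrow> real" where
  "L2_norm \<mu> f = sqrt (\<integral>x. (cmod (f x))\<^sup>2 \<partial>\<mu>)"

text \<open>An orthonormal basis is an orthonormal family in \<open>L\<^sup>2(\<mu>)\<close> whose finite linear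
  combinations are dense.\<close>

definition L2_orthonormal_basis ::
    "(real^2) measure \<Rightarrow> 'i set \<Rightarrow> ('i \<Rightarrow> real^2 \<Rightarrow> complex) \<Rightarrow> bool" where
  "L2_orthonormal_basis \<mu> I e \<longleftrightarrow>
     (\<forall>i\<in>I. e i \<in> L2 \<mu>) \<and>
     (\<forall>i\<in>I. \<forall>j\<in>I. L2_inner \<mu> (e i) (e j) = (if i = j then 1 else 0)) \<and>
     (\<forall>f\<in>L2 \<mu>. \<forall>\<epsilon>>0. \<exists>F a. finite F \<and> F \<subseteq> I \<and>
        L2_norm \<mu> (\<lambda>x. f x - (\<Sum>i\<in>F. a i * e i x)) < \<epsilon>)"

definition is_spectrum :: "(real^2) measure \<Rightarrow> (real^2) set \<Rightarrow> bool" where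
  "is_spectrum \<mu> \<Lambda> \<longleftrightarrow> countable \<Lambda> \<and> L2_orthonormal_basis \<mu> \<Lambda> exp_char"

definition spectral_measure :: "(real^2) measure \<Rightarrow> bool" where
  "spectral_measure \<mu> \<longleftrightarrow>
     borel_prob \<mu> \<and> compactly_supported \<mu> \<and> (\<exists>\<Lambda>. is_spectrum \<mu> \<Lambda>)"

end

theory Submission
  imports Defs "HOL-Computational_Algebra.Polynomial_Factorial"
begin

text \<open>
Put \<open>b = 1 / \<rho>\<close> and let \<open>T n\<close> be the \<open>n\<close>-th power of the transpose of \<open>M\<close>, a shear followed by a dilation
by \<open>b ^ n\<close>. Let \<open>m\<close> be the Fourier transform of the uniform measure on \<open>D\<close> and \<open>\<phi>\<close> that of \<open>\<mu>\<close>. Self-affinity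
becomes \<open>\<phi> x = m (T (- 1) x) * \<phi> (T (- 1) x)\<close>. So \<open>\<phi> x = 0\<close> exactly if \<open>m (T (- n) x) = 0\<close> for some
\<open>n \<ge> 1\<close>, a level of \<open>x\<close>; the form of the zeros of \<open>m\<close> then gives that the first coordinate of \<open>x\<close> is
\<open>b ^ n * k / p\<close> with \<open>k\<close> prime to \<open>p\<close>. As \<open>\<mu>\<close> has compact support, a countable set \<open>\<Lambda>\<close> is a spectrum if and
only if \<open>\<phi>\<close> vanishes on its differences and the squares of \<open>\<phi>\<close> over \<open>\<xi> - \<Lambda>\<close> add up to 1 for every \<open>\<xi>\<close>
(\<open>spectrum_iff\<close>). The rest of the argument concerns \<open>\<phi>\<close> only.

If the arithmetic condition holds, \<open>m\<close> has zeros \<open>j \<alpha>\<close> with \<open>1 \<le> j < p\<close> that all positive powers of the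
transposed matrix map into the integer lattice. Expansions in the digits \<open>j \<alpha>\<close> then give orthogonal sets
that are complete for the finite products of masks. The digits may be shifted by vectors that the masks do
not see. A point and its translate by the second unit vector are never both zeros of \<open>\<phi>\<close>, so the shifts can be
chosen to keep the remaining infinite product away from 0. This makes the union of the finite sets complete
(\<open>exists_spectrum\<close>).

Conversely let \<open>\<Lambda>\<close> be a spectrum. Every level is the only level of some pair in \<open>\<Lambda>\<close>, since otherwise \<open>\<Lambda>\<close>
would be orthogonal for the product without this factor and could not be complete
(\<open>every_level_essential\<close>). Each triangle in \<open>\<Lambda>\<close> gives an integer relation between powers of \<open>b\<close>. A relation
between different powers with coefficients prime to \<open>p\<close> would make \<open>b\<close> a unit in the finite ring
\<open>\<int>[b]/p\<close> and \<open>\<Lambda>\<close> finite (\<open>unit_differences_finite\<close>). Hence the triangles are isosceles, and \<open>b = q / h\<close> in lowest terms with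
\<open>q\<close> divisible by \<open>p\<close> (\<open>base_rational\<close>). If \<open>h \<ge> 2\<close>, the distance of points at level \<open>n\<close> is at least
a constant times \<open>q ^ n\<close>, much more than \<open>b ^ n\<close> (\<open>separation\<close>), while \<open>\<phi>\<close> decays like a negative power of the logarithm of the first
coordinate (\<open>decay\<close>). Then the points that enter at later scales contribute too little for completeness;
so \<open>h = 1\<close> (\<open>base_integral\<close>). A triangle with levels 1, 1 and 2 finally shows the divisibility property
of \<open>c\<close> (\<open>shear_entry\<close>).\<close>

section \<open>Units modulo a prime in the ring generated by a real number\<close>

abbreviation rpoly :: "int poly \<Rightarrow> real \<Rightarrow> real" where
  "rpoly P x \<equiv> poly (map_poly of_int P) x"

lemma rpoly_add: "rpoly (P + Q) x = rpoly P x + rpoly Q x"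
proof -
  have "map_poly real_of_int (P + Q) = map_poly of_int P + map_poly of_int Q"
    by (intro poly_eqI) (simp add: coeff_map_poly)
  then show ?thesis by simp
qed

lemma rpoly_smult: "rpoly (smult a P) x = of_int a * rpoly P x"
proof -
  have "map_poly real_of_int (smult a P) = smult (of_int a) (map_poly of_int P)"
    by (intro poly_eqI) (simp add: coeff_map_poly)
  then show ?thesis by simp
qed

lemma rpoly_pCons: "rpoly (pCons a P) x = of_int a + x * rpoly P x"
  by (simp add: map_poly_pCons)

lemma rpoly_mult: "rpoly (P * Q) x = rpoly P x * rpoly Q x"
  by (induction P) (simp_all add: rpoly_add rpoly_smult rpoly_pCons algebra_simps)

lemma rpoly_diff: "rpoly (P - Q) x = rpoly P x - rpoly Q x"
  using rpoly_add[of "P - Q" Q x] by simp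

lemma rpoly_monom: "rpoly (monom a n) x = of_int a * x ^ n"
  by (simp add: map_poly_monom poly_monom)

text \<open>The primitive part of an annihilating polynomial of least degree divides every other one already
over the integers, by Gauss's lemma. Divisibility over the rationals would not be enough, since
the coefficients are reduced modulo a prime below.\<close>

lemma integral_minimal_polynomial:
  assumes "P \<noteq> 0" and "rpoly P b = 0"
  obtains Q where "rpoly Q b = 0" "Q \<noteq> 0" "\<And>F. rpoly F b = 0 \<Longrightarrow> Q dvd F"
proof -
  obtain R where R: "R \<noteq> 0" "rpoly R b = 0"
    and min: "\<And>S. S \<noteq> 0 \<Longrightarrow> rpoly S b = 0 \<Longrightarrow> degree R \<le> degree S"
    using ex_has_least_nat[of "\<lambda>S. S \<noteq> 0 \<and> rpoly S b = 0" P degree] assms by auto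
  define Q where "Q = primitive_part R"
  have RQ: "R = smult (content R) Q" by (simp add: Q_def)
  have Q0: "Q \<noteq> 0" using R by (auto simp: Q_def)
  have cR: "content R \<noteq> 0" using R by simp
  have degQ: "degree Q = degree R" by (simp add: Q_def)
  have Qb: "rpoly Q b = 0"
    using R(2) cR RQ rpoly_smult[of "content R" Q b] by simp
  have cQ: "content Q = 1" using R by (simp add: Q_def)
  have "Q dvd F" if F: "rpoly F b = 0" for F
  proof -
    obtain a h where a: "a \<noteq> 0" "smult a F = Q * h + pseudo_mod F Q"
      using pseudo_mod(1)[OF Q0] by blast
    have "rpoly (pseudo_mod F Q) b = 0"
      using arg_cong[OF a(2), of "\<lambda>S. rpoly S b"] F Qb
      by (simp add: rpoly_add rpoly_mult rpoly_smult)
    then have "pseudo_mod F Q = 0"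
      using pseudo_mod(2)[OF Q0, of F] min[of "pseudo_mod F Q"] degQ by fastforce
    then have "smult a F = Q * h" using a by simp
    then have "fract_poly Q dvd fract_poly (smult a F)"
      by (simp add: fract_poly_dvd)
    then have "fract_poly Q dvd smult (to_fract a) (fract_poly F)"
      by (simp add: fract_poly_smult)
    then have "fract_poly Q dvd fract_poly F"
      using a(1) dvd_smult_cancel[of "fract_poly Q" "to_fract a" "fract_poly F"] by simp
    then show ?thesis using cQ by (rule fract_poly_dvdD)
  qed
  then show thesis using that Qb Q0 by blast
qed

text \<open>Modulo \<open>p\<close> the hypothesis says that \<open>Q * H\<close> is a monomial. Over a field the factors of a
monomial are monomials, and a monomial with nonzero constant coefficient is constant; so \<open>Q\<close>, which
keeps its degree modulo \<open>p\<close>, is constant. The proof compares the lowest and the highest index at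
which \<open>H\<close> has a coefficient prime to \<open>p\<close>.\<close>

lemma extreme_coeffs_survive_mod_prime:
  fixes p :: int
  assumes p: "prime p" and Q0: "\<not> p dvd coeff Q 0" and Ql: "\<not> p dvd lead_coeff Q"
    and F: "\<And>i. i \<noteq> n \<Longrightarrow> p dvd coeff (Q * H) i" and Fn: "\<not> p dvd coeff (Q * H) n"
  shows "degree Q = 0"
proof -
  have ex: "\<exists>i. \<not> p dvd coeff H i"
  proof (rule ccontr)
    assume "\<not> ?thesis"
    then have "p dvd coeff (Q * H) n"
      by (auto simp: coeff_mult intro!: dvd_sum dvd_mult)
    with Fn show False by simp
  qed
  define i where "i = (LEAST i. \<not> p dvd coeff H i)"
  have i: "\<not> p dvd coeff H i" "\<And>l. l < i \<Longrightarrow> p dvd coeff H l"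
    using LeastI_ex[OF ex] not_less_Least unfolding i_def by blast+
  have bound: "l \<le> degree H" if "\<not> p dvd coeff H l" for l
    using that by (metis dvd_0_right coeff_eq_0 not_le)
  define j where "j = (GREATEST i. \<not> p dvd coeff H i)"
  have j: "\<not> p dvd coeff H j" unfolding j_def
    by (rule GreatestI_nat[of _ i]) (use i bound in auto)
  have jmax: "p dvd coeff H l" if "l > j" for l
  proof (rule ccontr)
    assume "\<not> p dvd coeff H l"
    then have "l \<le> j" unfolding j_def using bound by (intro Greatest_le_nat) auto
    with that show False by simp
  qed
  have "coeff (Q * H) i = coeff Q 0 * coeff H i + (\<Sum>l\<in>{..i} - {0}. coeff Q l * coeff H (i - l))"
    by (simp add: coeff_mult sum.remove[of "{..i}" 0])
  moreover have "p dvd (\<Sum>l\<in>{..i} - {0}. coeff Q l * coeff H (i - l))"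
    by (intro dvd_sum dvd_mult i) auto
  ultimately have "\<not> p dvd coeff (Q * H) i"
    using p Q0 i(1) by (simp add: dvd_add_left_iff prime_dvd_mult_iff)
  then have "i = n" using F by blast
  moreover
  let ?m = "degree Q + j"
  have "coeff (Q * H) ?m = lead_coeff Q * coeff H j + (\<Sum>l\<in>{..?m} - {degree Q}. coeff Q l * coeff H (?m - l))"
    by (simp add: coeff_mult sum.remove[of "{..?m}" "degree Q"])
  moreover have "p dvd (\<Sum>l\<in>{..?m} - {degree Q}. coeff Q l * coeff H (?m - l))"
  proof (rule dvd_sum)
    fix l assume l: "l \<in> {..?m} - {degree Q}"
    show "p dvd coeff Q l * coeff H (?m - l)"
    proof (cases "l < degree Q")
      case True then show ?thesis using jmax[of "?m - l"] by (intro dvd_mult) auto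
    next
      case False then show ?thesis using l by (simp add: coeff_eq_0)
    qed
  qed
  ultimately have "\<not> p dvd coeff (Q * H) ?m"
    using p Ql j by (simp add: dvd_add_left_iff prime_dvd_mult_iff)
  then have "?m = n" using F by blast
  moreover have "i \<le> j"
    using jmax i(1) by (meson not_le)
  ultimately show ?thesis using \<open>i = n\<close> by simp
qed

text \<open>If the extreme coefficients of an integer equation for \<open>b\<close> are prime to \<open>p\<close>, then \<open>b\<close> behaves like
a unit at \<open>p\<close>: no power of \<open>b\<close>, multiplied by an integer prime to \<open>p\<close>, becomes divisible by \<open>p\<close> in
\<open>\<int>[b]\<close>.\<close>

lemma unit_not_divisible:
  fixes p :: int
  assumes p: "prime p" and P0: "\<not> p dvd coeff P 0" and Pl: "\<not> p dvd lead_coeff P"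
    and root: "rpoly P b = 0" and k: "\<not> p dvd k"
  shows "of_int k * b ^ n \<noteq> of_int p * rpoly G b"
proof
  assume eq: "of_int k * b ^ n = of_int p * rpoly G b"
  have "P \<noteq> 0" using Pl by auto
  then obtain Q where Q: "rpoly Q b = 0" "Q \<noteq> 0" "\<And>F. rpoly F b = 0 \<Longrightarrow> Q dvd F"
    using integral_minimal_polynomial root by blast
  obtain S where S: "P = Q * S" using Q(3)[OF root] by blast
  have "rpoly (monom k n - smult p G) b = 0"
    using eq by (simp add: rpoly_diff rpoly_monom rpoly_smult)
  then obtain H where H: "monom k n - smult p G = Q * H" using Q(3) by blast
  have "\<not> p dvd coeff Q 0" using P0 by (auto simp: S coeff_mult)
  moreover have "\<not> p dvd lead_coeff Q" using Pl by (auto simp: S lead_coeff_mult)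
  ultimately have "degree Q = 0"
    by (rule extreme_coeffs_survive_mod_prime[OF p, of _ n H])
       (use k in \<open>auto simp: H[symmetric] dvd_diff_left_iff\<close>)
  then obtain a where "Q = [:a:]" by (rule degree_eq_zeroE)
  then show False using Q(1,2) rpoly_pCons[of a 0 b] by simp
qed

text \<open>Modulo \<open>p\<close> the leading coefficient of \<open>P\<close> can be inverted, so the equation \<open>P(b) = 0\<close> rewrites
\<open>b\<close> to the power \<open>degree P\<close> in lower powers. Together with the reduction of the coefficients
modulo \<open>p\<close> in the lemma after this one, it follows that \<open>\<int>[b]/p\<close> is finite.\<close>

lemma reduce_degree:
  fixes p :: int
  assumes p: "prime p" and Pl: "\<not> p dvd lead_coeff P" and root: "rpoly P b = 0"
    and d: "degree P > 0"
  shows "\<exists>G' H. degree G' < degree P \<and> rpoly G b = rpoly G' b + of_int p * rpoly H b"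
proof (induction G)
  case 0
  show ?case by (rule exI[of _ 0], rule exI[of _ 0]) (simp add: d)
next
  case (pCons a G)
  then obtain G' H where GH: "degree G' < degree P" "rpoly G b = rpoly G' b + of_int p * rpoly H b"
    by blast
  let ?d = "degree P"
  have "coprime (lead_coeff P) p" using p Pl by (simp add: prime_imp_coprime coprime_commute)
  then obtain u v where uv: "u * lead_coeff P + v * p = 1"
    by (metis bezout_int coprime_iff_gcd_eq_1)
  define e where "e = coeff (pCons a G') ?d"
  (* The last term is a multiple of p and repairs the coefficient of degree ?d, which the
     subtraction of P cancels only modulo p. *)
  define G'' where "G'' = pCons a G' - smult (e * u) P - smult p (monom (e * v) ?d)"
  have le: "degree (pCons a G') \<le> ?d"
    using GH(1) by (simp add: degree_pCons_le le_trans[OF degree_pCons_le])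
  have "degree G'' \<le> ?d"
    unfolding G''_def by (intro degree_diff_le le) (auto intro: degree_smult_le order_trans[OF degree_smult_le] degree_monom_le)
  moreover have "coeff G'' ?d = 0"
  proof -
    have "coeff G'' ?d = e * (1 - (u * lead_coeff P + v * p))"
      unfolding G''_def by (simp add: e_def[symmetric] algebra_simps)
    then show ?thesis using uv by simp
  qed
  ultimately have deg: "degree G'' < ?d"
    using d by (metis degree_0 le_neq_implies_less leading_coeff_0_iff)
  have "rpoly (pCons a G) b = rpoly G'' b + of_int p * rpoly (monom (e * v) ?d + pCons 0 H) b"
    using GH(2) root by (simp add: G''_def rpoly_diff rpoly_pCons rpoly_smult rpoly_add rpoly_monom algebra_simps)
  with deg show ?case by blast
qed

lemma finite_residues:
  fixes p :: int
  assumes p: "prime p" and Pl: "\<not> p dvd lead_coeff P" and root: "rpoly P b = 0"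
    and d: "degree P > 0"
  shows "\<exists>xs H. set xs \<subseteq> {0..<p} \<and> length xs = degree P \<and> rpoly G b = rpoly (Poly xs) b + of_int p * rpoly H b"
proof -
  obtain G' H where GH: "degree G' < degree P" "rpoly G b = rpoly G' b + of_int p * rpoly H b"
    using reduce_degree[OF assms] by blast
  define xs where "xs = map (\<lambda>i. coeff G' i mod p) [0..<degree P]"
  have p0: "p > 0" using p by (simp add: prime_gt_0_int)
  have "G' = Poly xs + smult p (map_poly (\<lambda>c. c div p) G')"
  proof (rule poly_eqI)
    fix i
    show "coeff G' i = coeff (Poly xs + smult p (map_poly (\<lambda>c. c div p) G')) i"
    proof (cases "i < degree P")
      case True then show ?thesis by (simp add: xs_def nth_default_def coeff_map_poly)
    next
      case False
      then have "coeff G' i = 0" using GH(1) by (simp add: coeff_eq_0)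
      with False show ?thesis by (simp add: xs_def nth_default_def coeff_map_poly)
    qed
  qed
  then have "rpoly G' b = rpoly (Poly xs) b + of_int p * rpoly (map_poly (\<lambda>c. c div p) G') b"
    by (metis rpoly_add rpoly_smult)
  then have "rpoly G b = rpoly (Poly xs) b + of_int p * rpoly (map_poly (\<lambda>c. c div p) G' + H) b"
    using GH(2) by (simp add: rpoly_add algebra_simps)
  moreover have "set xs \<subseteq> {0..<p}" using p0 by (auto simp: xs_def)
  ultimately show ?thesis by (intro exI[of _ xs] exI[of _ "map_poly (\<lambda>c. c div p) G' + H"]) (simp add: xs_def)
qed

lemma infinite_two_elements:
  assumes "infinite S"
  obtains x y where "x \<in> S" "y \<in> S" "x \<noteq> y"
proof -
  obtain x where x: "x \<in> S" using assms infinite_imp_nonempty by blast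
  have "infinite (S - {x})" using assms by simp
  then obtain y where "y \<in> S - {x}" using infinite_imp_nonempty by blast
  with x that show thesis by blast
qed

text \<open>Differences of \<open>X\<close> lie in \<open>\<int>[b]\<close> and are units modulo \<open>p\<close>, hence distinct elements of \<open>X\<close> have
distinct residues in the finite ring \<open>\<int>[b]/p\<close>.\<close>

lemma unit_differences_finite:
  fixes p :: int and X :: "real set"
  assumes p: "prime p" and P0: "\<not> p dvd coeff P 0" and Pl: "\<not> p dvd lead_coeff P"
    and root: "rpoly P b = 0"
    and X: "\<And>x y. x \<in> X \<Longrightarrow> y \<in> X \<Longrightarrow> x \<noteq> y \<Longrightarrow> \<exists>n k. x - y = b ^ n * of_int k \<and> \<not> p dvd k"
  shows "finite X"
proof (rule ccontr)
  assume inf: "infinite X"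
  then obtain x0 where x0: "x0 \<in> X" by fastforce
  have d: "degree P > 0"
  proof (rule ccontr)
    assume "\<not> ?thesis"
    then obtain a where "P = [:a:]" using degree_eq_zeroE by blast
    then show False using root P0 rpoly_pCons[of a 0 b] by simp
  qed
  let ?B = "{xs. set xs \<subseteq> {0..<p} \<and> length xs = degree P}"
  have fin: "finite ?B" by (rule finite_lists_length_eq) simp
  have "\<forall>x\<in>X. \<exists>xs\<in>?B. \<exists>H. x - x0 = rpoly (Poly xs) b + of_int p * rpoly H b"
  proof
    fix x assume x: "x \<in> X"
    have "\<exists>G. x - x0 = rpoly G b"
    proof (cases "x = x0")
      case True then show ?thesis by (intro exI[of _ 0]) simp
    next
      case False
      then obtain n k where "x - x0 = b ^ n * of_int k" using X x x0 by blast
      then show ?thesis by (intro exI[of _ "monom k n"]) (simp add: rpoly_monom)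
    qed
    then obtain G where G: "x - x0 = rpoly G b" by blast
    show "\<exists>xs\<in>?B. \<exists>H. x - x0 = rpoly (Poly xs) b + of_int p * rpoly H b"
      using finite_residues[OF p Pl root d, of G] unfolding G by blast
  qed
  from pigeonhole_infinite_rel[OF inf fin this] obtain xs where
    xs: "infinite {x \<in> X. \<exists>H. x - x0 = rpoly (Poly xs) b + of_int p * rpoly H b}" (is "infinite ?Y")
    by blast
  then obtain x y where x: "x \<in> ?Y" and y: "y \<in> ?Y" "x \<noteq> y"
    by (rule infinite_two_elements)
  obtain H H' where "x - x0 = rpoly (Poly xs) b + of_int p * rpoly H b"
    "y - x0 = rpoly (Poly xs) b + of_int p * rpoly H' b" using x y by blast
  then have e: "x - y = of_int p * rpoly (H - H') b" by (simp add: rpoly_diff algebra_simps)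
  obtain n k where k: "x - y = b ^ n * of_int k" "\<not> p dvd k" using X x y by blast
  then show False using unit_not_divisible[OF p P0 Pl root k(2), of n "H - H'"] e
    by (simp add: mult.commute)
qed

section \<open>Infinite sets whose differences are powers times units\<close>

text \<open>A \<open>p\<close>-adic valuation in disguise: for an integer base divisible by \<open>p\<close>, membership in level \<open>n\<close>
fixes the power of \<open>p\<close> in \<open>x\<close>. For a general real \<open>b\<close> the level of a number need not be unique.\<close>

definition unit_level :: "real \<Rightarrow> int \<Rightarrow> nat \<Rightarrow> real \<Rightarrow> bool" where
  "unit_level b p n x \<longleftrightarrow> (\<exists>k. x = b ^ n * of_int k \<and> \<not> p dvd k)"

lemma unit_level_minus: "unit_level b p n (x - y) \<Longrightarrow> unit_level b p n (y - x)"
  unfolding unit_level_def by (metis dvd_minus_iff minus_diff_eq mult_minus_right of_int_minus)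

lemma unit_level_nonzero: "b > 0 \<Longrightarrow> unit_level b p n x \<Longrightarrow> x \<noteq> 0"
  unfolding unit_level_def by auto

text \<open>The first coordinates of a spectrum, multiplied by \<open>p\<close>, form such a set \<open>X\<close>. The aim is that \<open>b\<close> is
a rational number with numerator divisible by \<open>p\<close>. Every three elements of \<open>X\<close> give a relation
between powers of \<open>b\<close>. By the finiteness result above, a relation between different powers cannot
have all its coefficients prime to \<open>p\<close>, which restricts the levels of a triangle.\<close>

locale unit_tree =
  fixes b :: real and p :: int and X :: "real set"
  assumes p: "prime p" and b: "b > 1" and inf: "infinite X"
    and level_ex: "\<And>x y. x \<in> X \<Longrightarrow> y \<in> X \<Longrightarrow> x \<noteq> y \<Longrightarrow> \<exists>n\<ge>1. unit_level b p n (x - y)"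
    and level_occurs: "\<And>n. n \<ge> 1 \<Longrightarrow> \<exists>x\<in>X. \<exists>y\<in>X. unit_level b p n (x - y)"
begin

abbreviation lev :: "real \<Rightarrow> real \<Rightarrow> nat \<Rightarrow> bool" where
  "lev x y n \<equiv> unit_level b p n (x - y)"

lemma lev_sym: "lev x y n \<Longrightarrow> lev y x n"
  by (rule unit_level_minus)

lemma no_unit_polynomial:
  assumes "\<not> p dvd coeff P 0" and "\<not> p dvd lead_coeff P"
  shows "rpoly P b \<noteq> 0"
proof
  assume "rpoly P b = 0"
  then have "finite X"
    using unit_differences_finite[OF p assms, of b X] level_ex unfolding unit_level_def by metis
  with inf show False by simp
qed

lemma no_unit_binomial:
  assumes f: "f \<ge> 1" and "\<not> p dvd k" "\<not> p dvd s"
  shows "b ^ f * of_int k \<noteq> of_int s"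
proof
  assume eq: "b ^ f * of_int k = of_int s"
  let ?P = "monom k f - [:s:]"
  have k: "k \<noteq> 0" using assms by auto
  have "degree ?P = f"
    using f k by (intro antisym degree_diff_le le_degree) (auto simp: degree_monom_eq coeff_pCons split: nat.split)
  then have "lead_coeff ?P = k" using f by (simp add: coeff_pCons split: nat.split)
  then have lc: "\<not> p dvd lead_coeff ?P" using assms(2) by presburger
  have "coeff ?P 0 = - s" using f by simp
  then have c0: "\<not> p dvd coeff ?P 0" using assms(3) by simp
  have s: "rpoly [:s:] b = of_int s" using rpoly_pCons[of s 0 b] by simp
  have "rpoly ?P b = 0" unfolding rpoly_diff rpoly_monom s using eq by (simp add: mult.commute)
  with no_unit_polynomial[OF c0 lc] show False by blast
qed

lemma no_unit_trinomial:
  assumes n: "n1 < n2" "n2 < n3" and k: "\<not> p dvd k1" "\<not> p dvd k2" "\<not> p dvd k3"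
  shows "b ^ n1 * of_int k1 + b ^ n2 * of_int k2 + b ^ n3 * of_int k3 \<noteq> 0"
proof
  assume eq: "b ^ n1 * of_int k1 + b ^ n2 * of_int k2 + b ^ n3 * of_int k3 = 0"
  define e where "e = n2 - n1"
  define f where "f = n3 - n1"
  have ef: "n2 = n1 + e" "n3 = n1 + f" "0 < e" "e < f" using n by (auto simp: e_def f_def)
  have "b ^ n1 * (of_int k1 + b ^ e * of_int k2 + b ^ f * of_int k3) = 0"
    using eq unfolding ef by (simp add: power_add algebra_simps)
  then have eq': "of_int k1 + b ^ e * of_int k2 + b ^ f * of_int k3 = 0" using b by simp
  let ?P = "monom k3 f + monom k2 e + [:k1:]"
  have k0: "k3 \<noteq> 0" using k by auto
  have "degree ?P = f"
    using ef k0 by (intro antisym degree_add_le le_degree)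
       (auto simp: degree_monom_eq coeff_pCons intro: order_trans[OF degree_monom_le] split: nat.split)
  then have "lead_coeff ?P = k3" using ef by (simp add: coeff_pCons split: nat.split)
  then have lc: "\<not> p dvd lead_coeff ?P" using k(3) by presburger
  have "coeff ?P 0 = k1" using ef by simp
  then have c0: "\<not> p dvd coeff ?P 0" using k(1) by simp
  have s: "rpoly [:k1:] b = of_int k1" using rpoly_pCons[of k1 0 b] by simp
  have "rpoly ?P b = 0" unfolding rpoly_add rpoly_monom s using eq' by (simp add: algebra_simps)
  with no_unit_polynomial[OF c0 lc] show False by blast
qed

text \<open>Three distinct levels would give a trinomial equation for \<open>b\<close> with coefficients prime to \<open>p\<close>.\<close>

lemma triangle_two_equal:
  assumes "lev x y n1" "lev y z n2" "lev x z n3"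
  shows "n1 = n2 \<or> n2 = n3 \<or> n1 = n3"
proof (rule ccontr)
  assume d: "\<not> ?thesis"
  from assms obtain k1 k2 k3 where k: "x - y = b ^ n1 * of_int k1" "y - z = b ^ n2 * of_int k2"
    "z - x = b ^ n3 * of_int k3" "\<not> p dvd k1" "\<not> p dvd k2" "\<not> p dvd k3"
    using lev_sym[OF assms(3)] unfolding unit_level_def by blast
  have "b ^ n1 * of_int k1 + b ^ n2 * of_int k2 + b ^ n3 * of_int k3 = 0"
    using k(1-3) by linarith
  then show False
    using d no_unit_trinomial[of n1 n2 n3 k1 k2 k3] no_unit_trinomial[of n1 n3 n2 k1 k3 k2]
      no_unit_trinomial[of n2 n1 n3 k2 k1 k3] no_unit_trinomial[of n2 n3 n1 k2 k3 k1]
      no_unit_trinomial[of n3 n1 n2 k3 k1 k2] no_unit_trinomial[of n3 n2 n1 k3 k2 k1] k(4-6)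
    by (smt (verit, best) nat_neq_iff)
qed

lemma isosceles:
  assumes "lev x y n" "lev x z n" "lev y z n'"
  obtains k s where "b ^ n' * of_int k = b ^ n * of_int s" "\<not> p dvd k" "y - z = b ^ n * of_int s"
proof -
  from assms obtain k1 k2 k3 where k: "x - y = b ^ n * of_int k1" "x - z = b ^ n * of_int k2"
    "y - z = b ^ n' * of_int k3" "\<not> p dvd k3" unfolding unit_level_def by blast
  have "y - z = b ^ n * of_int (k2 - k1)" using k(1,2) by (simp add: algebra_simps)
  with k that[of k3 "k2 - k1"] show thesis by simp
qed

text \<open>If only one level occurred, all elements of \<open>X\<close> would differ by \<open>b\<close> to the power \<open>n\<close> times integers,
pairwise incongruent modulo \<open>p\<close>; there are at most \<open>p\<close> of those.\<close>

lemma not_all_equilateral: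
  "\<exists>x\<in>X. \<exists>y\<in>X. \<exists>z\<in>X. \<exists>n n'. n \<noteq> n' \<and> lev x y n \<and> lev x z n \<and> lev y z n'"
proof (rule ccontr)
  assume no: "\<not> ?thesis"
  have mono: "n1 = n3" if "x \<in> X" "y \<in> X" "z \<in> X" "lev x y n1" "lev y z n2" "lev x z n3" for x y z n1 n2 n3
    using triangle_two_equal[OF that(4-6)] no that lev_sym by metis
  obtain x1 x0 where x1: "x1 \<in> X" and x0: "x0 \<in> X" and "x1 \<noteq> x0"
    by (rule infinite_two_elements[OF inf])
  note x1 = x1 \<open>x1 \<noteq> x0\<close>
  obtain n where n: "lev x0 x1 n" using level_ex x0 x1 by metis
  have all: "lev x0 z n" if z: "z \<in> X - {x0}" for z
  proof (cases "z = x1")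
    case True then show ?thesis using n by simp
  next
    case False
    obtain n' where n': "lev x0 z n'" using level_ex x0 z by (metis DiffE insertI1)
    obtain n'' where n'': "lev z x1 n''" using level_ex x1 z False by (metis DiffE)
    have "n' = n" by (rule mono[OF x0 _ x1(1) n' n'' n]) (use z in auto)
    then show ?thesis using n' by simp
  qed
  have "infinite (X - {x0})" using inf by simp
  have fin: "finite {0..<p}" by simp
  have "\<forall>z\<in>X - {x0}. \<exists>r\<in>{0..<p}. \<exists>k. x0 - z = b ^ n * of_int k \<and> k mod p = r"
    using all p unfolding unit_level_def
    by (metis atLeastLessThan_iff pos_mod_bound pos_mod_sign prime_gt_0_int)
  from pigeonhole_infinite_rel[OF \<open>infinite (X - {x0})\<close> fin this] obtain r where
    inf': "infinite {z \<in> X - {x0}. \<exists>k. x0 - z = b ^ n * of_int k \<and> k mod p = r}" (is "infinite ?Y")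
    by blast
  obtain z y where z: "z \<in> ?Y" and y: "y \<in> ?Y" and "z \<noteq> y"
    by (rule infinite_two_elements[OF inf'])
  note z = z \<open>z \<noteq> y\<close>
  obtain k k' where k: "x0 - y = b ^ n * of_int k" "x0 - z = b ^ n * of_int k'" "k mod p = k' mod p"
  proof -
    from y z obtain k k' where "x0 - y = b ^ n * of_int k" "k mod p = r"
      "x0 - z = b ^ n * of_int k'" "k' mod p = r" by blast
    with that show thesis by metis
  qed
  have "y \<in> X" "z \<in> X" using y z by auto
  obtain n' where n': "lev y z n'" using level_ex \<open>y \<in> X\<close> \<open>z \<in> X\<close> z(2) by metis
  have ly: "lev x0 y n" and lz: "lev x0 z n" using all y z by auto
  have "n' = n" using no x0 \<open>y \<in> X\<close> \<open>z \<in> X\<close> ly lz n' by metis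
  then obtain l where l: "y - z = b ^ n * of_int l" "\<not> p dvd l"
    using n' unfolding unit_level_def by blast
  have "b ^ n * of_int l = b ^ n * of_int (k' - k)" using k(1,2) l(1) by (simp add: algebra_simps)
  then have "real_of_int l = of_int (k' - k)" using b by simp
  then have "l = k' - k" by linarith
  then show False using k(3) l(2) by (simp add: mod_eq_dvd_iff[symmetric])
qed

text \<open>An isosceles triangle with two different levels makes a power of \<open>b\<close> rational. This rational number
cannot be a unit at \<open>p\<close>.\<close>

lemma power_relation:
  "\<exists>e\<ge>1. \<exists>u v. b ^ e * of_int v = of_int u \<and> ((p dvd u \<and> \<not> p dvd v) \<or> (p dvd v \<and> \<not> p dvd u))"
proof -
  obtain x y z n n' where n: "n \<noteq> n'" "lev x y n" "lev x z n" "lev y z n'"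
    using not_all_equilateral by blast
  obtain k s where ks: "b ^ n' * of_int k = b ^ n * of_int s" "\<not> p dvd k" "y - z = b ^ n * of_int s"
    by (rule isosceles[OF n(2-4)])
  show ?thesis
  proof (cases "n < n'")
    case True
    define e where "e = n' - n"
    have e: "n' = n + e" "e \<ge> 1" using True by (auto simp: e_def)
    have "b ^ e * of_int k = of_int s" using ks(1) b by (simp add: e power_add)
    then show ?thesis using no_unit_binomial[OF e(2) ks(2), of s] ks(2) e(2) by blast
  next
    case False
    define e where "e = n - n'"
    have e: "n = n' + e" "e \<ge> 1" using False n(1) by (auto simp: e_def)
    have "b ^ e * of_int s = of_int k" using ks(1) b by (simp add: e power_add)
    then show ?thesis using no_unit_binomial[OF e(2) _ ks(2), of s] ks(2) e(2) by blast
  qed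
qed

text \<open>Suppose that the rational power of \<open>b\<close> has negative \<open>p\<close>-adic valuation. Then the largest level in
a triangle occurs twice. Fix \<open>x0\<close> and \<open>x1\<close>; a third element at a very high level \<open>l\<close> from \<open>x0\<close> is
then at the same level from \<open>x1\<close>, so that the fixed nonzero number \<open>x0 - x1\<close> is an integer
multiple of \<open>b\<close> to the power \<open>l\<close>. Since \<open>b > 1\<close>, it is too large.\<close>

lemma valuation_positive:
  "\<exists>e\<ge>1. \<exists>u v. b ^ e * of_int v = of_int u \<and> p dvd u \<and> \<not> p dvd v"
proof (rule ccontr)
  assume no: "\<not> ?thesis"
  then obtain e u v where euv: "e \<ge> 1" "b ^ e * of_int v = of_int u" "p dvd v" "\<not> p dvd u"
    using power_relation by blast
  have nomax: False if f: "f \<ge> 1" and k: "\<not> p dvd k" and eq: "b ^ f * of_int k = of_int s" for f k s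
  proof -
    have "of_int (u ^ f * k ^ e) = (b ^ e * of_int v) ^ f * real_of_int k ^ e" using euv by simp
    also have "\<dots> = (b ^ f * of_int k) ^ e * of_int v ^ f"
      by (simp add: power_mult_distrib power_mult[symmetric] mult.commute)
    also have "\<dots> = of_int (s ^ e * v ^ f)" using eq by simp
    finally have "u ^ f * k ^ e = s ^ e * v ^ f" by (metis of_int_eq_iff)
    moreover have "p dvd v ^ f" using euv f by (meson dvd_power dvd_trans less_le_trans zero_less_one)
    ultimately have "p dvd u ^ f * k ^ e" by simp
    then show False using p k euv(4) by (auto simp: prime_dvd_mult_iff dest: prime_dvd_power)
  qed
  have umax: False if H: "lev x y n" "lev x z n" "lev y z n'" "n < n'" for x y z n n'
  proof -
    obtain k s where ks: "b ^ n' * of_int k = b ^ n * of_int s" "\<not> p dvd k" "y - z = b ^ n * of_int s"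
      by (rule isosceles[OF H(1-3)])
    define f where "f = n' - n"
    have f: "n' = n + f" "f \<ge> 1" using H(4) by (auto simp: f_def)
    have "b ^ f * of_int k = of_int s" using ks(1) b by (simp add: f power_add)
    then show False using nomax f ks by blast
  qed
  obtain x1 x0 where x1: "x1 \<in> X" and x0: "x0 \<in> X" and "x1 \<noteq> x0"
    by (rule infinite_two_elements[OF inf])
  note x1 = x1 \<open>x1 \<noteq> x0\<close>
  obtain n where n: "lev x0 x1 n" using level_ex x0 x1 by metis
  obtain N0 where N0: "\<bar>x0 - x1\<bar> < b ^ N0" using real_arch_pow[OF b] by blast
  define N where "N = Suc (max N0 n)"
  have N: "n < N" "\<bar>x0 - x1\<bar> < b ^ N" "N \<ge> 1"
  proof -
    show "n < N" "N \<ge> 1" by (auto simp: N_def)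
    have "b ^ N0 \<le> b ^ N" using b by (intro power_increasing) (auto simp: N_def)
    then show "\<bar>x0 - x1\<bar> < b ^ N" using N0 by simp
  qed
  have far: False if "x0 - x1 = b ^ l * of_int t" "l \<ge> N" for l t
  proof -
    have "t \<noteq> 0" using that x1 by auto
    then have "b ^ l \<le> b ^ l * real_of_int \<bar>t\<bar>" using b by (simp add: mult_le_cancel_left1)
    also have "\<dots> = \<bar>x0 - x1\<bar>" using that b by (simp add: abs_mult)
    finally have "b ^ l \<le> \<bar>x0 - x1\<bar>" .
    moreover have "b ^ N \<le> b ^ l" using that(2) b by (intro power_increasing) auto
    ultimately show False using N(2) by simp
  qed
  (* Seen from x0, one of z and z' must be at level N or higher, since N cannot be the
     unique largest level of the triangle x0, z, z'. *)
  obtain z z' where z: "z \<in> X" "z' \<in> X" "lev z z' N" using level_occurs[OF N(3)] by blast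
  have "\<exists>y\<in>X. \<exists>l\<ge>N. lev x0 y l"
  proof (cases "x0 = z \<or> x0 = z'")
    case True then show ?thesis using z lev_sym by blast
  next
    case False
    obtain a d where ad: "lev x0 z a" "lev x0 z' d" using level_ex False x0 z by metis
    show ?thesis
    proof (rule ccontr)
      assume "\<not> ?thesis"
      then have "a < N" "d < N" using ad z by (meson not_le)+
      moreover have "a = d" using triangle_two_equal[OF ad(1) z(3) ad(2)] calculation by auto
      ultimately show False using umax[of a x0 z z' N] ad z by blast
    qed
  qed
  then obtain y l where y: "y \<in> X" "l \<ge> N" "lev x0 y l" by blast
  have "y \<noteq> x1" using far y(2,3) unfolding unit_level_def by blast
  then obtain d where d: "lev x1 y d" using level_ex x1 y by metis
  have "n = d \<or> d = l" using triangle_two_equal[OF n d y(3)] N y(2) by auto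
  then show False
  proof
    assume "n = d"
    then show False using umax[of n x1 x0 y l] n lev_sym y N d by auto
  next
    assume "d = l"
    then have "lev y x1 l" using lev_sym d by blast
    then obtain k s where "b ^ n * of_int k = b ^ l * of_int s" "\<not> p dvd k" "x0 - x1 = b ^ l * of_int s"
      by (rule isosceles[OF lev_sym[OF y(3)] _ n])
    then show False using far y(2) by blast
  qed
qed

text \<open>With positive valuation it is the smallest level in a triangle that occurs twice. A pair at level 1
and a pair at level 2 then produce a triangle with levels 1, 1 and 2, that is, an equation
\<open>b * k = s\<close> with integers \<open>k\<close> and \<open>s\<close>.\<close>

theorem base_rational:
  "\<exists>q h. h > 0 \<and> coprime q h \<and> p dvd q \<and> b = of_int q / of_int h"
proof -
  obtain e u v where euv: "e \<ge> 1" "b ^ e * of_int v = of_int u" "p dvd u" "\<not> p dvd v"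
    using valuation_positive by blast
  have nomin: False if f: "f \<ge> 1" and k: "\<not> p dvd k" and eq: "b ^ f * of_int s = of_int k" for f k s
  proof -
    have "of_int (u ^ f * s ^ e) = (b ^ e * of_int v) ^ f * real_of_int s ^ e" using euv by simp
    also have "\<dots> = (b ^ f * of_int s) ^ e * of_int v ^ f"
      by (simp add: power_mult_distrib power_mult[symmetric] mult.commute)
    also have "\<dots> = of_int (k ^ e * v ^ f)" using eq by simp
    finally have "u ^ f * s ^ e = k ^ e * v ^ f" by (metis of_int_eq_iff)
    moreover have "p dvd u ^ f" using euv f by (meson dvd_power dvd_trans less_le_trans zero_less_one)
    ultimately have "p dvd k ^ e * v ^ f" by (metis dvd_mult2)
    then show False using p k euv(4) by (auto simp: prime_dvd_mult_iff dest: prime_dvd_power)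
  qed
  have umin: False if H: "lev x y n" "lev x z n" "lev y z 1" "n > 1" for x y z n
  proof -
    obtain k s where ks: "b ^ 1 * of_int k = b ^ n * of_int s" "\<not> p dvd k" "y - z = b ^ n * of_int s"
      by (rule isosceles[OF H(1-3)])
    define f where "f = n - 1"
    have f: "n = 1 + f" "f \<ge> 1" using H(4) by (auto simp: f_def)
    have "b ^ f * of_int s = of_int k" using ks(1) b by (simp add: f power_add)
    then show False using nomin f ks by blast
  qed
  obtain w w' where w: "w \<in> X" "w' \<in> X" "lev w w' 1" using level_occurs[of 1] by auto
  obtain x x' where x: "x \<in> X" "x' \<in> X" "lev x x' 2" using level_occurs[of 2] by auto
  have "\<exists>y\<in>X. lev x y 1"
  proof (cases "x = w \<or> x = w'")
    case True then show ?thesis using w lev_sym by blast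
  next
    case False
    obtain a d where ad: "a \<ge> 1" "lev x w a" "d \<ge> 1" "lev x w' d" using level_ex False x w by metis
    show ?thesis
    proof (rule ccontr)
      assume "\<not> ?thesis"
      then have "a \<noteq> 1" "d \<noteq> 1" using ad w by auto
      moreover have "a = d" using triangle_two_equal[OF ad(2) w(3) ad(4)] calculation by auto
      ultimately show False using umin[of a x w w'] ad w by auto
    qed
  qed
  then obtain y where y: "y \<in> X" "lev x y 1" by blast
  have "x' \<noteq> y"
  proof
    assume "x' = y"
    then obtain k k' where "x - y = b ^ 2 * of_int k" "x - y = b * of_int k'" "\<not> p dvd k'"
      using x y unfolding unit_level_def by auto
    then have "b ^ 1 * of_int k = of_int k'" using b by (simp add: power2_eq_square)
    then show False using nomin[of 1 k' k] \<open>\<not> p dvd k'\<close> by simp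
  qed
  then obtain d where d: "lev x' y d" using level_ex x y by metis
  have "d = 1 \<or> d = 2" using triangle_two_equal[OF x(3) d y(2)] by auto
  then have "d = 1" using umin[of 2 x' x y] x lev_sym y d by auto
  then have "lev y x' 1" using lev_sym d by blast
  then obtain k s where ks: "b ^ 2 * of_int k = b ^ 1 * of_int s" "\<not> p dvd k" "x - x' = b ^ 1 * of_int s"
    by (rule isosceles[OF lev_sym[OF y(2)] _ x(3)])
  then have eq: "b * of_int k = of_int s" using b by (simp add: power2_eq_square)
  then have ps: "p dvd s" using no_unit_binomial[of 1 k s] ks(2) by auto
  have k0: "k \<noteq> 0" using ks(2) by auto
  define k' where "k' = \<bar>k\<bar>"
  define s' where "s' = sgn k * s"
  have k': "k' > 0" "\<not> p dvd k'" using k0 ks(2) by (auto simp: k'_def)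
  have ps': "p dvd s'" using ps by (simp add: s'_def)
  have eq': "b * of_int k' = of_int s'"
    using eq k0 by (cases "k > 0") (auto simp: k'_def s'_def sgn_if)
  define g where "g = gcd s' k'"
  define q where "q = s' div g"
  define h where "h = k' div g"
  have sg: "s' = g * q" "k' = g * h" by (simp_all add: g_def q_def h_def)
  have g0: "g > 0" using k'(1) by (simp add: g_def)
  have "\<not> p dvd g" using k'(2) sg(2) by auto
  then have "p dvd q" using ps' sg(1) p by (metis prime_dvd_mult_iff)
  moreover have "h > 0" using sg(2) g0 k'(1) by (metis zero_less_mult_pos)
  moreover have "coprime q h"
    unfolding q_def h_def g_def by (rule div_gcd_coprime) (use k'(1) in simp)
  moreover have "b = of_int q / of_int h"
    using eq' g0 \<open>h > 0\<close> unfolding sg by (simp add: field_simps)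
  ultimately show ?thesis by blast
qed

end

section \<open>Shears\<close>

text \<open>The \<open>n\<close>-th power of the transpose of the matrix with rows \<open>(b, c)\<close> and \<open>(0, b)\<close>. Negative \<open>n\<close> are
included, so that the powers form a one-parameter group.\<close>

definition shear :: "real \<Rightarrow> real \<Rightarrow> int \<Rightarrow> real^2 \<Rightarrow> real^2" where
  "shear b c n x = (b powi n) *\<^sub>R vector [x $ 1, x $ 2 + of_int n * (c / b) * x $ 1]"

lemma shear_1 [simp]: "shear b c n x $ 1 = b powi n * x $ 1"
  by (simp add: shear_def)

lemma shear_2: "shear b c n x $ 2 = b powi n * (x $ 2 + of_int n * (c / b) * x $ 1)"
  by (simp add: shear_def)

lemma vec2_eqI: "x $ 1 = y $ 1 \<Longrightarrow> x $ 2 = y $ 2 \<Longrightarrow> x = (y :: 'a^2)"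
  by (simp add: vec_eq_iff forall_2)

lemma shear_diff: "shear b c n (x - y) = shear b c n x - shear b c n y"
  by (rule vec2_eqI) (simp_all add: shear_2 algebra_simps)

lemma shear_add: "shear b c n (x + y) = shear b c n x + shear b c n y"
  by (rule vec2_eqI) (simp_all add: shear_2 algebra_simps)

lemma shear_zero [simp]: "shear b c n 0 = 0"
  by (rule vec2_eqI) (simp_all add: shear_2)

lemma shear_minus: "shear b c n (- x) = - shear b c n x"
  by (rule vec2_eqI) (simp_all add: shear_2 algebra_simps)

lemma shear_0 [simp]: "shear b c 0 x = x"
  by (rule vec2_eqI) (simp_all add: shear_2)

lemma shear_shear: "b \<noteq> 0 \<Longrightarrow> shear b c m (shear b c n x) = shear b c (m + n) x"
  by (rule vec2_eqI) (simp_all add: shear_2 power_int_add algebra_simps)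

lemma shear_contracts:
  assumes "b > 1"
  shows "(\<lambda>n. shear b c (- int n) x) \<longlonglongrightarrow> 0"
proof (rule vec_tendstoI)
  fix i :: 2
  have pw: "b powi (- int n) = (1 / b) ^ n" for n
    by (simp add: power_int_minus power_one_over inverse_eq_divide)
  have n0: "norm (1 / b) < 1" using assms by simp
  have l1: "(\<lambda>n. (1 / b) ^ n) \<longlonglongrightarrow> 0" using n0 by (rule LIMSEQ_power_zero)
  have l2: "(\<lambda>n. of_nat n * (1 / b) ^ n) \<longlonglongrightarrow> 0" using powser_times_n_limit_0[OF n0] by simp
  have "(\<lambda>n. (1 / b) ^ n * x $ 1) \<longlonglongrightarrow> 0" using tendsto_mult_left_zero[OF l1] .
  moreover have "(\<lambda>n. (1 / b) ^ n * x $ 2 - (of_nat n * (1 / b) ^ n) * ((c / b) * x $ 1)) \<longlonglongrightarrow> 0 - 0"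
    by (intro tendsto_diff tendsto_mult_left_zero l1 l2)
  ultimately show "(\<lambda>n. shear b c (- int n) x $ i) \<longlonglongrightarrow> (0 :: real^2) $ i"
    using exhaust_2[of i] by (auto simp: shear_2 pw algebra_simps)
qed

section \<open>Characters and masks\<close>

text \<open>The Fourier transform of the uniform measure on \<open>D\<close>; see \<open>fourier_delta_measure\<close>.\<close>

definition mask :: "(real^2) set \<Rightarrow> real^2 \<Rightarrow> complex" where
  "mask D \<xi> = (\<Sum>d\<in>D. exp_char \<xi> d) / of_nat (card D)"

lemma exp_char_cis: "exp_char \<xi> x = cis (- 2 * pi * (\<xi> \<bullet> x))"
  by (simp add: exp_char_def cis_conv_exp mult_ac)

lemma exp_char_add: "exp_char (\<xi> + \<eta>) x = exp_char \<xi> x * exp_char \<eta> x"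
  by (simp add: exp_char_cis cis_mult inner_add_left algebra_simps)

lemma exp_char_diff: "exp_char (\<xi> - \<eta>) x = exp_char \<xi> x * cnj (exp_char \<eta> x)"
  by (simp add: exp_char_cis cis_cnj cis_mult inner_diff_left algebra_simps)

lemma exp_char_minus: "exp_char (- \<xi>) x = cnj (exp_char \<xi> x)"
  by (simp add: exp_char_cis cis_cnj)

lemma exp_char_add_right: "exp_char \<xi> (x + y) = exp_char \<xi> x * exp_char \<xi> y"
  by (simp add: exp_char_cis cis_mult inner_add_right algebra_simps)

lemma exp_char_zero [simp]: "exp_char 0 x = 1"
  by (simp add: exp_char_def)

lemma norm_exp_char [simp]: "cmod (exp_char \<xi> x) = 1"
  by (simp add: exp_char_cis)

lemma exp_char_integer: "\<xi> \<bullet> x \<in> \<int> \<Longrightarrow> exp_char \<xi> x = 1"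
proof -
  assume "\<xi> \<bullet> x \<in> \<int>"
  then have "cis (2 * pi * (- (\<xi> \<bullet> x))) = 1" by (intro cis_multiple_2pi) simp
  then show ?thesis by (simp add: exp_char_cis)
qed

lemma int_lattice_iff: "z \<in> int_lattice \<longleftrightarrow> z $ 1 \<in> \<int> \<and> z $ 2 \<in> \<int>"
  by (simp add: int_lattice_def forall_2)

lemma int_lattice_inner: "z \<in> int_lattice \<Longrightarrow> d \<in> int_lattice \<Longrightarrow> z \<bullet> d \<in> \<int>"
  by (auto simp: int_lattice_iff inner_vec_def sum_2)

lemma int_lattice_diff: "x \<in> int_lattice \<Longrightarrow> y \<in> int_lattice \<Longrightarrow> x - y \<in> int_lattice"
  by (simp add: int_lattice_iff)

lemma mask_periodic:
  assumes "D \<subseteq> int_lattice" "z \<in> int_lattice"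
  shows "mask D (x + z) = mask D x"
proof -
  have "exp_char (x + z) d = exp_char x d" if "d \<in> D" for d
    using that assms by (simp add: exp_char_add exp_char_integer int_lattice_inner subset_iff)
  then show ?thesis by (simp add: mask_def)
qed

lemma mask_zero: "card D > 0 \<Longrightarrow> mask D 0 = 1"
  by (simp add: mask_def)

lemma norm_mask_le: "cmod (mask D x) \<le> 1"
proof -
  have "cmod (\<Sum>d\<in>D. exp_char x d) \<le> (\<Sum>d\<in>D. cmod (exp_char x d))" by (rule norm_sum)
  also have "\<dots> = card D" by simp
  finally show ?thesis unfolding mask_def norm_divide norm_of_nat
    by (cases "card D = 0") (simp_all add: divide_le_eq_1)
qed

lemma mask_minus: "mask D (- x) = cnj (mask D x)"
  by (simp add: mask_def exp_char_minus)

lemma continuous_mask: "continuous_on UNIV (mask D)"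
  unfolding mask_def exp_char_def divide_inverse by (intro continuous_intros)

section \<open>Positive definite functions\<close>

text \<open>Bessel's inequality is needed for products of dilated masks with and without a dilated Fourier
transform. All of them are Fourier transforms of convolutions, but positive definiteness gives the
inequality without constructing these measures. The index type has one element more than the plane
because the inequality is applied to an orthogonal family together with one further, possibly
repeated, point.\<close>

definition pos_def :: "(real^2 \<Rightarrow> complex) \<Rightarrow> bool" where
  "pos_def \<psi> \<longleftrightarrow> (\<forall>x. \<psi> (- x) = cnj (\<psi> x)) \<and>
     (\<forall>I :: (real^2) option set. finite I \<longrightarrow> (\<forall>x w.
        0 \<le> Re (\<Sum>i\<in>I. \<Sum>j\<in>I. w i * cnj (w j) * \<psi> (x i - x j))))"

lemma pos_defD:
  fixes I :: "(real^2) option set"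
  assumes "pos_def \<psi>" "finite I"
  shows "0 \<le> Re (\<Sum>i\<in>I. \<Sum>j\<in>I. w i * cnj (w j) * \<psi> (x i - x j))"
  using assms(1)[unfolded pos_def_def, THEN conjunct2, rule_format, OF assms(2)] .

lemma pos_def_minus: "pos_def \<psi> \<Longrightarrow> \<psi> (- x) = cnj (\<psi> x)"
  unfolding pos_def_def by simp

lemma pos_defI:
  assumes "\<And>x. \<psi> (- x) = cnj (\<psi> x)"
    and "\<And>I w x. finite (I :: (real^2) option set) \<Longrightarrow>
      0 \<le> Re (\<Sum>i\<in>I. \<Sum>j\<in>I. w i * cnj (w j) * \<psi> (x i - x j))"
  shows "pos_def \<psi>"
  unfolding pos_def_def by (intro conjI allI impI assms)

lemma pos_def_one: "pos_def (\<lambda>x. 1)"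
proof (rule pos_defI)
  fix I :: "(real^2) option set" and w :: "(real^2) option \<Rightarrow> complex"
  have "(\<Sum>i\<in>I. \<Sum>j\<in>I. w i * cnj (w j) * 1) = (\<Sum>i\<in>I. w i) * cnj (\<Sum>i\<in>I. w i)"
    by (simp add: sum_product)
  also have "Re \<dots> \<ge> 0"
  proof -
    have "0 \<le> Re (z * cnj z)" for z by simp
    then show ?thesis .
  qed
  finally show "0 \<le> Re (\<Sum>i\<in>I. \<Sum>j\<in>I. w i * cnj (w j) * 1)" .
qed simp

lemma pos_def_shear:
  assumes "pos_def \<psi>"
  shows "pos_def (\<lambda>x. \<psi> (shear b c n x))"
proof (rule pos_defI)
  show "\<psi> (shear b c n (- x)) = cnj (\<psi> (shear b c n x))" for x
    unfolding shear_minus by (rule pos_def_minus[OF assms])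
  show "0 \<le> Re (\<Sum>i\<in>I. \<Sum>j\<in>I. w i * cnj (w j) * \<psi> (shear b c n (x i - x j)))"
    if "finite I" for I :: "(real^2) option set" and w x
    unfolding shear_diff by (rule pos_defD[OF assms that])
qed

text \<open>Multiplication by a mask is an average of multiplications by characters, and a character is absorbed
into the coefficients of the quadratic form.\<close>

lemma pos_def_mask:
  assumes "pos_def \<psi>"
  shows "pos_def (\<lambda>x. mask D (shear b c n x) * \<psi> x)"
proof -
  let ?T = "shear b c n"
  have "0 \<le> Re (\<Sum>i\<in>I. \<Sum>j\<in>I. w i * cnj (w j) * (mask D (?T (x i - x j)) * \<psi> (x i - x j)))"
    if I: "finite I" for I :: "(real^2) option set" and x w
  proof -
    define N where "N = inverse (real (card D))"
    define v where "v = (\<lambda>d i. w i * exp_char (?T (x i)) d)"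
    have e: "w i * cnj (w j) * (mask D (?T (x i - x j)) * \<psi> (x i - x j))
        = of_real N * (\<Sum>d\<in>D. v d i * cnj (v d j) * \<psi> (x i - x j))" for i j
      by (simp add: mask_def N_def v_def shear_diff exp_char_diff sum_distrib_left sum_distrib_right
          divide_inverse mult_ac)
    have "(\<Sum>i\<in>I. \<Sum>j\<in>I. w i * cnj (w j) * (mask D (?T (x i - x j)) * \<psi> (x i - x j)))
       = of_real N * (\<Sum>i\<in>I. \<Sum>j\<in>I. \<Sum>d\<in>D. v d i * cnj (v d j) * \<psi> (x i - x j))"
      unfolding e by (simp add: sum_distrib_left)
    also have "(\<Sum>i\<in>I. \<Sum>j\<in>I. \<Sum>d\<in>D. v d i * cnj (v d j) * \<psi> (x i - x j))
       = (\<Sum>d\<in>D. \<Sum>i\<in>I. \<Sum>j\<in>I. v d i * cnj (v d j) * \<psi> (x i - x j))"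
      by (simp add: sum.swap[of _ D])
    also have "Re (of_real N * \<dots>) = N * (\<Sum>d\<in>D. Re (\<Sum>i\<in>I. \<Sum>j\<in>I. v d i * cnj (v d j) * \<psi> (x i - x j)))"
      by simp
    also have "\<dots> \<ge> 0"
      by (intro mult_nonneg_nonneg sum_nonneg pos_defD[OF assms I]) (simp add: N_def)
    finally show ?thesis .
  qed
  then show ?thesis
    by (rule pos_defI[rotated]) (simp_all add: shear_minus mask_minus pos_def_minus[OF assms])
qed

text \<open>For a Fourier transform \<open>\<psi>\<close> the left side is the squared norm of the character at \<open>\<xi>\<close> minus the
combination with coefficients \<open>v\<close> of the characters at \<open>F\<close>, and the right side is Pythagoras' theorem.\<close>

lemma quadratic_form_orthonormal:
  fixes \<psi> :: "real^2 \<Rightarrow> complex" and \<xi> :: "real^2" and v :: "real^2 \<Rightarrow> complex"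
  defines "x \<equiv> case_option \<xi> (\<lambda>l. l)" and "w \<equiv> case_option 1 (\<lambda>l. - v l)"
  assumes herm: "\<And>x. \<psi> (- x) = cnj (\<psi> x)" and one: "\<psi> 0 = 1" and F: "finite F"
    and orth: "\<And>x y. x \<in> F \<Longrightarrow> y \<in> F \<Longrightarrow> x \<noteq> y \<Longrightarrow> \<psi> (x - y) = 0"
  shows "(\<Sum>i\<in>insert None (Some ` F). \<Sum>j\<in>insert None (Some ` F). w i * cnj (w j) * \<psi> (x i - x j))
    = of_real (1 - (\<Sum>l\<in>F. (cmod (\<psi> (\<xi> - l)))\<^sup>2) + (\<Sum>l\<in>F. (cmod (v l - \<psi> (\<xi> - l)))\<^sup>2))"
proof -
  have diag: "(\<Sum>m\<in>F. v l * cnj (v m) * \<psi> (l - m)) = v l * cnj (v l)" if "l \<in> F" for l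
  proof -
    have "(\<Sum>m\<in>F. v l * cnj (v m) * \<psi> (l - m)) = (\<Sum>m\<in>F. if m = l then v l * cnj (v l) else 0)"
      by (intro sum.cong refl) (use orth that one in auto)
    then show ?thesis using F that by simp
  qed
  have herm': "\<psi> (l - \<xi>) = cnj (\<psi> (\<xi> - l))" for l
    using herm[of "\<xi> - l"] by simp
  have point: "- (cnj (v l) * \<psi> (\<xi> - l)) + (- (v l * cnj (\<psi> (\<xi> - l))) + v l * cnj (v l))
      = - of_real ((cmod (\<psi> (\<xi> - l)))\<^sup>2) + of_real ((cmod (v l - \<psi> (\<xi> - l)))\<^sup>2)" for l
    unfolding complex_norm_square by (simp add: algebra_simps)
  have "(\<Sum>i\<in>insert None (Some ` F). \<Sum>j\<in>insert None (Some ` F). w i * cnj (w j) * \<psi> (x i - x j))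
      = (1 - (\<Sum>l\<in>F. cnj (v l) * \<psi> (\<xi> - l)))
        + (\<Sum>l\<in>F. - (v l * \<psi> (l - \<xi>)) + (\<Sum>m\<in>F. v l * cnj (v m) * \<psi> (l - m)))"
    using F by (simp add: x_def w_def sum.reindex one sum_negf)
  also have "\<dots> = (1 - (\<Sum>l\<in>F. cnj (v l) * \<psi> (\<xi> - l)))
        + (\<Sum>l\<in>F. - (v l * cnj (\<psi> (\<xi> - l))) + v l * cnj (v l))"
    using diag herm' by (intro arg_cong2[of _ _ _ _ "(+)"] refl sum.cong) auto
  also have "\<dots> = 1 + (\<Sum>l\<in>F. - (cnj (v l) * \<psi> (\<xi> - l)) + (- (v l * cnj (\<psi> (\<xi> - l))) + v l * cnj (v l)))"
    by (simp add: sum.distrib sum_negf sum_subtractf)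
  also have "\<dots> = of_real (1 - (\<Sum>l\<in>F. (cmod (\<psi> (\<xi> - l)))\<^sup>2) + (\<Sum>l\<in>F. (cmod (v l - \<psi> (\<xi> - l)))\<^sup>2))"
    unfolding point by (simp add: sum.distrib sum_negf sum_subtractf)
  finally show ?thesis .
qed

lemma pos_def_bessel:
  assumes pd: "pos_def \<psi>" and one: "\<psi> 0 = 1" and F: "finite F"
    and orth: "\<And>x y. x \<in> F \<Longrightarrow> y \<in> F \<Longrightarrow> x \<noteq> y \<Longrightarrow> \<psi> (x - y) = 0"
  shows "(\<Sum>l\<in>F. (cmod (\<psi> (\<xi> - l)))\<^sup>2) \<le> 1"
proof -
  have "finite (insert None (Some ` F))" using F by simp
  note nonneg = pos_defD[OF pd this, of "case_option 1 (\<lambda>l. - \<psi> (\<xi> - l))" "case_option \<xi> (\<lambda>l. l)"]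
  have "0 \<le> Re (of_real (1 - (\<Sum>l\<in>F. (cmod (\<psi> (\<xi> - l)))\<^sup>2)
      + (\<Sum>l\<in>F. (cmod (\<psi> (\<xi> - l) - \<psi> (\<xi> - l)))\<^sup>2)))"
    by (subst quadratic_form_orthonormal[symmetric]) (use pos_def_minus[OF pd] one F orth nonneg in auto)
  then show ?thesis by simp
qed

definition orthogonal_for :: "(real^2 \<Rightarrow> complex) \<Rightarrow> (real^2) set \<Rightarrow> bool" where
  "orthogonal_for \<psi> \<Lambda> \<longleftrightarrow> (\<forall>x\<in>\<Lambda>. \<forall>y\<in>\<Lambda>. x \<noteq> y \<longrightarrow> \<psi> (x - y) = 0)"

text \<open>The sum of the squared values of \<open>\<psi>\<close> over \<open>\<xi> - \<Lambda>\<close> is at least 1, for every \<open>\<xi>\<close>. Finite subsets avoid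
any question of summability.\<close>

definition complete_for :: "(real^2 \<Rightarrow> complex) \<Rightarrow> (real^2) set \<Rightarrow> bool" where
  "complete_for \<psi> \<Lambda> \<longleftrightarrow>
     (\<forall>\<xi>. \<forall>\<epsilon>>0. \<exists>F. finite F \<and> F \<subseteq> \<Lambda> \<and> 1 - \<epsilon> < (\<Sum>l\<in>F. (cmod (\<psi> (\<xi> - l)))\<^sup>2))"

section \<open>Refinable functions\<close>

text \<open>What is used about the Fourier transform \<open>\<phi>\<close> of the self-affine measure. The refinement equation
makes \<open>\<phi>\<close> the infinite product of the masks at \<open>T (- n) x\<close>.\<close>

locale refinable =
  fixes p :: nat and b c :: real and D :: "(real^2) set" and a :: "real^2" and \<phi> :: "real^2 \<Rightarrow> complex"
  assumes prime_p: "prime p" and b: "b > 1" and D: "D \<subseteq> int_lattice" and card_D: "card D = p"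
    and a: "a \<in> int_lattice" "\<exists>k. a $ 1 = of_int k \<and> \<not> int p dvd k"
    and mask_zeros: "{\<xi>. mask D \<xi> = 0} =
      (\<Union>j\<in>{1..p - 1}. {(real j / real p) *\<^sub>R a + z | z. z \<in> int_lattice})"
    and uniformly_continuous_phi: "uniformly_continuous_on UNIV \<phi>" and phi_0: "\<phi> 0 = 1"
    and norm_phi_le: "cmod (\<phi> x) \<le> 1" and pos_def_phi: "pos_def \<phi>"
    and refine: "\<phi> x = mask D (shear b c (- 1) x) * \<phi> (shear b c (- 1) x)"
begin

abbreviation "m \<equiv> mask D"
abbreviation "T \<equiv> shear b c"

lemma continuous_phi: "continuous_on UNIV \<phi>"
  using uniformly_continuous_phi by (rule uniformly_continuous_imp_continuous)
lemma p_ge_2: "p \<ge> 2" using prime_p by (rule prime_ge_2_nat)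
lemma p_pos [simp]: "p > 0" using p_ge_2 by simp
lemma prime_int_p: "prime (int p)" using prime_p by simp
lemma b0 [simp]: "b \<noteq> 0" "b > 0" using b by auto
lemma finite_D: "finite D" using card_D p_pos card_gt_0_iff by metis
lemma m_0 [simp]: "m 0 = 1" using card_D by (simp add: mask_zero)
lemma m_periodic: "z \<in> int_lattice \<Longrightarrow> m (x + z) = m x" using D by (rule mask_periodic)
lemma T_T: "T i (T j x) = T (i + j) x" by (simp add: shear_shear)

lemma m_zero_iff: "m x = 0 \<longleftrightarrow> (\<exists>j\<in>{1..p - 1}. \<exists>z\<in>int_lattice. x = (real j / real p) *\<^sub>R a + z)"
proof -
  have "m x = 0 \<longleftrightarrow> x \<in> {\<xi>. m \<xi> = 0}" by simp
  then show ?thesis unfolding mask_zeros by auto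
qed

lemma m_zero_first:
  assumes "m x = 0"
  obtains k where "x $ 1 = of_int k / real p" "\<not> int p dvd k"
proof -
  obtain j z where j: "j \<in> {1..p - 1}" "z \<in> int_lattice" "x = (real j / real p) *\<^sub>R a + z"
    using assms m_zero_iff by blast
  obtain k where k: "a $ 1 = of_int k" "\<not> int p dvd k" using a by blast
  obtain l where l: "z $ 1 = of_int l" using j by (auto simp: int_lattice_iff elim: Ints_cases)
  have "x $ 1 = of_int (int j * k + int p * l) / real p"
    using k l j by (simp add: field_simps)
  moreover have "\<not> int p dvd int j * k + int p * l"
  proof
    assume "int p dvd int j * k + int p * l"
    then have "int p dvd int j * k" by (simp add: dvd_add_left_iff)
    then have "int p dvd int j" using k(2) prime_int_p by (simp add: prime_dvd_mult_iff)
    then have "p dvd j" by simp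
    then show False using j p_ge_2 by (auto dest: dvd_imp_le)
  qed
  ultimately show thesis using that by blast
qed

lemma m_zero_scaled: "m x = 0 \<Longrightarrow> real p *\<^sub>R x \<in> int_lattice"
proof -
  assume "m x = 0"
  then obtain j z where "z \<in> int_lattice" "x = (real j / real p) *\<^sub>R a + z"
    using m_zero_iff by blast
  then show ?thesis using a(1) by (simp add: int_lattice_iff distrib_left)
qed

text \<open>The residue \<open>j\<close> of a zero \<open>j a / p + z\<close> can be read off its first coordinate, since the first
coordinate of \<open>a\<close> is prime to \<open>p\<close>.\<close>

lemma m_zero_diff:
  assumes "m x = 0" "m y = 0" "x $ 1 - y $ 1 \<in> \<int>"
  shows "x - y \<in> int_lattice"
proof -
  obtain j z where j: "j \<in> {1..p - 1}" "z \<in> int_lattice" "x = (real j / real p) *\<^sub>R a + z"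
    using assms m_zero_iff by blast
  obtain j' z' where j': "j' \<in> {1..p - 1}" "z' \<in> int_lattice" "y = (real j' / real p) *\<^sub>R a + z'"
    using assms m_zero_iff by blast
  obtain k where k: "a $ 1 = of_int k" "\<not> int p dvd k" using a by blast
  have "(real j - real j') / real p * of_int k = (x $ 1 - y $ 1) - (z $ 1 - z' $ 1)"
    using k j j' by (simp add: algebra_simps diff_divide_distrib)
  also have "\<dots> \<in> \<int>"
  proof (rule Ints_diff[OF assms(3)])
    show "z $ 1 - z' $ 1 \<in> \<int>" using j(2) j'(2) by (simp add: int_lattice_iff)
  qed
  finally obtain l where "(real j - real j') / real p * of_int k = of_int l" by (auto elim: Ints_cases)
  then have "real_of_int ((int j - int j') * k) = of_int (int p * l)" by (simp add: field_simps)
  then have "(int j - int j') * k = int p * l" by linarith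
  then have "int p dvd (int j - int j') * k" by simp
  then have d: "int p dvd int j - int j'" using k(2) prime_int_p by (simp add: prime_dvd_mult_iff)
  have "j = j'"
  proof (rule ccontr)
    assume "j \<noteq> j'"
    then have "int p \<le> \<bar>int j - int j'\<bar>" using d by (simp add: zdvd_imp_le)
    then show False using j(1) j'(1) by auto
  qed
  then have "x - y = z - z'" using j j' by simp
  then show ?thesis using j(2) j'(2) by (simp add: int_lattice_diff)
qed

text \<open>Equality in the triangle inequality forces all characters \<open>exp_char x d\<close> to agree, so translation by
\<open>x\<close> maps zeros of the mask to zeros. The zeros together with the lattice form the group generated by
\<open>a / p\<close> and the lattice; moving \<open>a / p\<close> by \<open>x\<close> shows that \<open>x\<close> lies in this group, and \<open>x\<close> itself is
not a zero.\<close>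

lemma m_norm_one:
  assumes "cmod (m x) = 1"
  shows "x \<in> int_lattice"
proof -
  have eq: "exp_char x d = exp_char x d'" if d: "d \<in> D" "d' \<in> D" for d d'
  proof (cases "d = d'")
    case False
    let ?u = "exp_char x d" and ?v = "exp_char x d'"
    have "real p = cmod (\<Sum>d\<in>D. exp_char x d)"
      using assms card_D p_pos by (simp add: mask_def norm_divide field_simps)
    also have "(\<Sum>d\<in>D. exp_char x d) = (?u + ?v) + (\<Sum>d\<in>D - {d, d'}. exp_char x d)"
    proof -
      have "(\<Sum>d\<in>D. exp_char x d) = (\<Sum>d\<in>{d, d'}. exp_char x d) + (\<Sum>d\<in>D - {d, d'}. exp_char x d)"
        using d finite_D by (subst sum.subset_diff[of "{d, d'}"]) auto
      then show ?thesis using False by simp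
    qed
    also have "cmod \<dots> \<le> cmod (?u + ?v) + (\<Sum>d\<in>D - {d, d'}. cmod (exp_char x d))"
      by (intro order_trans[OF norm_triangle_ineq] add_left_mono norm_sum)
    also have "(\<Sum>d\<in>D - {d, d'}. cmod (exp_char x d)) = real p - 2"
      using d False finite_D card_D p_ge_2 by (simp add: card_Diff_subset of_nat_diff)
    finally have "2 \<le> cmod (?u + ?v)" by simp
    then have "4 \<le> (cmod (?u + ?v))\<^sup>2" using power_mono[of 2 _ 2] by fastforce
    moreover have "(cmod (?u + ?v))\<^sup>2 + (cmod (?u - ?v))\<^sup>2 = 2 * (cmod ?u)\<^sup>2 + 2 * (cmod ?v)\<^sup>2"
      unfolding cmod_power2 by (simp add: power2_eq_square algebra_simps)
    then have "(cmod (?u + ?v))\<^sup>2 + (cmod (?u - ?v))\<^sup>2 = 4" by simp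
    ultimately have "(cmod (?u - ?v))\<^sup>2 \<le> 0" by linarith
    then show ?thesis by simp
  qed simp
  have "D \<noteq> {}" using card_D p_ge_2 by auto
  then obtain d0 where d0: "d0 \<in> D" by blast
  have shift: "m (x + y) = exp_char x d0 * m y" for y
  proof -
    have "(\<Sum>d\<in>D. exp_char (x + y) d) = (\<Sum>d\<in>D. exp_char x d0 * exp_char y d)"
    proof (rule sum.cong[OF refl])
      fix d assume "d \<in> D"
      from eq[OF this d0] show "exp_char (x + y) d = exp_char x d0 * exp_char y d"
        by (simp add: exp_char_add)
    qed
    then show ?thesis by (simp add: mask_def sum_distrib_left)
  qed
  have one: "1 \<in> {1..p - 1}" "(0 :: real^2) \<in> int_lattice" using p_ge_2 by (auto simp: int_lattice_iff)
  have "(1 / real p) *\<^sub>R a = (real 1 / real p) *\<^sub>R a + 0" by simp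
  then have "m ((1 / real p) *\<^sub>R a) = 0" unfolding m_zero_iff using one by blast
  then have "m (x + (1 / real p) *\<^sub>R a) = 0" by (simp add: shift)
  then obtain j z where j: "j \<in> {1..p - 1}" "z \<in> int_lattice"
    "x + (1 / real p) *\<^sub>R a = (real j / real p) *\<^sub>R a + z" unfolding m_zero_iff by blast
  have "x = (real j / real p) *\<^sub>R a + z - (1 / real p) *\<^sub>R a" using j(3) by (simp add: eq_diff_eq)
  also have "\<dots> = (real (j - 1) / real p) *\<^sub>R a + z"
    using j(1) by (simp add: of_nat_diff diff_divide_distrib scaleR_diff_left)
  finally have x: "x = (real (j - 1) / real p) *\<^sub>R a + z" .
  show ?thesis
  proof (cases "j = 1")
    case True then show ?thesis using x j by simp
  next
    case False
    then have "j - 1 \<in> {1..p - 1}" using j(1) by auto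
    then have "m x = 0" unfolding m_zero_iff using j(2) x by blast
    then show ?thesis using assms by simp
  qed
qed

section \<open>Finite products and levels of zeros\<close>

text \<open>The Fourier transform of the \<open>n\<close>-th approximation of the self-affine measure: the first \<open>n\<close> factors
of the infinite product for \<open>\<phi>\<close>.\<close>

definition M :: "nat \<Rightarrow> real^2 \<Rightarrow> complex" where
  "M n x = (\<Prod>i<n. m (T (- int (Suc i)) x))"

lemma M_0 [simp]: "M 0 x = 1" by (simp add: M_def)
lemma M_Suc: "M (Suc n) x = M n x * m (T (- int (Suc n)) x)" by (simp add: M_def)
lemma M_at_0 [simp]: "M n 0 = 1" by (simp add: M_def)

lemma phi_M: "\<phi> x = M n x * \<phi> (T (- int n) x)"
proof (induction n)
  case (Suc n)
  have "\<phi> (T (- int n) x) = m (T (- int (Suc n)) x) * \<phi> (T (- int (Suc n)) x)"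
    using refine[of "T (- int n) x"] by (simp add: T_T)
  then show ?case using Suc by (simp add: M_Suc)
qed simp

lemma pos_def_M: "pos_def \<psi> \<Longrightarrow> pos_def (\<lambda>x. M n x * \<psi> x)"
proof (induction n arbitrary: \<psi>)
  case (Suc n)
  have "pos_def (\<lambda>x. M n x * (m (T (- int (Suc n)) x) * \<psi> x))"
    by (rule Suc.IH) (rule pos_def_mask[OF Suc.prems])
  then show ?case by (simp add: M_Suc mult.assoc)
qed simp

definition level :: "nat \<Rightarrow> real^2 \<Rightarrow> bool" where
  "level n x \<longleftrightarrow> m (T (- int n) x) = 0"

lemma level_minus: "level n (- x) = level n x"
  by (simp add: level_def shear_minus mask_minus)

lemma level_commute: "level n (x - y) \<Longrightarrow> level n (y - x)"
  using level_minus[of n "x - y"] by simp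

lemma level_M: "1 \<le> n \<Longrightarrow> n \<le> k \<Longrightarrow> level n x \<Longrightarrow> M k x = 0"
  unfolding M_def level_def by (intro prod_zero bexI[of _ "n - 1"]) auto

lemma level_phi: "1 \<le> n \<Longrightarrow> level n x \<Longrightarrow> \<phi> x = 0"
  using phi_M[of x n] level_M[of n n x] by simp

lemma M_zero_level: "M k x = 0 \<Longrightarrow> \<exists>n. 1 \<le> n \<and> n \<le> k \<and> level n x"
  unfolding M_def level_def by (auto intro: exI[of _ "Suc _"] simp: Suc_le_eq)

lemma phi_near_0: "\<exists>e>0. \<forall>x. norm x < e \<longrightarrow> \<phi> x \<noteq> 0"
proof -
  have "isCont \<phi> 0" using continuous_phi by (simp add: continuous_on_eq_continuous_at)
  then obtain e where "e > 0" "\<forall>y. dist 0 y < e \<longrightarrow> \<phi> y \<noteq> 0"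
    using continuous_at_avoid[of 0 \<phi> 0] phi_0 by auto
  then show ?thesis by (auto simp: dist_norm)
qed

text \<open>Since \<open>T (- n) x\<close> tends to 0 and \<open>\<phi>\<close> does not vanish near 0, a zero of \<open>\<phi>\<close> is a zero of one of the
factors.\<close>

lemma phi_zero_level:
  assumes "\<phi> x = 0"
  obtains n where "n \<ge> 1" "level n x"
proof -
  obtain e where e: "e > 0" "\<And>x. norm x < e \<Longrightarrow> \<phi> x \<noteq> 0" using phi_near_0 by blast
  have "eventually (\<lambda>n. dist (T (- int n) x) 0 < e) sequentially"
    using shear_contracts[OF b, of c x] e(1) by (rule tendstoD)
  then obtain n where "norm (T (- int n) x) < e" by (auto simp: eventually_sequentially dist_norm)
  then have "M n x = 0" using e(2) phi_M[of x n] assms by simp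
  then show thesis using M_zero_level that by blast
qed

lemma level_first:
  assumes "level n x"
  obtains k where "real p * x $ 1 = b ^ n * of_int k" "\<not> int p dvd k"
proof -
  obtain k where k: "T (- int n) x $ 1 = of_int k / real p" "\<not> int p dvd k"
    using m_zero_first assms unfolding level_def by blast
  then have "real p * x $ 1 = b ^ n * of_int k"
    by (simp add: power_int_minus field_simps)
  with k that show thesis by blast
qed

text \<open>A small vector along the first axis: its images under \<open>T (- n)\<close> have first coordinate strictly between 0
and 1 and hence avoid the lattice. Adding it to a point of a spectrum makes inequalities strict.\<close>

lemma generic_shift:
  obtains \<eta> where "\<phi> \<eta> \<noteq> 0" "\<And>n. cmod (m (T (- int n) \<eta>)) < 1"
proof -
  obtain e where e: "e > 0" "\<And>x. norm x < e \<Longrightarrow> \<phi> x \<noteq> 0" using phi_near_0 by blast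
  define t where "t = min (1 / 2) (e / 2)"
  define \<eta> :: "real^2" where "\<eta> = t *\<^sub>R axis 1 1"
  have t: "0 < t" "t < 1" "t < e" using e(1) by (auto simp: t_def min_def)
  have "norm \<eta> = t" using t by (simp add: \<eta>_def norm_axis_1)
  then have "\<phi> \<eta> \<noteq> 0" using e t by simp
  moreover have "cmod (m (T (- int n) \<eta>)) < 1" for n
  proof -
    have e1: "T (- int n) \<eta> $ 1 = t / b ^ n" by (simp add: \<eta>_def axis_def power_int_minus field_simps)
    have "1 \<le> b ^ n" using b by simp
    then have "t < b ^ n" using t by linarith
    then have "0 < t / b ^ n" "t / b ^ n < 1" using t b by (auto simp: divide_less_eq)
    have "T (- int n) \<eta> $ 1 \<notin> \<int>"
    proof
      assume "T (- int n) \<eta> $ 1 \<in> \<int>"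
      then obtain z where "t / b ^ n = of_int z" unfolding e1 by (rule Ints_cases)
      then have "0 < real_of_int z" "real_of_int z < 1"
        using \<open>0 < t / b ^ n\<close> \<open>t / b ^ n < 1\<close> by linarith+
      then show False by simp
    qed
    then have "T (- int n) \<eta> \<notin> int_lattice" by (simp add: int_lattice_iff)
    then show ?thesis
      using m_norm_one[of "T (- int n) \<eta>"] norm_mask_le[of D "T (- int n) \<eta>"] by (auto simp: less_le)
  qed
  ultimately show thesis using that by blast
qed

end

section \<open>Levels in a spectrum\<close>

locale refinable_spectrum = refinable +
  fixes \<Lambda> :: "(real^2) set"
  assumes orthogonal: "orthogonal_for \<phi> \<Lambda>" and complete: "complete_for \<phi> \<Lambda>"
begin

lemma phi_diff_zero: "x \<in> \<Lambda> \<Longrightarrow> y \<in> \<Lambda> \<Longrightarrow> x \<noteq> y \<Longrightarrow> \<phi> (x - y) = 0"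
  using orthogonal by (simp add: orthogonal_for_def)

lemma level_exists:
  assumes "x \<in> \<Lambda>" "y \<in> \<Lambda>" "x \<noteq> y"
  obtains n where "n \<ge> 1" "level n (x - y)"
  by (rule phi_zero_level[OF phi_diff_zero[OF assms]]) (rule that)

lemma complete_bound_one:
  assumes "\<And>F. finite F \<Longrightarrow> F \<subseteq> \<Lambda> \<Longrightarrow> (\<Sum>l\<in>F. (cmod (\<phi> (\<xi> - l)))\<^sup>2) \<le> 1 - \<tau>"
  shows "\<tau> \<le> 0"
proof (rule ccontr)
  assume "\<not> ?thesis"
  then obtain F where "finite F" "F \<subseteq> \<Lambda>" "1 - \<tau> < (\<Sum>l\<in>F. (cmod (\<phi> (\<xi> - l)))\<^sup>2)"
    using complete unfolding complete_for_def by (metis not_le)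
  with assms[of F] show False by simp
qed

lemma spectrum_nonempty: "\<Lambda> \<noteq> {}"
proof
  assume e: "\<Lambda> = {}"
  have "(1 :: real) \<le> 0"
  proof (rule complete_bound_one)
    fix F assume "finite F" "F \<subseteq> \<Lambda>"
    then show "(\<Sum>l\<in>F. (cmod (\<phi> (0 - l)))\<^sup>2) \<le> 1 - 1" using e by simp
  qed
  then show False by simp
qed

text \<open>Drop the factor of level \<open>n\<close> from the product for \<open>\<phi>\<close>. If every pair of points of the spectrum had a
level other than \<open>n\<close>, the spectrum would be orthogonal for the remaining product \<open>\<psi>\<close>. Bessel's
inequality for \<open>\<psi>\<close> then contradicts completeness, because the dropped factor is smaller than 1 in
absolute value near any point of the spectrum.\<close>

lemma every_level_essential:
  assumes "n \<ge> 1"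
  obtains x y where "x \<in> \<Lambda>" "y \<in> \<Lambda>" "x \<noteq> y" "level n (x - y)"
    "\<And>n'. n' \<ge> 1 \<Longrightarrow> level n' (x - y) \<Longrightarrow> n' = n"
proof (rule ccontr)
  assume "\<not> thesis"
  with that have other: "\<exists>n'\<ge>1. n' \<noteq> n \<and> level n' (x - y)" if "x \<in> \<Lambda>" "y \<in> \<Lambda>" "x \<noteq> y" for x y
    using that level_exists by metis
  obtain k where k: "n = Suc k" using assms by (cases n) auto
  define \<psi> where "\<psi> = (\<lambda>x. M k x * \<phi> (T (- int n) x))"
  have phi: "\<phi> x = m (T (- int n) x) * \<psi> x" for x
    using phi_M[of x n] by (simp add: k M_Suc \<psi>_def mult_ac)
  have psi0: "\<psi> (x - y) = 0" if xy: "x \<in> \<Lambda>" "y \<in> \<Lambda>" "x \<noteq> y" for x y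
  proof -
    obtain n' where n': "n' \<ge> 1" "n' \<noteq> n" "level n' (x - y)" using other[OF xy] by blast
    show ?thesis
    proof (cases "n' \<le> k")
      case True
      then show ?thesis using level_M[of n' k] n' by (simp add: \<psi>_def)
    next
      case False
      then have "level (n' - n) (T (- int n) (x - y))"
        using n' k by (simp add: level_def T_T of_nat_diff)
      then have "\<phi> (T (- int n) (x - y)) = 0"
        using False n' k level_phi[of "n' - n"] by simp
      then show ?thesis by (simp add: \<psi>_def)
    qed
  qed
  have bessel: "(\<Sum>l\<in>F. (cmod (\<psi> (\<xi> - l)))\<^sup>2) \<le> 1" if "finite F" "F \<subseteq> \<Lambda>" for F \<xi>
  proof (rule pos_def_bessel)
    show "pos_def \<psi>" unfolding \<psi>_def by (intro pos_def_M pos_def_shear pos_def_phi)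
    show "\<psi> 0 = 1" by (simp add: \<psi>_def phi_0)
    show "\<psi> (x - y) = 0" if "x \<in> F" "y \<in> F" "x \<noteq> y" for x y
      using psi0 that \<open>F \<subseteq> \<Lambda>\<close> by blast
  qed fact
  obtain l0 where l0: "l0 \<in> \<Lambda>" using spectrum_nonempty by blast
  obtain \<eta> where \<eta>: "\<phi> \<eta> \<noteq> 0" "\<And>n. cmod (m (T (- int n) \<eta>)) < 1" using generic_shift by blast
  define \<xi> where "\<xi> = l0 + \<eta>"
  define \<tau> where "\<tau> = (cmod (\<psi> \<eta>))\<^sup>2 - (cmod (\<phi> \<eta>))\<^sup>2"
  have le: "(cmod (\<phi> x))\<^sup>2 \<le> (cmod (\<psi> x))\<^sup>2" for x
    unfolding phi norm_mult power_mult_distrib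
    by (rule mult_left_le_one_le) (auto simp: norm_mask_le power_le_one)
  have "\<psi> \<eta> \<noteq> 0" using \<eta>(1) phi[of \<eta>] by auto
  then have "(cmod (\<phi> \<eta>))\<^sup>2 < (cmod (\<psi> \<eta>))\<^sup>2"
    unfolding phi[of \<eta>] norm_mult using \<eta>(2)[of n]
    by (intro power_strict_mono) auto
  then have "\<tau> > 0" by (simp add: \<tau>_def)
  moreover have "\<tau> \<le> 0"
  proof (rule complete_bound_one[of \<xi>])
    fix F assume F: "finite F" "F \<subseteq> \<Lambda>"
    let ?G = "insert l0 F"
    have "(\<Sum>l\<in>F. (cmod (\<phi> (\<xi> - l)))\<^sup>2) \<le> (\<Sum>l\<in>?G. (cmod (\<phi> (\<xi> - l)))\<^sup>2)"
      using F by (intro sum_mono2) auto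
    also have "\<dots> = (cmod (\<phi> \<eta>))\<^sup>2 + (\<Sum>l\<in>?G - {l0}. (cmod (\<phi> (\<xi> - l)))\<^sup>2)"
      using F by (subst sum.remove[of _ l0]) (auto simp: \<xi>_def)
    also have "\<dots> \<le> (cmod (\<phi> \<eta>))\<^sup>2 + (\<Sum>l\<in>?G - {l0}. (cmod (\<psi> (\<xi> - l)))\<^sup>2)"
      by (intro add_left_mono sum_mono le)
    also have "\<dots> = (\<Sum>l\<in>?G. (cmod (\<psi> (\<xi> - l)))\<^sup>2) - \<tau>"
      using F by (subst (2) sum.remove[of _ l0]) (auto simp: \<xi>_def \<tau>_def)
    also have "\<dots> \<le> 1 - \<tau>" using bessel[of ?G \<xi>] F l0 by simp
    finally show "(\<Sum>l\<in>F. (cmod (\<phi> (\<xi> - l)))\<^sup>2) \<le> 1 - \<tau>" .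
  qed
  ultimately show False by simp
qed

text \<open>Infinitely many levels are each the only level of some pair.\<close>

lemma spectrum_infinite: "infinite \<Lambda>"
proof
  assume fin: "finite \<Lambda>"
  define P where "P n z \<longleftrightarrow> z \<in> \<Lambda> \<times> \<Lambda> \<and> (\<forall>n'\<ge>1. level n' (fst z - snd z) \<longleftrightarrow> n' = n)" for n z
  have "\<exists>z. P n z" if n1: "n \<ge> 1" for n
  proof -
    obtain x y where "x \<in> \<Lambda>" "y \<in> \<Lambda>" "level n (x - y)"
      "\<And>n'. n' \<ge> 1 \<Longrightarrow> level n' (x - y) \<Longrightarrow> n' = n" using every_level_essential[OF n1] by metis
    then have "P n (x, y)" by (auto simp: P_def)
    then show ?thesis by blast
  qed
  then obtain f where f: "P n (f n)" if "n \<ge> 1" for n by metis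
  have "inj_on f {1..}"
  proof (rule inj_onI)
    fix n n' :: nat assume n: "n \<in> {1..}" "n' \<in> {1..}" "f n = f n'"
    then have "P n (f n)" "P n' (f n)" using f[of n] f[of n'] by auto
    then show "n = n'" using n unfolding P_def by (metis atLeast_iff)
  qed
  moreover have "f ` {1..} \<subseteq> \<Lambda> \<times> \<Lambda>" using f unfolding P_def by (meson atLeast_iff image_subsetI)
  ultimately have "finite {1::nat..}" using fin by (meson finite_SigmaI inj_on_finite)
  then show False by (simp add: infinite_Ici)
qed

definition first_coords :: "real set" where
  "first_coords = (\<lambda>x. real p * x $ 1) ` \<Lambda>"

lemma level_unit_level: "level n (x - y) \<Longrightarrow> unit_level b (int p) n (real p * x $ 1 - real p * y $ 1)"
proof -
  assume "level n (x - y)"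
  then obtain k where k: "real p * (x - y) $ 1 = b ^ n * of_int k" "\<not> int p dvd k" by (rule level_first)
  have "real p * x $ 1 - real p * y $ 1 = b ^ n * of_int k" using k(1) by (simp add: right_diff_distrib)
  then show ?thesis unfolding unit_level_def using k(2) by blast
qed

lemma first_inj:
  assumes "x \<in> \<Lambda>" "y \<in> \<Lambda>" "x \<noteq> y"
  shows "x $ 1 \<noteq> y $ 1"
proof -
  obtain n where "level n (x - y)" using level_exists[OF assms] by blast
  from unit_level_nonzero[OF b0(2) level_unit_level[OF this]] show ?thesis by auto
qed

lemma base_rational:
  obtains q h where "h > 0" "coprime q h" "int p dvd q" "b = of_int q / of_int h"
proof -
  interpret unit_tree b "int p" first_coords
  proof
    show "prime (int p)" by (rule prime_int_p)
    show "b > 1" by (rule b)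
    have "inj_on (\<lambda>x. real p * x $ 1) \<Lambda>"
      using first_inj p_pos by (intro inj_onI) (metis mult_left_cancel of_nat_0_less_iff less_irrefl)
    then show "infinite first_coords"
      unfolding first_coords_def using spectrum_infinite finite_imageD by blast
    show "\<exists>n\<ge>1. unit_level b (int p) n (x - y)" if xy: "x \<in> first_coords" "y \<in> first_coords" "x \<noteq> y" for x y
    proof -
      obtain u v where uv: "x = real p * u $ 1" "y = real p * v $ 1" "u \<in> \<Lambda>" "v \<in> \<Lambda>"
        using xy by (auto simp: first_coords_def)
      then have "u \<noteq> v" using xy by auto
      then obtain n where "n \<ge> 1" "level n (u - v)" using level_exists uv by metis
      then show ?thesis using level_unit_level uv by blast
    qed
    show "\<exists>x\<in>first_coords. \<exists>y\<in>first_coords. unit_level b (int p) n (x - y)" if n: "n \<ge> 1" for n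
    proof -
      obtain u v where "u \<in> \<Lambda>" "v \<in> \<Lambda>" "level n (u - v)"
        using every_level_essential[OF n] by metis
      then show ?thesis using level_unit_level unfolding first_coords_def by blast
    qed
  qed
  show thesis using base_rational that by blast
qed

end

text \<open>From here on the base is a fraction in lowest terms whose numerator is divisible by \<open>p\<close>, as the
preceding lemma provides.\<close>

locale rational_spectrum = refinable_spectrum +
  fixes q h :: int
  assumes h_pos: "h > 0" and coprime_qh: "coprime q h" and p_dvd_q: "int p dvd q"
    and b_eq: "b = of_int q / of_int h"
begin

lemma p_not_dvd_h: "\<not> int p dvd h"
proof
  assume "int p dvd h"
  from coprime_common_divisor[OF coprime_qh p_dvd_q this] show False
    using prime_int_p not_prime_unit by blast
qed

lemma b_h: "b * of_int h = of_int q"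
  unfolding b_eq using h_pos by simp

lemma b_pow_h: "b ^ n * of_int h ^ n = of_int q ^ n"
  by (simp only: power_mult_distrib[symmetric] b_h)

lemma q_pos: "q > 0"
proof -
  have "0 < b * of_int h" using h_pos by simp
  then show ?thesis using b_h by simp
qed

text \<open>The \<open>p\<close>-adic ultrametric inequality, with denominators cleared.\<close>

lemma unique_min:
  assumes f: "f \<ge> 1" and g: "g \<ge> 1" and eq: "of_int k1 = b ^ f * of_int k2 + b ^ g * of_int k3"
  shows "int p dvd k1"
proof -
  have "real_of_int (k1 * h ^ (f + g)) = (b ^ f * of_int k2 + b ^ g * of_int k3) * (of_int h ^ f * of_int h ^ g)"
    using eq by (simp add: power_add)
  also have "\<dots> = (b ^ f * of_int h ^ f) * of_int h ^ g * of_int k2 + (b ^ g * of_int h ^ g) * of_int h ^ f * of_int k3"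
    by (simp add: algebra_simps)
  also have "\<dots> = of_int (q ^ f * h ^ g * k2 + q ^ g * h ^ f * k3)"
    by (simp add: b_pow_h)
  finally have "k1 * h ^ (f + g) = q ^ f * h ^ g * k2 + q ^ g * h ^ f * k3" by linarith
  moreover have "int p dvd q ^ f" "int p dvd q ^ g"
    using p_dvd_q f g by (meson dvd_power dvd_trans less_le_trans zero_less_one)+
  ultimately have "int p dvd k1 * h ^ (f + g)" by simp
  then show ?thesis using prime_int_p p_not_dvd_h by (metis prime_dvd_mult_iff prime_dvd_power)
qed

lemma triangle_min:
  assumes "level n1 (x - y)" "level n2 (y - z)" "level n3 (x - z)" and n: "n3 < n1" "n3 < n2"
  shows False
proof -
  obtain k1 where k1: "real p * (x - y) $ 1 = b ^ n1 * of_int k1" using level_first[OF assms(1)] by blast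
  obtain k2 where k2: "real p * (y - z) $ 1 = b ^ n2 * of_int k2" using level_first[OF assms(2)] by blast
  obtain k3 where k3: "real p * (x - z) $ 1 = b ^ n3 * of_int k3" "\<not> int p dvd k3"
    using level_first[OF assms(3)] by blast
  define f where "f = n1 - n3"
  define g where "g = n2 - n3"
  have fg: "n1 = n3 + f" "n2 = n3 + g" "f \<ge> 1" "g \<ge> 1" using n by (auto simp: f_def g_def)
  have "b ^ n3 * of_int k3 = b ^ n1 * of_int k1 + b ^ n2 * of_int k2"
    using k1 k2 k3 by (simp add: algebra_simps)
  also have "\<dots> = b ^ n3 * (b ^ f * of_int k1 + b ^ g * of_int k2)"
    by (simp add: fg power_add algebra_simps)
  finally have "of_int k3 = b ^ f * of_int k1 + b ^ g * of_int k2" using b by simp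
  then show False using unique_min fg k3(2) by blast
qed

lemma level_unique:
  assumes "level n x" "level n' x"
  shows "n = n'"
proof -
  have less: False if l: "level n x" "level n' x" "n' < n" for n n'
  proof -
    obtain k where k: "real p * x $ 1 = b ^ n * of_int k" using level_first[OF l(1)] by blast
    obtain k' where k': "real p * x $ 1 = b ^ n' * of_int k'" "\<not> int p dvd k'"
      using level_first[OF l(2)] by blast
    define f where "f = n - n'"
    have f: "n = n' + f" "f \<ge> 1" using l(3) by (auto simp: f_def)
    have "b ^ n' * of_int k' = b ^ n' * (b ^ f * of_int k)" using k k' by (simp add: f power_add)
    then have "of_int k' = b ^ f * of_int k + b ^ f * of_int 0" using b by simp
    then show False using unique_min f k'(2) by blast
  qed
  then show ?thesis using assms less[of n n'] less[of n' n] by (meson nat_neq_iff)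
qed

lemma level_one_neighbour:
  assumes x: "x \<in> \<Lambda>"
  obtains w where "w \<in> \<Lambda>" "level 1 (x - w)"
proof -
  obtain u v where uv: "u \<in> \<Lambda>" "v \<in> \<Lambda>" "level 1 (u - v)"
    using every_level_essential[of 1] by (metis order_refl)
  show thesis
  proof (cases "x = u \<or> x = v")
    case True then show thesis using uv that level_commute by blast
  next
    case False
    obtain n where n: "n \<ge> 1" "level n (u - x)" using level_exists uv x False by metis
    obtain n' where n': "n' \<ge> 1" "level n' (x - v)" using level_exists uv x False by metis
    have "\<not> (1 < n \<and> 1 < n')" using triangle_min[OF n(2) n'(2) uv(3)] by blast
    then have "n = 1 \<or> n' = 1" using n n' by auto
    then show thesis using that uv n n' level_commute by blast
  qed
qed

text \<open>Choose \<open>w\<close> at level 1 from \<open>x\<close>. By the ultrametric property \<open>w\<close> is at level 1 from \<open>y\<close> too, so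
\<open>T (- 1) (x - y)\<close> is a difference of two zeros of the mask. Its first coordinate is an integer
because the numerator of \<open>b\<close> is divisible by \<open>p\<close>, and so both zeros have the same residue.\<close>

lemma deep_level_integral:
  assumes x: "x \<in> \<Lambda>" and y: "y \<in> \<Lambda>" and lev: "level n (x - y)" and n: "n \<ge> 2"
  shows "T (- 1) (x - y) \<in> int_lattice"
proof -
  obtain w where w: "w \<in> \<Lambda>" "level 1 (x - w)" by (rule level_one_neighbour[OF x])
  have "w \<noteq> y" using level_unique[OF lev] w(2) n by fastforce
  then obtain l where l: "l \<ge> 1" "level l (y - w)" using level_exists y w by metis
  have "l = 1"
  proof (rule ccontr)
    assume "l \<noteq> 1"
    then show False using triangle_min[OF lev l(2) w(2)] n l by simp
  qed
  then have yw: "m (T (- 1) (y - w)) = 0" using l(2) unfolding level_def by simp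
  have xw: "m (T (- 1) (x - w)) = 0" using w(2) unfolding level_def by simp
  have diff: "T (- 1) (x - w) - T (- 1) (y - w) = T (- 1) (x - y)"
    unfolding shear_diff[symmetric] by simp
  obtain k1 where k1: "T (- 1) (x - w) $ 1 = of_int k1 / real p" using m_zero_first[OF xw] by blast
  obtain k2 where k2: "T (- 1) (y - w) $ 1 = of_int k2 / real p" using m_zero_first[OF yw] by blast
  obtain k where k: "real p * (x - y) $ 1 = b ^ n * of_int k" using level_first[OF lev] by blast
  have d1: "T (- 1) (x - y) $ 1 = of_int (k1 - k2) / real p"
    unfolding diff[symmetric] vector_minus_component k1 k2 by (simp add: diff_divide_distrib)
  have "(x - y) $ 1 = b * (T (- 1) (x - y) $ 1)" by (simp add: power_int_minus)
  then have "real p * (x - y) $ 1 = b * of_int (k1 - k2)" unfolding d1 using p_ge_2 by simp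
  then have "b * of_int (k1 - k2) = b ^ n * of_int k" using k by simp
  moreover have "b ^ n = b * b ^ (n - 1)" using n by (cases n) auto
  ultimately have "of_int (k1 - k2) = b ^ (n - 1) * of_int k + b ^ (n - 1) * of_int 0" by simp
  then have "int p dvd k1 - k2" by (rule unique_min[rotated 2]) (use n in auto)
  then obtain t where "k1 - k2 = int p * t" by blast
  then have "T (- 1) (x - y) $ 1 = of_int t" unfolding d1 using p_ge_2 by simp
  then have "T (- 1) (x - w) $ 1 - T (- 1) (y - w) $ 1 \<in> \<int>"
    by (metis Ints_of_int diff vector_minus_component)
  then have "T (- 1) (x - w) - T (- 1) (y - w) \<in> int_lattice" by (rule m_zero_diff[OF xw yw])
  then show ?thesis by (simp add: diff)
qed

text \<open>Integrality of \<open>T (- 1) (x - y)\<close> forces the denominator of \<open>b\<close> to divide the unit part of the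
difference, to the power \<open>n - 1\<close>. So points at level \<open>n\<close> are not only \<open>b\<close> to the power \<open>n\<close> apart but,
up to a constant, \<open>q\<close> to the power \<open>n\<close>.\<close>

lemma separation:
  assumes x: "x \<in> \<Lambda>" and y: "y \<in> \<Lambda>" and lev: "level n (x - y)" and n: "n \<ge> 1"
  shows "of_int q ^ n \<le> of_int h * real p * \<bar>x $ 1 - y $ 1\<bar>"
proof -
  obtain k where k: "real p * (x - y) $ 1 = b ^ n * of_int k" "\<not> int p dvd k"
    by (rule level_first[OF lev])
  have "h ^ (n - 1) dvd k"
  proof (cases "n = 1")
    case False
    then have "T (- 1) (x - y) \<in> int_lattice" using n by (intro deep_level_integral[OF x y lev]) simp
    then have "T (- 1) (x - y) $ 1 \<in> \<int>" unfolding int_lattice_iff by blast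
    then obtain t where t: "T (- 1) (x - y) $ 1 = of_int t" by (rule Ints_cases)
    have "(x - y) $ 1 = b * (T (- 1) (x - y) $ 1)" by (simp add: power_int_minus)
    then have "b ^ n * of_int k = b * (real p * of_int t)" unfolding t using k(1) by (simp add: mult.left_commute)
    moreover have "b ^ n = b * b ^ (n - 1)" using n by (cases n) auto
    ultimately have "b * (b ^ (n - 1) * of_int k) = b * (real p * of_int t)" by simp
    then have "b ^ (n - 1) * of_int k = real p * of_int t" by simp
    have "of_int (q ^ (n - 1) * k) = (b ^ (n - 1) * of_int h ^ (n - 1)) * real_of_int k"
      unfolding b_pow_h by simp
    also have "\<dots> = of_int h ^ (n - 1) * (b ^ (n - 1) * of_int k)" by (simp only: mult_ac)
    also have "\<dots> = of_int (h ^ (n - 1) * (int p * t))"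
      unfolding \<open>b ^ (n - 1) * of_int k = real p * of_int t\<close> by simp
    finally have "q ^ (n - 1) * k = h ^ (n - 1) * (int p * t)" by (simp only: of_int_eq_iff)
    then have "h ^ (n - 1) dvd q ^ (n - 1) * k" by simp
    moreover have "coprime (h ^ (n - 1)) (q ^ (n - 1))" using coprime_qh by (simp add: coprime_commute)
    ultimately show ?thesis by (simp add: coprime_dvd_mult_right_iff)
  qed simp
  moreover have "k \<noteq> 0" using k(2) by auto
  ultimately have "h ^ (n - 1) \<le> \<bar>k\<bar>" using h_pos by (intro zdvd_imp_le) auto
  then have "real_of_int (h ^ (n - 1)) \<le> of_int \<bar>k\<bar>" by (simp only: of_int_le_iff)
  then have hk: "of_int h ^ (n - 1) \<le> \<bar>real_of_int k\<bar>" by simp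
  have "of_int q ^ n = b ^ n * (of_int h * of_int h ^ (n - 1))"
    using b_pow_h[of n] n by (cases n) auto
  also have "\<dots> \<le> b ^ n * (of_int h * \<bar>real_of_int k\<bar>)"
    using hk h_pos b by (intro mult_left_mono) auto
  also have "\<dots> = of_int h * \<bar>real p * (x - y) $ 1\<bar>"
    using k(1) b by (simp add: abs_mult)
  also have "\<dots> = of_int h * real p * \<bar>x $ 1 - y $ 1\<bar>" by (simp add: abs_mult)
  finally show ?thesis .
qed

text \<open>Apply integrality to a pair at level 2 and read the second coordinate of \<open>T 1 z\<close>, where \<open>z\<close> is a
zero of the mask. As \<open>b\<close> is divisible by \<open>p\<close>, only the contribution of \<open>c\<close> can fail to be an integer.\<close>

lemma shear_entry:
  assumes "h = 1"
  obtains w k :: int where "c * of_int k = real p * of_int w" "\<not> int p dvd k"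
proof -
  obtain x y where xy: "x \<in> \<Lambda>" "y \<in> \<Lambda>" "level 2 (x - y)"
    using every_level_essential[of 2] by (metis one_le_numeral)
  define z where "z = T (- 2) (x - y)"
  have z: "m z = 0" using xy by (simp add: z_def level_def)
  obtain k where k: "z $ 1 = of_int k / real p" "\<not> int p dvd k" using m_zero_first[OF z] by blast
  have "T 1 z = T (- 1) (x - y)" by (simp add: z_def T_T)
  then have "T 1 z \<in> int_lattice" using deep_level_integral[OF xy(1,2,3)] by simp
  then have i1: "b * z $ 2 + c * z $ 1 \<in> \<int>" by (simp add: int_lattice_iff shear_2 distrib_left)
  obtain r where r: "q = int p * r" using p_dvd_q by blast
  have "b * z $ 2 = of_int r * (real p *\<^sub>R z) $ 2" using b_h assms r by simp
  also have "\<dots> \<in> \<int>" using m_zero_scaled[OF z] by (intro Ints_mult) (auto simp: int_lattice_iff)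
  finally have "c * z $ 1 \<in> \<int>" using Ints_diff[OF i1] by (metis add_diff_cancel_left')
  then obtain w where "c * z $ 1 = of_int w" by (rule Ints_cases)
  then have "c * of_int k = real p * of_int w" using k(1) p_ge_2 by (simp add: field_simps)
  with k(2) that show thesis by blast
qed

end

section \<open>Decay of the Fourier transform for a fractional base\<close>

lemma power_bracket:
  fixes b y :: real
  assumes "b > 1" "y \<ge> 1"
  obtains K where "b ^ K \<le> y" "y < b ^ Suc K"
proof -
  obtain n where n: "y < b ^ n" using real_arch_pow[OF assms(1)] by blast
  define N where "N = (LEAST n. y < b ^ n)"
  have N: "y < b ^ N" unfolding N_def by (rule LeastI) (rule n)
  then obtain K where K: "N = Suc K" using assms by (cases N) auto
  have "\<not> y < b ^ K" using not_less_Least[of K "\<lambda>n. y < b ^ n"] K unfolding N_def by simp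
  with N K that show thesis by (auto simp: not_less)
qed

context refinable
begin

lemma norm_M_le_factor:
  assumes "1 \<le> i" "i \<le> n"
  shows "cmod (M n x) \<le> cmod (m (T (- int i) x))"
proof -
  let ?f = "\<lambda>i. cmod (m (T (- int (Suc i)) x))"
  have "cmod (M n x) = ?f (i - 1) * (\<Prod>l\<in>{..<n} - {i - 1}. ?f l)"
    using assms unfolding M_def prod_norm[symmetric] by (intro prod.remove) auto
  also have "\<dots> \<le> ?f (i - 1) * 1"
    by (intro mult_left_mono prod_le_1) (auto simp: norm_mask_le)
  finally show ?thesis using assms by simp
qed

lemma norm_phi_le_M: "(cmod (\<phi> x))\<^sup>2 \<le> (cmod (M n x))\<^sup>2"
  unfolding phi_M[of x n] norm_mult power_mult_distrib
  by (rule mult_right_le_one_le) (auto simp: norm_phi_le power_le_one)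

text \<open>A compactness statement: by periodicity the mask is bounded away from 1 in absolute value as long as
the first coordinate keeps its distance from the integers.\<close>

lemma mask_gap:
  assumes "\<delta> > 0"
  obtains \<eta> where "0 \<le> \<eta>" "\<eta> < 1"
    "\<And>x. \<eta> < cmod (m x) \<Longrightarrow> \<exists>z. \<bar>x $ 1 - of_int z\<bar> < \<delta>"
proof -
  define K where "K = cbox (vector [\<delta>, 0]) (vector [1 - \<delta>, 1] :: real^2)"
  have mem: "x \<in> K \<longleftrightarrow> \<delta> \<le> x $ 1 \<and> x $ 1 \<le> 1 - \<delta> \<and> 0 \<le> x $ 2 \<and> x $ 2 \<le> 1" for x
    by (auto simp: K_def mem_box_cart forall_2)
  have "\<exists>\<eta>. 0 \<le> \<eta> \<and> \<eta> < 1 \<and> (\<forall>x\<in>K. cmod (m x) \<le> \<eta>)"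
  proof (cases "K = {}")
    case False
    have "continuous_on K (\<lambda>x. cmod (m x))"
      by (intro continuous_on_norm continuous_on_subset[OF continuous_mask]) auto
    then obtain x0 where x0: "x0 \<in> K" "\<forall>x\<in>K. cmod (m x) \<le> cmod (m x0)"
      using continuous_attains_sup[of K "\<lambda>x. cmod (m x)"] False unfolding K_def by auto
    have "x0 $ 1 \<notin> \<int>"
    proof
      assume "x0 $ 1 \<in> \<int>"
      then obtain z where z: "x0 $ 1 = of_int z" by (rule Ints_cases)
      then have "0 < real_of_int z" "real_of_int z < 1" using x0(1) assms unfolding mem by auto
      then show False by simp
    qed
    then have "x0 \<notin> int_lattice" by (simp add: int_lattice_iff)
    then have "cmod (m x0) < 1" using m_norm_one[of x0] norm_mask_le[of D x0] by (auto simp: less_le)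
    with x0 show ?thesis by (intro exI[of _ "cmod (m x0)"]) auto
  qed (auto intro: exI[of _ 0])
  then obtain \<eta> where \<eta>: "0 \<le> \<eta>" "\<eta> < 1" "\<And>x. x \<in> K \<Longrightarrow> cmod (m x) \<le> \<eta>" by blast
  have "\<exists>z. \<bar>x $ 1 - of_int z\<bar> < \<delta>" if x: "\<eta> < cmod (m x)" for x
  proof (rule ccontr)
    assume far: "\<not> ?thesis"
    define z :: "real^2" where "z = vector [of_int \<lfloor>x $ 1\<rfloor>, of_int \<lfloor>x $ 2\<rfloor>]"
    have z: "z \<in> int_lattice" by (simp add: z_def int_lattice_iff)
    have "\<not> \<bar>x $ 1 - of_int \<lfloor>x $ 1\<rfloor>\<bar> < \<delta>" "\<not> \<bar>x $ 1 - of_int (\<lfloor>x $ 1\<rfloor> + 1)\<bar> < \<delta>" using far by blast+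
    then have "x - z \<in> K" unfolding mem z_def by (simp add: vector_2) linarith
    then have "cmod (m (x - z)) \<le> \<eta>" by (rule \<eta>(3))
    moreover have "m (x - z) = m x" using m_periodic[OF z, of "x - z"] by simp
    ultimately show False using x by simp
  qed
  with \<eta> that show thesis by blast
qed

end

context rational_spectrum
begin

text \<open>Suppose that no factor \<open>m (T (- i) x)\<close> with \<open>i \<le> L\<close> is small. Then the first coordinates \<open>u i\<close> of
\<open>T (- i) x\<close> are all close to integers \<open>z i\<close>, and \<open>u i = b * u (i + 1)\<close> passes to the integers as
\<open>h * z i = q * z (i + 1)\<close>. Hence \<open>q\<close> to the power \<open>L - 1\<close> divides the nonzero integer \<open>z 1\<close>, which is
impossible when this power exceeds the first coordinate of \<open>x\<close>. Since \<open>q \<ge> 2 b\<close>, this happens for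
some \<open>L\<close> for which \<open>T (- L) x\<close> is still large. So \<open>\<phi> x\<close> gains a factor \<open>\<eta> < 1\<close> over \<open>\<phi> (T (- L) x)\<close>
whenever the exponent of the size of \<open>x\<close> is multiplied by \<open>A\<close>.\<close>

lemma decay_step:
  assumes h: "h \<ge> 2"
  obtains \<eta> A where "0 \<le> \<eta>" "\<eta> < 1" "A \<ge> 2"
    "\<And>j r x. 1 \<le> j \<Longrightarrow> (\<And>x. b ^ j \<le> \<bar>x $ 1\<bar> \<Longrightarrow> cmod (\<phi> x) \<le> r) \<Longrightarrow>
       b ^ (A * j) \<le> \<bar>x $ 1\<bar> \<Longrightarrow> cmod (\<phi> x) \<le> \<eta> * r"
proof -
  (* With this closeness the integer h * z i - q * z (i + 1) has absolute value at most
     1/2. *)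
  define \<delta> where "\<delta> = 1 / (2 * of_int h * (1 + b))"
  have \<delta>: "\<delta> > 0" using h b by (simp add: \<delta>_def)
  have \<delta>h: "of_int h * (\<delta> + b * \<delta>) = 1 / 2"
  proof -
    define w where "w = of_int h * (1 + b)"
    have w: "w > 0" using h b by (simp add: w_def)
    have "of_int h * (\<delta> + b * \<delta>) = w * \<delta>" by (simp add: w_def algebra_simps)
    also have "\<dots> = w * (1 / (2 * w))" by (simp add: \<delta>_def w_def mult.assoc)
    also have "\<dots> = 1 / 2" using w by simp
    finally show ?thesis .
  qed
  have "\<delta> \<le> of_int h * \<delta>" using h \<delta> by simp
  also have "\<dots> \<le> of_int h * (\<delta> + b * \<delta>)" using h \<delta> b by (intro mult_left_mono) auto
  finally have \<delta>1: "\<delta> < 1" using \<delta>h by simp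
  obtain \<eta> where \<eta>: "0 \<le> \<eta>" "\<eta> < 1" "\<And>x. \<eta> < cmod (m x) \<Longrightarrow> \<exists>z. \<bar>x $ 1 - of_int z\<bar> < \<delta>"
    using mask_gap[OF \<delta>] by blast
  obtain N where N: "b\<^sup>2 < 2 ^ N" using real_arch_pow[of 2 "b\<^sup>2"] by auto
  (* Leaves enough room for the exponent L - 1 to reach N * j' + 1 below. *)
  define A where "A = N + 3"
  have "cmod (\<phi> x) \<le> \<eta> * r"
    if j: "1 \<le> j" and r: "\<And>x. b ^ j \<le> \<bar>x $ 1\<bar> \<Longrightarrow> cmod (\<phi> x) \<le> r" and x: "b ^ (A * j) \<le> \<bar>x $ 1\<bar>" for j r x
  proof -
    have "1 \<le> b ^ (A * j)" using b by simp
    then have "1 \<le> \<bar>x $ 1\<bar>" using x by linarith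
    then obtain K where K: "b ^ K \<le> \<bar>x $ 1\<bar>" "\<bar>x $ 1\<bar> < b ^ Suc K" using power_bracket[OF b] by blast
    have "b ^ (A * j) < b ^ Suc K" using x K by linarith
    then have "A * j < Suc K" by (rule power_less_imp_less_exp[OF b])
    then have "A * j \<le> K" by simp
    define j' where "j' = K div A"
    have "j \<le> j'" unfolding j'_def using \<open>A * j \<le> K\<close>
      by (simp add: A_def less_eq_div_iff_mult_less_eq mult.commute)
    have "A * j' \<le> K" by (simp add: j'_def)
    (* After L steps the first coordinate has size about b ^ j' and is still at least b ^
       j. *)
    define L where "L = K - j'"
    have j'1: "1 \<le> j'" using j \<open>j \<le> j'\<close> by simp
    have L: "(N + 2) * j' \<le> L" "K = L + j'" "1 \<le> L"
    proof -
      have "(N + 2) * j' + j' \<le> K" using \<open>A * j' \<le> K\<close> by (simp add: A_def algebra_simps)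
      then show "(N + 2) * j' \<le> L" "K = L + j'" by (auto simp: L_def)
      have "1 * 1 \<le> (N + 2) * j'" using j'1 by (intro mult_le_mono) auto
      then show "1 \<le> L" using \<open>(N + 2) * j' \<le> L\<close> by linarith
    qed
    define u where "u = (\<lambda>i. x $ 1 / b ^ i)"
    have u: "T (- int i) x $ 1 = u i" for i by (simp add: u_def power_int_minus divide_inverse mult.commute)
    have uL: "b ^ j' \<le> \<bar>u L\<bar>"
      using K(1) b unfolding u_def L(2) power_add by (simp add: abs_divide field_simps)
    have "\<exists>i. 1 \<le> i \<and> i \<le> L \<and> cmod (m (T (- int i) x)) \<le> \<eta>"
    proof (rule ccontr)
      assume "\<not> ?thesis"
      then have "\<exists>z. \<bar>u i - of_int z\<bar> < \<delta>" if "1 \<le> i" "i \<le> L" for i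
        using \<eta>(3)[of "T (- int i) x"] that unfolding u by (meson not_le)
      then obtain z where z: "\<And>i. 1 \<le> i \<Longrightarrow> i \<le> L \<Longrightarrow> \<bar>u i - of_int (z i)\<bar> < \<delta>" by metis
      have rec: "h * z i = q * z (Suc i)" if i: "1 \<le> i" "Suc i \<le> L" for i
      proof -
        have ui: "u i = b * u (Suc i)" using b by (simp add: u_def)
        have "of_int (h * z i - q * z (Suc i)) = of_int h * (of_int (z i) - b * of_int (z (Suc i)))"
          using b_h by (simp add: algebra_simps)
        also have "\<dots> = of_int h * (b * (u (Suc i) - of_int (z (Suc i))) - (u i - of_int (z i)))"
          unfolding ui by (simp add: algebra_simps)
        finally have "\<bar>real_of_int (h * z i - q * z (Suc i))\<bar>
            = of_int h * \<bar>b * (u (Suc i) - of_int (z (Suc i))) - (u i - of_int (z i))\<bar>"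
          using h by (simp add: abs_mult)
        also have "\<dots> \<le> of_int h * (\<bar>b * (u (Suc i) - of_int (z (Suc i)))\<bar> + \<bar>u i - of_int (z i)\<bar>)"
          using h by (intro mult_left_mono abs_triangle_ineq4) auto
        also have "\<dots> = of_int h * (\<bar>u i - of_int (z i)\<bar> + b * \<bar>u (Suc i) - of_int (z (Suc i))\<bar>)"
          using b by (simp add: abs_mult)
        also have "\<dots> \<le> of_int h * (\<delta> + b * \<delta>)"
          using z[of i] z[of "Suc i"] i h b by (intro mult_left_mono add_mono) auto
        finally have "\<bar>real_of_int (h * z i - q * z (Suc i))\<bar> < 1" unfolding \<delta>h by simp
        then have "\<bar>h * z i - q * z (Suc i)\<bar> < 1" by linarith
        then show ?thesis by simp
      qed
      have pow: "h ^ i * z 1 = q ^ i * z (Suc i)" if "Suc i \<le> L" for i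
        using that
      proof (induction i)
        case (Suc i)
        have "h ^ Suc i * z 1 = h * (q ^ i * z (Suc i))" using Suc by simp
        also have "\<dots> = q ^ i * (h * z (Suc i))" by simp
        also have "\<dots> = q ^ Suc i * z (Suc (Suc i))" using rec[of "Suc i"] Suc.prems by simp
        finally show ?case .
      qed simp
      have L1: "L = Suc (L - 1)" using L by simp
      then have p1: "h ^ (L - 1) * z 1 = q ^ (L - 1) * z L" using pow[of "L - 1"] by simp
      have "z L \<noteq> 0"
      proof
        assume "z L = 0"
        then have "\<bar>u L\<bar> < 1" using z[of L] L \<delta>1 by simp
        moreover have "1 \<le> b ^ j'" using b by simp
        ultimately show False using uL by simp
      qed
      then have "z 1 \<noteq> 0" using p1 q_pos by auto
      have "q ^ (L - 1) dvd h ^ (L - 1) * z 1" unfolding p1 by simp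
      moreover have "coprime (q ^ (L - 1)) (h ^ (L - 1))" using coprime_qh by simp
      ultimately have "q ^ (L - 1) dvd z 1" by (simp add: coprime_dvd_mult_right_iff)
      then have "q ^ (L - 1) \<le> \<bar>z 1\<bar>" using \<open>z 1 \<noteq> 0\<close> by (simp add: zdvd_imp_le)
      then have "real_of_int (q ^ (L - 1)) \<le> of_int \<bar>z 1\<bar>" by (simp only: of_int_le_iff)
      then have qz: "of_int q ^ (L - 1) \<le> \<bar>real_of_int (z 1)\<bar>" by simp
      also have "\<dots> < \<bar>u 1\<bar> + 1" using z[of 1] L \<delta>1 by simp
      also have "\<bar>u 1\<bar> < b ^ K" using K(2) b by (simp add: u_def abs_divide field_simps)
      also have "1 \<le> b ^ K" using b by simp
      finally have up: "of_int q ^ (L - 1) < 2 * b ^ K" by simp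
      have "b ^ K = b ^ (L - 1) * b ^ Suc j'" unfolding L(2) by (subst L1) (simp flip: power_add)
      also have "\<dots> \<le> b ^ (L - 1) * (b\<^sup>2) ^ j'"
        unfolding power_mult[symmetric] using b j'1 by (intro mult_left_mono power_increasing) auto
      also have "\<dots> \<le> b ^ (L - 1) * (2 ^ N) ^ j'"
        using N b by (intro mult_left_mono power_mono) auto
      finally have "2 * b ^ K \<le> b ^ (L - 1) * 2 ^ Suc (N * j')" by (simp add: power_mult)
      also have "\<dots> \<le> b ^ (L - 1) * 2 ^ (L - 1)"
      proof (intro mult_left_mono power_increasing)
        have "N * j' + 2 * j' \<le> L" using L(1) by (simp add: algebra_simps)
        then show "Suc (N * j') \<le> L - 1" using j'1 by linarith
      qed (use b in auto)
      also have "\<dots> \<le> b ^ (L - 1) * of_int h ^ (L - 1)"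
        using h b by (intro mult_left_mono power_mono) auto
      also have "\<dots> = of_int q ^ (L - 1)" by (rule b_pow_h)
      finally show False using up by simp
    qed
    then obtain i where i: "1 \<le> i" "i \<le> L" "cmod (m (T (- int i) x)) \<le> \<eta>" by blast
    have "b ^ j \<le> b ^ j'" using b \<open>j \<le> j'\<close> by (intro power_increasing) auto
    then have "b ^ j \<le> \<bar>T (- int L) x $ 1\<bar>" unfolding u using uL by linarith
    then have "cmod (\<phi> (T (- int L) x)) \<le> r" by (rule r)
    moreover have "cmod (M L x) \<le> \<eta>" using norm_M_le_factor[OF i(1,2), of x] i(3) by linarith
    ultimately show ?thesis
      unfolding phi_M[of x L] norm_mult using \<eta>(1) by (intro mult_mono) auto
  qed
  moreover have "A \<ge> 2" by (simp add: A_def)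
  ultimately show thesis using that \<eta>(1,2) by blast
qed

lemma decay:
  assumes h: "h \<ge> 2"
  obtains \<eta> A where "0 \<le> \<eta>" "\<eta> < 1" "A \<ge> 2"
    "\<And>k x. b ^ (A ^ k) \<le> \<bar>x $ 1\<bar> \<Longrightarrow> cmod (\<phi> x) \<le> \<eta> ^ k"
proof -
  obtain \<eta> A where \<eta>: "0 \<le> \<eta>" "\<eta> < 1" "A \<ge> 2"
    and step: "\<And>j r x. 1 \<le> j \<Longrightarrow> (\<And>x. b ^ j \<le> \<bar>x $ 1\<bar> \<Longrightarrow> cmod (\<phi> x) \<le> r) \<Longrightarrow>
       b ^ (A * j) \<le> \<bar>x $ 1\<bar> \<Longrightarrow> cmod (\<phi> x) \<le> \<eta> * r"
    using decay_step[OF h] by blast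
  have "b ^ (A ^ k) \<le> \<bar>x $ 1\<bar> \<Longrightarrow> cmod (\<phi> x) \<le> \<eta> ^ k" for k x
  proof (induction k arbitrary: x)
    case 0 then show ?case by (simp add: norm_phi_le)
  next
    case (Suc k)
    have "1 \<le> A ^ k" using \<eta>(3) by simp
    from step[OF this, of "\<eta> ^ k" x] Suc show ?case by simp
  qed
  with \<eta> that show thesis by blast
qed

section \<open>A fractional base admits no spectrum\<close>

text \<open>The bound is half of the lower bound for the distance of points at level \<open>n\<close>, so all levels inside a truncation are smaller
than \<open>n\<close> and the truncation is orthogonal for the finite product \<open>M n\<close>.\<close>

definition truncation :: "nat \<Rightarrow> (real^2) set" where
  "truncation n = {x \<in> \<Lambda>. 2 * of_int h * real p * \<bar>x $ 1\<bar> < of_int q ^ n}"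

lemma q_ge_2: "q \<ge> 2"
proof -
  have "int p \<le> q" using p_dvd_q q_pos by (rule zdvd_imp_le)
  then show ?thesis using p_ge_2 by linarith
qed

lemma truncation_subset: "truncation n \<subseteq> \<Lambda>"
  by (auto simp: truncation_def)

lemma truncation_mono: "n \<le> n' \<Longrightarrow> truncation n \<subseteq> truncation n'"
proof -
  assume "n \<le> n'"
  then have "real_of_int q ^ n \<le> of_int q ^ n'" using q_ge_2 by (intro power_increasing) auto
  then show ?thesis by (auto simp: truncation_def)
qed

lemma truncation_M_zero:
  assumes "x \<in> truncation n" "y \<in> truncation n" "x \<noteq> y"
  shows "M n (x - y) = 0"
proof -
  have xy: "x \<in> \<Lambda>" "y \<in> \<Lambda>" using assms truncation_subset by auto
  obtain l where l: "l \<ge> 1" "level l (x - y)" using level_exists[OF xy assms(3)] by blast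
  have "of_int q ^ l \<le> of_int h * real p * \<bar>x $ 1 - y $ 1\<bar>" by (rule separation[OF xy l(2,1)])
  also have "\<dots> \<le> of_int h * real p * (\<bar>x $ 1\<bar> + \<bar>y $ 1\<bar>)"
    using h_pos by (intro mult_left_mono) auto
  also have "\<dots> < of_int q ^ n" using assms(1,2) by (simp add: truncation_def algebra_simps)
  finally have "l < n" using q_ge_2 by (simp add: power_strict_increasing_iff)
  then show ?thesis using level_M[of l n] l by simp
qed

text \<open>Points of the spectrum are separated in the first coordinate by a fixed distance \<open>s\<close>.\<close>

lemma truncation_finite: "finite (truncation n)"
proof -
  define s where "s = of_int q / (of_int h * real p)"
  have s: "s > 0" using q_pos h_pos by (simp add: s_def)
  have sep: "s \<le> \<bar>x $ 1 - y $ 1\<bar>" if xy: "x \<in> \<Lambda>" "y \<in> \<Lambda>" "x \<noteq> y" for x y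
  proof -
    obtain l where l: "l \<ge> 1" "level l (x - y)" using level_exists[OF xy] by blast
    have "real_of_int q ^ 1 \<le> of_int q ^ l" using q_ge_2 l(1) by (intro power_increasing) auto
    also have "\<dots> \<le> of_int h * real p * \<bar>x $ 1 - y $ 1\<bar>" by (rule separation[OF xy(1,2) l(2,1)])
    finally show ?thesis using h_pos by (simp add: s_def divide_le_eq mult.commute)
  qed
  define f where "f = (\<lambda>x :: real^2. \<lfloor>x $ 1 / s\<rfloor>)"
  define R :: real where "R = of_int q ^ n / s"
  have "inj_on f (truncation n)"
  proof (rule inj_onI, rule ccontr)
    fix x y assume xy: "x \<in> truncation n" "y \<in> truncation n" "f x = f y" "x \<noteq> y"
    have "\<bar>x $ 1 / s - y $ 1 / s\<bar> < 1" using xy(3) unfolding f_def by linarith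
    also have "\<bar>x $ 1 / s - y $ 1 / s\<bar> = \<bar>x $ 1 - y $ 1\<bar> / s"
      using s by (simp add: abs_divide flip: diff_divide_distrib)
    finally have "\<bar>x $ 1 - y $ 1\<bar> < s" using s by (simp add: divide_less_eq)
    then show False using sep[of x y] xy truncation_subset by fastforce
  qed
  moreover have "f ` truncation n \<subseteq> {\<lfloor>- R\<rfloor>..\<lfloor>R\<rfloor>}"
  proof (rule image_subsetI)
    fix x assume x: "x \<in> truncation n"
    have "1 \<le> 2 * real_of_int h * real p"
    proof -
      have "1 \<le> real_of_int h" "1 \<le> real p" using h_pos p_ge_2 by auto
      then have "1 * 1 \<le> real_of_int h * real p" by (intro mult_mono) auto
      then show ?thesis by simp
    qed
    then have "\<bar>x $ 1\<bar> \<le> 2 * of_int h * real p * \<bar>x $ 1\<bar>" by (simp add: mult_le_cancel_right1)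
    also have "\<dots> < of_int q ^ n" using x by (simp add: truncation_def)
    finally have "\<bar>x $ 1 / s\<bar> \<le> R" unfolding R_def abs_divide using s by (simp add: divide_right_mono)
    then have "- R \<le> x $ 1 / s" "x $ 1 / s \<le> R" unfolding abs_le_iff by linarith+
    then show "f x \<in> {\<lfloor>- R\<rfloor>..\<lfloor>R\<rfloor>}" unfolding f_def by (simp add: floor_mono)
  qed
  ultimately show ?thesis using finite_atLeastAtMost_int inj_on_finite by blast
qed

lemma truncation_bessel: "(\<Sum>l\<in>truncation n. (cmod (M n (\<xi> - l)))\<^sup>2) \<le> 1"
proof (rule pos_def_bessel)
  have "pos_def (\<lambda>x. M n x * 1)" by (rule pos_def_M[OF pos_def_one])
  then show "pos_def (M n)" by simp
qed (auto simp: truncation_finite truncation_M_zero)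

definition partial_sum :: "real^2 \<Rightarrow> nat \<Rightarrow> real" where
  "partial_sum \<xi> n = (\<Sum>l\<in>truncation n. (cmod (\<phi> (\<xi> - l)))\<^sup>2)"

lemma truncation_exhausts:
  assumes "finite F" "F \<subseteq> \<Lambda>"
  obtains n0 where "\<And>n. n \<ge> n0 \<Longrightarrow> F \<subseteq> truncation n"
proof -
  have "\<exists>n0. \<forall>x\<in>F. x \<in> truncation n0"
    using assms
  proof (induction F rule: finite_induct)
    case (insert x F)
    then obtain n0 where n0: "\<forall>x\<in>F. x \<in> truncation n0" by auto
    obtain n1 where "2 * of_int h * real p * \<bar>x $ 1\<bar> < of_int q ^ n1"
      using real_arch_pow[of "of_int q" "2 * of_int h * real p * \<bar>x $ 1\<bar>"] q_ge_2 by auto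
    then have "x \<in> truncation n1" using insert by (simp add: truncation_def)
    then have "\<forall>y\<in>insert x F. y \<in> truncation (max n0 n1)"
      using n0 truncation_mono[of n0 "max n0 n1"] truncation_mono[of n1 "max n0 n1"] by auto
    then show ?case by blast
  qed simp
  then show thesis using that truncation_mono by blast
qed

lemma partial_sum_limit:
  assumes "\<epsilon> > 0"
  obtains n0 where "\<And>n. n \<ge> n0 \<Longrightarrow> 1 - \<epsilon> < partial_sum \<xi> n"
proof -
  obtain F where F: "finite F" "F \<subseteq> \<Lambda>" "1 - \<epsilon> < (\<Sum>l\<in>F. (cmod (\<phi> (\<xi> - l)))\<^sup>2)"
    using complete assms unfolding complete_for_def by blast
  obtain n0 where n0: "\<And>n. n \<ge> n0 \<Longrightarrow> F \<subseteq> truncation n" using truncation_exhausts[OF F(1,2)] by blast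
  have "1 - \<epsilon> < partial_sum \<xi> n" if "n \<ge> n0" for n
    using F(3) sum_mono2[OF truncation_finite n0[OF that], of "\<lambda>l. (cmod (\<phi> (\<xi> - l)))\<^sup>2"]
    unfolding partial_sum_def by simp
  then show thesis using that by blast
qed

text \<open>A point that enters between the truncations \<open>n\<close> and \<open>n'\<close> is so far out that \<open>T (- n') (\<xi> - l)\<close> has first
coordinate at least \<open>B\<close> in absolute value. There \<open>\<phi>\<close> is bounded by \<open>r\<close>, while Bessel's inequality for \<open>M n'\<close> bounds the
sum of the other factors by the mass \<open>1 - partial_sum \<xi> n\<close> that is still missing.\<close>

lemma partial_sum_step:
  assumes n: "n \<le> n'" and r: "\<And>x. B \<le> \<bar>x $ 1\<bar> \<Longrightarrow> cmod (\<phi> x) \<le> r"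
    and B: "2 * of_int h * real p * (B * b ^ n' + \<bar>\<xi> $ 1\<bar>) \<le> of_int q ^ n"
  shows "(1 - partial_sum \<xi> n) * (1 - r\<^sup>2) \<le> 1 - partial_sum \<xi> n'"
proof -
  let ?C = "2 * of_int h * real p"
  let ?S = "truncation n" and ?S' = "truncation n'"
  have C: "?C > 0" using h_pos by simp
  have sub: "?S \<subseteq> ?S'" by (rule truncation_mono[OF n])
  have dominated: "(cmod (\<phi> (\<xi> - l)))\<^sup>2 \<le> r\<^sup>2 * (cmod (M n' (\<xi> - l)))\<^sup>2" if l: "l \<in> ?S' - ?S" for l
  proof -
    have "l \<in> \<Lambda>" using l truncation_subset by blast
    then have "of_int q ^ n \<le> ?C * \<bar>l $ 1\<bar>" using l by (auto simp: truncation_def)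
    then have "?C * (B * b ^ n' + \<bar>\<xi> $ 1\<bar>) \<le> ?C * \<bar>l $ 1\<bar>" using B by linarith
    then have "B * b ^ n' + \<bar>\<xi> $ 1\<bar> \<le> \<bar>l $ 1\<bar>" using C mult_le_cancel_left_pos by blast
    then have "B * b ^ n' \<le> \<bar>\<xi> $ 1 - l $ 1\<bar>" by linarith
    then have "B \<le> \<bar>\<xi> $ 1 - l $ 1\<bar> / b ^ n'" using b by (simp add: le_divide_eq)
    also have "\<dots> = \<bar>T (- int n') (\<xi> - l) $ 1\<bar>"
      using b by (simp add: power_int_minus abs_mult divide_inverse mult.commute)
    finally have "cmod (\<phi> (T (- int n') (\<xi> - l))) \<le> r" by (rule r)
    then have "(cmod (\<phi> (T (- int n') (\<xi> - l))))\<^sup>2 \<le> r\<^sup>2" by (rule power_mono) simp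
    then have "(cmod (M n' (\<xi> - l)))\<^sup>2 * (cmod (\<phi> (T (- int n') (\<xi> - l))))\<^sup>2 \<le> (cmod (M n' (\<xi> - l)))\<^sup>2 * r\<^sup>2"
      by (rule mult_left_mono) simp
    then show ?thesis unfolding phi_M[of "\<xi> - l" n'] norm_mult power_mult_distrib by (simp add: mult.commute)
  qed
  have "partial_sum \<xi> n' = partial_sum \<xi> n + (\<Sum>l\<in>?S' - ?S. (cmod (\<phi> (\<xi> - l)))\<^sup>2)"
    unfolding partial_sum_def by (subst sum.subset_diff[OF sub truncation_finite]) simp
  also have "(\<Sum>l\<in>?S' - ?S. (cmod (\<phi> (\<xi> - l)))\<^sup>2) \<le> (\<Sum>l\<in>?S' - ?S. r\<^sup>2 * (cmod (M n' (\<xi> - l)))\<^sup>2)"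
    by (rule sum_mono) (rule dominated)
  also have "\<dots> = r\<^sup>2 * ((\<Sum>l\<in>?S'. (cmod (M n' (\<xi> - l)))\<^sup>2) - (\<Sum>l\<in>?S. (cmod (M n' (\<xi> - l)))\<^sup>2))"
    by (subst sum.subset_diff[OF sub truncation_finite]) (simp add: sum_distrib_left)
  also have "\<dots> \<le> r\<^sup>2 * (1 - partial_sum \<xi> n)"
    unfolding partial_sum_def
    by (intro mult_left_mono diff_mono truncation_bessel sum_mono norm_phi_le_M) simp
  finally show ?thesis by (simp add: algebra_simps)
qed

lemma partial_sum_less_one:
  assumes l0: "l0 \<in> truncation n" and \<eta>: "\<phi> \<eta> \<noteq> 0" "\<And>n. cmod (m (T (- int n) \<eta>)) < 1"
  shows "partial_sum (l0 + \<eta>) n < 1"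
proof -
  have "partial_sum (l0 + \<eta>) n < (\<Sum>l\<in>truncation n. (cmod (M n (l0 + \<eta> - l)))\<^sup>2)"
    unfolding partial_sum_def
  proof (rule sum_strict_mono_ex1[OF truncation_finite])
    show "\<forall>l\<in>truncation n. (cmod (\<phi> (l0 + \<eta> - l)))\<^sup>2 \<le> (cmod (M n (l0 + \<eta> - l)))\<^sup>2"
      by (simp add: norm_phi_le_M)
    have "M n \<eta> \<noteq> 0" using \<eta>(1) phi_M[of \<eta> n] by auto
    have "cmod (\<phi> (T (- int n) \<eta>)) = cmod (m (T (- int (Suc n)) \<eta>)) * cmod (\<phi> (T (- int (Suc n)) \<eta>))"
      by (subst refine) (simp add: T_T norm_mult)
    also have "\<dots> \<le> cmod (m (T (- int (Suc n)) \<eta>)) * 1" by (intro mult_left_mono norm_phi_le) simp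
    also have "\<dots> < 1" using \<eta>(2)[of "Suc n"] by simp
    finally have "cmod (M n \<eta>) * cmod (\<phi> (T (- int n) \<eta>)) < cmod (M n \<eta>) * 1"
      using \<open>M n \<eta> \<noteq> 0\<close> by (intro mult_strict_left_mono) auto
    then have "cmod (\<phi> \<eta>) < cmod (M n \<eta>)" by (subst phi_M[of \<eta> n]) (simp add: norm_mult)
    then have "(cmod (\<phi> \<eta>))\<^sup>2 < (cmod (M n \<eta>))\<^sup>2" by (intro power_strict_mono) auto
    then show "\<exists>l\<in>truncation n. (cmod (\<phi> (l0 + \<eta> - l)))\<^sup>2 < (cmod (M n (l0 + \<eta> - l)))\<^sup>2"
      using l0 by (intro bexI[of _ l0]) auto
  qed
  also have "\<dots> \<le> 1" by (rule truncation_bessel)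
  finally show ?thesis .
qed

text \<open>If the denominator were at least 2, the missing mass \<open>X k\<close> in the truncation at
\<open>n0 * A ^ k\<close> would shrink per step by at most a factor \<open>1 - R * \<eta> ^ k\<close>. Each of these steps consists of
\<open>R\<close> moves by \<open>A ^ k\<close>, which keeps the rescaled points in the range where \<open>\<phi>\<close> is at most \<open>\<eta> ^ k\<close>. The
product of these factors is positive, so the mass missing from the spectrum could not tend to 0.\<close>

lemma base_integral: "h = 1"
proof (rule ccontr)
  assume "h \<noteq> 1"
  then have h: "h \<ge> 2" using h_pos by simp
  obtain \<eta> A where \<eta>: "0 \<le> \<eta>" "\<eta> < 1" and A: "A \<ge> 2"
    and dec: "\<And>k x. b ^ (A ^ k) \<le> \<bar>x $ 1\<bar> \<Longrightarrow> cmod (\<phi> x) \<le> \<eta> ^ k" using decay[OF h] by blast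
  obtain l0 where l0: "l0 \<in> \<Lambda>" using spectrum_nonempty by blast
  obtain \<zeta> where \<zeta>: "\<phi> \<zeta> \<noteq> 0" "\<And>n. cmod (m (T (- int n) \<zeta>)) < 1" using generic_shift by blast
  define \<xi> where "\<xi> = l0 + \<zeta>"
  define C where "C = 2 * of_int h * real p"
  have C1: "C \<ge> 1"
  proof -
    have "1 \<le> real_of_int h" "1 \<le> real p" using h_pos p_ge_2 by auto
    then have "1 * 1 \<le> real_of_int h * real p" by (intro mult_mono) auto
    then show ?thesis by (simp add: C_def)
  qed
  define y where "y = C * (1 + \<bar>\<xi> $ 1\<bar>)"
  have y1: "y \<ge> 1" using C1 mult_mono[of 1 C 1 "1 + \<bar>\<xi> $ 1\<bar>"] by (simp add: y_def)
  (* The square of b pays for the growth of b ^ (n + A ^ k) and of the threshold b ^ (A ^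
     k) in the step, and y for the constants. *)
  obtain n0 where n0: "y * b\<^sup>2 + C * \<bar>l0 $ 1\<bar> < 2 ^ n0" using real_arch_pow[of 2] by auto
  have yb: "y * b\<^sup>2 \<le> 2 ^ n0" and l0n: "C * \<bar>l0 $ 1\<bar> < 2 ^ n0"
    using n0 C1 y1 by (auto intro: order.strict_trans1[rotated] simp: add_nonneg_nonneg)
       (smt (verit) mult_nonneg_nonneg zero_le_power2 abs_ge_zero)+
  have n0_pos: "n0 \<ge> 1"
  proof (rule ccontr)
    assume "\<not> ?thesis"
    then have "n0 = 0" by simp
    then have "y * b\<^sup>2 \<le> 1" using yb by simp
    moreover have "1 < b\<^sup>2" using b by (simp add: power2_eq_square less_1_mult)
    moreover have "1 * b\<^sup>2 \<le> y * b\<^sup>2" using y1 by (intro mult_right_mono) auto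
    ultimately show False by simp
  qed
  have l0_in: "l0 \<in> truncation n" if "n \<ge> n0" for n
  proof -
    have "(2::real) ^ n0 \<le> 2 ^ n" using that by (intro power_increasing) auto
    also have "\<dots> \<le> of_int q ^ n" using q_ge_2 by (intro power_mono) auto
    finally show ?thesis using l0 l0n by (simp add: truncation_def C_def)
  qed
  define P where "P n = 1 - partial_sum \<xi> n" for n
  have P_pos: "P n > 0" if "n \<ge> n0" for n
    using partial_sum_less_one[OF l0_in[OF that] \<zeta>] by (simp add: P_def \<xi>_def)
  have step: "P n * (1 - (\<eta> ^ k)\<^sup>2) \<le> P (n + A ^ k)" if n: "n \<ge> n0 * A ^ k" for n k
    unfolding P_def
  proof (rule partial_sum_step)
    let ?t = "A ^ k"
    have t1: "?t \<ge> 1" using A by simp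
    show "cmod (\<phi> x) \<le> \<eta> ^ k" if "b ^ ?t \<le> \<bar>x $ 1\<bar>" for x by (rule dec[OF that])
    have bb: "b ^ (n + ?t) * b ^ ?t = b ^ n * (b\<^sup>2) ^ ?t"
      by (simp add: power_add power2_eq_square power_mult_distrib)
    have "1 \<le> b ^ (n + ?t) * b ^ ?t" unfolding power_add[symmetric] using b by simp
    then have "\<bar>\<xi> $ 1\<bar> \<le> \<bar>\<xi> $ 1\<bar> * (b ^ (n + ?t) * b ^ ?t)" by (simp add: mult_le_cancel_left1)
    then have "C * (b ^ ?t * b ^ (n + ?t) + \<bar>\<xi> $ 1\<bar>) \<le> C * ((1 + \<bar>\<xi> $ 1\<bar>) * (b ^ (n + ?t) * b ^ ?t))"
      using C1 by (intro mult_left_mono) (auto simp: algebra_simps)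
    also have "\<dots> = b ^ n * (y * (b\<^sup>2) ^ ?t)" unfolding bb y_def by simp
    also have "\<dots> \<le> b ^ n * (y ^ ?t * (b\<^sup>2) ^ ?t)"
      using self_le_power[OF y1, of ?t] A b by (intro mult_left_mono mult_right_mono) auto
    also have "\<dots> = b ^ n * (y * b\<^sup>2) ^ ?t" by (simp add: power_mult_distrib)
    also have "\<dots> \<le> b ^ n * (2 ^ n0) ^ ?t"
      using yb y1 b by (intro mult_left_mono power_mono) auto
    also have "\<dots> = b ^ n * 2 ^ (n0 * ?t)" by (simp add: power_mult)
    also have "\<dots> \<le> b ^ n * 2 ^ n" using n b by (intro mult_left_mono power_increasing) auto
    also have "\<dots> \<le> b ^ n * of_int h ^ n" using h b by (intro mult_left_mono power_mono) auto
    also have "\<dots> = of_int q ^ n" by (rule b_pow_h)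
    finally show "2 * of_int h * real p * (b ^ ?t * b ^ (n + ?t) + \<bar>\<xi> $ 1\<bar>) \<le> of_int q ^ n"
      unfolding C_def .
  qed simp
  define X where "X k = P (n0 * A ^ k)" for k
  define R where "R = (A - 1) * n0"
  have X_pos: "X k > 0" for k unfolding X_def by (rule P_pos) (use A in simp)
  have X_step: "X k * (1 - real R * \<eta> ^ k) \<le> X (Suc k)" for k
  proof -
    let ?r = "1 - (\<eta> ^ k)\<^sup>2"
    have ek: "0 \<le> \<eta> ^ k" "\<eta> ^ k \<le> 1" using \<eta> by (auto simp: power_le_one)
    then have r0: "0 \<le> ?r" by (simp add: power_le_one)
    have it: "X k * ?r ^ i \<le> P (n0 * A ^ k + i * A ^ k)" for i
    proof (induction i)
      case (Suc i)
      have "X k * ?r ^ Suc i = (X k * ?r ^ i) * ?r" by simp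
      also have "\<dots> \<le> P (n0 * A ^ k + i * A ^ k) * ?r" using Suc r0 by (rule mult_right_mono)
      also have "\<dots> \<le> P (n0 * A ^ k + i * A ^ k + A ^ k)" by (rule step) simp
      also have "n0 * A ^ k + i * A ^ k + A ^ k = n0 * A ^ k + Suc i * A ^ k" by simp
      finally show ?case .
    qed (simp add: X_def)
    have e: "n0 * A ^ k + R * A ^ k = n0 * A ^ Suc k"
      unfolding R_def using A by (cases A) (auto simp: algebra_simps)
    have sq: "(\<eta> ^ k)\<^sup>2 \<le> \<eta> ^ k" using ek by (simp add: power2_eq_square mult_left_le_one_le)
    have "1 - real R * \<eta> ^ k \<le> 1 + real R * (- (\<eta> ^ k)\<^sup>2)" using sq by (simp add: mult_left_mono)
    also have "\<dots> \<le> (1 + (- (\<eta> ^ k)\<^sup>2)) ^ R"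
      by (rule Bernoulli_inequality) (use ek in \<open>simp add: power_le_one\<close>)
    finally have "X k * (1 - real R * \<eta> ^ k) \<le> X k * ?r ^ R"
      using X_pos[of k] by (intro mult_left_mono) auto
    also have "\<dots> \<le> X (Suc k)" using it[of R] unfolding e X_def[symmetric] .
    finally show ?thesis .
  qed
  define s where "s k i = real R * \<eta> ^ k * (\<Sum>l<i. \<eta> ^ l)" for k i
  have "(\<lambda>k. real R / (1 - \<eta>) * \<eta> ^ k) \<longlonglongrightarrow> real R / (1 - \<eta>) * 0"
    using \<eta> by (intro tendsto_mult tendsto_const LIMSEQ_power_zero) auto
  then have "eventually (\<lambda>k. real R / (1 - \<eta>) * \<eta> ^ k < 1 / 2) sequentially"
    by (rule order_tendstoD) simp
  (* From k0 on, the total relative loss of mass is at most one half. *)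
  then obtain k0 where k0: "real R / (1 - \<eta>) * \<eta> ^ k0 < 1 / 2" by (auto simp: eventually_sequentially)
  have s_le: "s k0 i \<le> 1 / 2" for i
  proof -
    have "(\<Sum>l<i. \<eta> ^ l) = (1 - \<eta> ^ i) / (1 - \<eta>)" using \<eta> sum_gp_strict[of \<eta> i] by simp
    also have "\<dots> \<le> 1 / (1 - \<eta>)" using \<eta> by (intro divide_right_mono) auto
    finally have "s k0 i \<le> real R * \<eta> ^ k0 * (1 / (1 - \<eta>))"
      unfolding s_def using \<eta> by (intro mult_left_mono) auto
    then show ?thesis using k0 by (simp add: mult.commute)
  qed
  have s_Suc: "s k0 (Suc i) = s k0 i + real R * \<eta> ^ (k0 + i)" for i
    by (simp add: s_def power_add algebra_simps)
  have s_nonneg: "0 \<le> s k0 i" for i unfolding s_def using \<eta> by (intro mult_nonneg_nonneg sum_nonneg) auto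
  have low: "X k0 * (1 - s k0 i) \<le> X (k0 + i)" for i
  proof (induction i)
    case (Suc i)
    let ?e = "real R * \<eta> ^ (k0 + i)"
    have e: "0 \<le> ?e" "?e \<le> 1" using \<eta> s_le[of "Suc i"] s_nonneg[of i] s_Suc[of i] by auto
    have "X k0 * (1 - s k0 (Suc i)) \<le> X k0 * ((1 - s k0 i) * (1 - ?e))"
    proof (rule mult_left_mono)
      have "0 \<le> s k0 i * ?e" by (rule mult_nonneg_nonneg[OF s_nonneg e(1)])
      then show "1 - s k0 (Suc i) \<le> (1 - s k0 i) * (1 - ?e)"
        unfolding s_Suc left_diff_distrib right_diff_distrib by simp
    qed (use X_pos[of k0] in simp)
    also have "\<dots> = (X k0 * (1 - s k0 i)) * (1 - ?e)" by simp
    also have "\<dots> \<le> X (k0 + i) * (1 - ?e)" using Suc e by (intro mult_right_mono) auto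
    also have "\<dots> \<le> X (k0 + Suc i)" using X_step[of "k0 + i"] by simp
    finally show ?case .
  qed (simp add: s_def)
  obtain N where N: "\<And>n. n \<ge> N \<Longrightarrow> 1 - X k0 / 2 < partial_sum \<xi> n"
    using partial_sum_limit[of "X k0 / 2" \<xi>] X_pos[of k0] by (metis half_gt_zero)
  have "k0 + N < 2 ^ (k0 + N)" by (rule less_exp)
  then have "N \<le> 2 ^ (k0 + N)" by linarith
  also have "\<dots> \<le> A ^ (k0 + N)" using A by (rule power_mono) simp
  also have "\<dots> \<le> n0 * A ^ (k0 + N)" using n0_pos by simp
  finally have "1 - X k0 / 2 < partial_sum \<xi> (n0 * A ^ (k0 + N))" by (rule N)
  moreover have "X (k0 + N) = 1 - partial_sum \<xi> (n0 * A ^ (k0 + N))" by (simp add: X_def P_def)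
  ultimately have "X (k0 + N) < X k0 / 2" by linarith
  moreover have "X k0 * (1 / 2) \<le> X k0 * (1 - s k0 N)"
    using X_pos[of k0] s_le[of N] by (intro mult_left_mono) auto
  ultimately show False using low[of N] by simp
qed

end

section \<open>Digits that split the mask\<close>

context refinable
begin

lemma M_tendsto: "(\<lambda>n. M n x) \<longlonglongrightarrow> \<phi> x"
proof -
  have "isCont \<phi> 0" using continuous_phi by (simp add: continuous_on_eq_continuous_at)
  then have "(\<lambda>n. \<phi> (T (- int n) x)) \<longlonglongrightarrow> \<phi> 0"
    by (rule isCont_tendsto_compose) (rule shear_contracts[OF b])
  then have lim: "(\<lambda>n. \<phi> (T (- int n) x)) \<longlonglongrightarrow> 1" by (simp add: phi_0)
  have "(\<lambda>n. \<phi> x / \<phi> (T (- int n) x)) \<longlonglongrightarrow> \<phi> x / 1"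
    by (intro tendsto_divide tendsto_const lim) simp
  moreover have "eventually (\<lambda>n. \<phi> (T (- int n) x) \<noteq> 0) sequentially"
    using tendsto_imp_eventually_ne[OF lim] by simp
  then have "eventually (\<lambda>n. \<phi> x / \<phi> (T (- int n) x) = M n x) sequentially"
  proof eventually_elim
    case (elim n)
    then show ?case by (subst (1) phi_M[of x n]) simp
  qed
  ultimately show ?thesis by (simp add: tendsto_cong)
qed

text \<open>The zeros \<open>j \<alpha>\<close> of the mask say that the rows of the \<open>p\<close> by \<open>p\<close> matrix of the numbers
\<open>exp_char (j \<alpha>) d\<close> are orthogonal to the row \<open>j = 0\<close>. The sums \<open>g d d'\<close> are the inner products of
its columns. They are real and nonnegative, since they are sums over the powers of a \<open>p\<close>-th root
of unity, and their total is already attained on the diagonal; hence the columns are orthogonal.\<close>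

lemma mask_hadamard:
  assumes alpha: "real p *\<^sub>R \<alpha> \<in> int_lattice"
    and zero: "\<And>j. 1 \<le> j \<Longrightarrow> j < p \<Longrightarrow> m (real j *\<^sub>R \<alpha>) = 0"
  shows "(\<Sum>j<p. (cmod (m (y - real j *\<^sub>R \<alpha>)))\<^sup>2) = 1"
proof -
  define w where "w d d' = cnj (exp_char \<alpha> d) * exp_char \<alpha> d'" for d d'
  define g where "g d d' = (\<Sum>j<p. w d d' ^ j)" for d d'
  have epow: "exp_char (real j *\<^sub>R \<alpha>) d = exp_char \<alpha> d ^ j" for j d
  proof -
    have "exp_char (real j *\<^sub>R \<alpha>) d = cis (real j * (- 2 * pi * (\<alpha> \<bullet> d)))"
      by (simp add: exp_char_cis mult_ac)
    then show ?thesis by (simp only: exp_char_cis[of \<alpha>] Complex.DeMoivre)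
  qed
  have wp: "w d d' ^ p = 1" if "d \<in> D" "d' \<in> D" for d d'
  proof -
    have "exp_char (real p *\<^sub>R \<alpha>) x = 1" if "x \<in> D" for x
      using that D alpha by (intro exp_char_integer int_lattice_inner) auto
    then show ?thesis using that by (simp add: w_def power_mult_distrib flip: epow complex_cnj_power)
  qed
  have g: "g d d' = (if w d d' = 1 then of_nat p else 0)" if "d \<in> D" "d' \<in> D" for d d'
    using wp[OF that] by (simp add: g_def geometric_sum)
  have key: "of_real (\<Sum>j<p. (cmod (m (x - real j *\<^sub>R \<alpha>)))\<^sup>2)
      = (\<Sum>d\<in>D. \<Sum>d'\<in>D. exp_char x d * cnj (exp_char x d') * g d d') / (of_nat p)\<^sup>2" for x
  proof -
    have "of_real ((cmod (m (x - real j *\<^sub>R \<alpha>)))\<^sup>2)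
      = (\<Sum>d\<in>D. \<Sum>d'\<in>D. exp_char x d * cnj (exp_char x d') * w d d' ^ j) / (of_nat p)\<^sup>2" for j
    proof -
      let ?z = "m (x - real j *\<^sub>R \<alpha>)"
      have "of_real ((cmod ?z)\<^sup>2) = ?z * cnj ?z" by (rule complex_norm_square)
      also have "\<dots> = (\<Sum>d\<in>D. \<Sum>d'\<in>D. exp_char x d * cnj (exp_char x d') * w d d' ^ j) / (of_nat p)\<^sup>2"
        by (simp add: mask_def card_D exp_char_diff epow sum_product power2_eq_square w_def
            power_mult_distrib mult_ac)
      finally show ?thesis .
    qed
    then have "of_real (\<Sum>j<p. (cmod (m (x - real j *\<^sub>R \<alpha>)))\<^sup>2)
      = (\<Sum>j<p. (\<Sum>d\<in>D. \<Sum>d'\<in>D. exp_char x d * cnj (exp_char x d') * w d d' ^ j) / (of_nat p)\<^sup>2)"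
      by simp
    also have "\<dots> = (\<Sum>j<p. \<Sum>d\<in>D. \<Sum>d'\<in>D. exp_char x d * cnj (exp_char x d') * w d d' ^ j) / (of_nat p)\<^sup>2"
      by (simp add: sum_divide_distrib)
    also have "(\<Sum>j<p. \<Sum>d\<in>D. \<Sum>d'\<in>D. exp_char x d * cnj (exp_char x d') * w d d' ^ j)
      = (\<Sum>d\<in>D. \<Sum>d'\<in>D. exp_char x d * cnj (exp_char x d') * g d d')"
      unfolding g_def sum_distrib_left by (subst sum.swap) (intro sum.cong refl sum.swap)
    finally show ?thesis .
  qed
  have "(\<Sum>j<p. (cmod (m (0 - real j *\<^sub>R \<alpha>)))\<^sup>2) = (\<Sum>j<p. if j = 0 then 1 else 0)"
    using zero by (intro sum.cong refl) (auto simp: mask_minus)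
  also have "\<dots> = (1::real)" using p_ge_2 by simp
  finally have "(\<Sum>d\<in>D. \<Sum>d'\<in>D. g d d') = (of_nat p)\<^sup>2"
    using key[of 0] p_ge_2 by (simp add: field_simps)
  then have "Re (\<Sum>d\<in>D. \<Sum>d'\<in>D. g d d') = (real p)\<^sup>2"
    by (simp flip: of_nat_power)
  then have total: "(\<Sum>d\<in>D. \<Sum>d'\<in>D. Re (g d d')) = (real p)\<^sup>2" by simp
  have diag: "g d d = of_nat p" if "d \<in> D" for d
  proof -
    have "w d d = 1" by (simp add: w_def exp_char_cis cis_cnj cis_mult)
    then show ?thesis using g[OF that that] by simp
  qed
  have nonneg: "0 \<le> Re (g d d')" if "d \<in> D" "d' \<in> D" for d d' using g[OF that] by simp
  have off: "g d d' = 0" if d: "d \<in> D" "d' \<in> D" "d \<noteq> d'" for d d'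
  proof (rule ccontr)
    assume "g d d' \<noteq> 0"
    then have gp: "Re (g d d') = real p" using g[OF d(1,2)] by (simp split: if_splits)
    have "(\<Sum>x\<in>D. real p + (if x = d then real p else 0)) \<le> (\<Sum>x\<in>D. \<Sum>y\<in>D. Re (g x y))"
    proof (rule sum_mono)
      fix x assume x: "x \<in> D"
      show "real p + (if x = d then real p else 0) \<le> (\<Sum>y\<in>D. Re (g x y))"
      proof (cases "x = d")
        case True
        have "(\<Sum>y\<in>{d, d'}. Re (g d y)) \<le> (\<Sum>y\<in>D. Re (g d y))"
          using finite_D d nonneg by (intro sum_mono2) auto
        then show ?thesis using True gp diag[OF d(1)] d(3) by simp
      next
        case False
        have "(\<Sum>y\<in>{x}. Re (g x y)) \<le> (\<Sum>y\<in>D. Re (g x y))"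
          using finite_D x nonneg by (intro sum_mono2) auto
        then show ?thesis using False diag[OF x] by simp
      qed
    qed
    moreover have "(\<Sum>x\<in>D. real p + (if x = d then real p else 0)) = real p * real p + real p"
      using finite_D d(1) card_D by (simp add: sum.distrib)
    ultimately show False using total p_ge_2 by (simp add: power2_eq_square)
  qed
  have "(\<Sum>d\<in>D. \<Sum>d'\<in>D. exp_char y d * cnj (exp_char y d') * g d d')
      = (\<Sum>d\<in>D. \<Sum>d'\<in>D. if d' = d then of_nat p else 0)"
  proof (intro sum.cong refl)
    fix d d' assume d: "d \<in> D" "d' \<in> D"
    have "exp_char y d * cnj (exp_char y d) = 1" by (simp add: exp_char_cis cis_cnj cis_mult)
    then show "exp_char y d * cnj (exp_char y d') * g d d' = (if d' = d then of_nat p else 0)"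
      using diag[OF d(1)] off[OF d] by auto
  qed
  also have "\<dots> = (of_nat p)\<^sup>2" using finite_D card_D by (simp add: power2_eq_square)
  finally have "complex_of_real (\<Sum>j<p. (cmod (m (y - real j *\<^sub>R \<alpha>)))\<^sup>2) = 1"
    unfolding key using p_ge_2 by simp
  then show ?thesis using of_real_eq_1_iff by blast
qed

end

section \<open>Construction of a spectrum\<close>

text \<open>The arithmetic condition with \<open>c\<close> written as \<open>p t / s\<close>, where \<open>s\<close> is prime to \<open>p\<close>.\<close>

locale integral_refinable = refinable +
  fixes k s t :: int
  assumes b_eq: "b = real p * of_int k" and s_pos: "s > 0" and p_not_dvd_s: "\<not> int p dvd s"
    and c_eq: "c * of_int s = real p * of_int t"
begin

text \<open>Vectors of the lattice divided by \<open>p\<close> whose first coordinate is in addition divisible by \<open>s\<close>. The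
extra divisibility cancels the denominator of \<open>c\<close>, so that every positive power of the transposed matrix
maps them into the integer lattice.\<close>

definition coarse :: "(real^2) set" where
  "coarse = {x. \<exists>z1 z2. x $ 1 = of_int (s * z1) / real p \<and> x $ 2 = of_int z2 / real p}"

definition shifts :: "(real^2) set" where
  "shifts = {x. \<exists>z1 z2. x $ 1 = of_int (s * z1) \<and> x $ 2 = of_int z2}"

lemma shifts_int_lattice: "x \<in> shifts \<Longrightarrow> x \<in> int_lattice"
  by (auto simp: shifts_def int_lattice_iff)

lemma shifts_0: "0 \<in> shifts"
  unfolding shifts_def by (auto intro!: exI[of _ 0])

lemma T_coarse:
  assumes "x \<in> coarse" "r \<ge> 1"
  shows "T (int r) x \<in> int_lattice"
proof -
  obtain z1 z2 where z: "x $ 1 = of_int (s * z1) / real p" "x $ 2 = of_int z2 / real p"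
    using assms by (auto simp: coarse_def)
  define e where "e = r - 1"
  have r: "r = Suc e" using assms(2) by (simp add: e_def)
  have bz: "b = of_int (int p * k)" using b_eq by simp
  have "T (int r) x $ 1 = b ^ e * (b / real p * of_int (s * z1))" using z by (simp add: r del: of_nat_Suc)
  also have "b / real p = of_int k" using b_eq p_ge_2 by simp
  finally have 1: "T (int r) x $ 1 = of_int ((int p * k) ^ e * (k * (s * z1)))" unfolding bz by simp
  have "T (int r) x $ 2 = b ^ r * (x $ 2 + real r * (c / b) * x $ 1)" by (simp add: shear_2)
  also have "\<dots> = b ^ e * (b * x $ 2 + real r * c * x $ 1)"
    by (simp add: r distrib_left del: of_nat_Suc)
  also have "b * x $ 2 = b / real p * of_int z2" by (simp add: z)
  also have "real r * c * x $ 1 = real r * (c * of_int s) * of_int z1 / real p" by (simp add: z)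
  also have "b / real p = of_int k" using b_eq p_ge_2 by simp
  also have "real r * (c * of_int s) * of_int z1 / real p = of_int (int r * t * z1)"
    unfolding c_eq using p_ge_2 by simp
  finally have 2: "T (int r) x $ 2 = of_int ((int p * k) ^ e * (k * z2 + int r * t * z1))"
    unfolding bz by simp
  show ?thesis unfolding int_lattice_iff 1 2 by (intro conjI Ints_of_int)
qed

text \<open>Because \<open>s\<close> is invertible modulo \<open>p\<close>, \<open>a\<close> can be changed by an element of \<open>p\<close> times the lattice so that
its first coordinate becomes divisible by \<open>s\<close>.\<close>

lemma exists_step:
  obtains \<alpha> where "real p *\<^sub>R \<alpha> \<in> int_lattice" "\<And>j. 1 \<le> j \<Longrightarrow> j < p \<Longrightarrow> m (real j *\<^sub>R \<alpha>) = 0"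
    "\<And>j x. x \<in> shifts \<Longrightarrow> real j *\<^sub>R \<alpha> + x \<in> coarse"
proof -
  obtain a1 where a1: "a $ 1 = of_int a1" using a by blast
  have "a $ 2 \<in> \<int>" using a by (simp add: int_lattice_iff)
  then obtain a2 where a2: "a $ 2 = of_int a2" by (rule Ints_cases)
  have "coprime s (int p)" 
    using prime_imp_coprime[OF prime_int_p p_not_dvd_s] by (simp add: coprime_commute)
  then obtain x y where xy: "x * s + y * int p = 1" by (metis bezout_int coprime_iff_gcd_eq_1)
  define \<alpha> :: "real^2" where "\<alpha> = vector [of_int (s * (x * a1)) / real p, of_int a2 / real p]"
  have "s * (x * a1) = a1 * (x * s)" by simp
  also have "\<dots> = a1 * (1 - y * int p)" using xy by (simp add: eq_diff_eq)
  finally have e: "s * (x * a1) = a1 - int p * (a1 * y)" by (simp add: algebra_simps)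
  have "real p *\<^sub>R \<alpha> \<in> int_lattice" using p_ge_2 by (simp add: \<alpha>_def int_lattice_iff)
  moreover have "m (real j *\<^sub>R \<alpha>) = 0" if j: "1 \<le> j" "j < p" for j
  proof -
    define z :: "real^2" where "z = vector [- of_int (int j * (a1 * y)), 0]"
    have z: "z \<in> int_lattice" by (simp add: z_def int_lattice_iff)
    have "real j *\<^sub>R \<alpha> = (real j / real p) *\<^sub>R a + z"
    proof (rule vec2_eqI)
      have "real_of_int (s * (x * a1)) = of_int a1 - real p * of_int (a1 * y)" unfolding e by simp
      moreover have "\<alpha> $ 1 = of_int (s * (x * a1)) / real p" by (simp add: \<alpha>_def)
      ultimately have "\<alpha> $ 1 = of_int a1 / real p - of_int (a1 * y)"
        using p_ge_2 by (simp add: diff_divide_distrib)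
      then show "(real j *\<^sub>R \<alpha>) $ 1 = ((real j / real p) *\<^sub>R a + z) $ 1"
        by (simp add: z_def a1 right_diff_distrib)
      show "(real j *\<^sub>R \<alpha>) $ 2 = ((real j / real p) *\<^sub>R a + z) $ 2"
        by (simp add: \<alpha>_def z_def a2)
    qed
    moreover have "j \<in> {1..p - 1}" using j by auto
    ultimately show ?thesis unfolding m_zero_iff using z by blast
  qed
  moreover have "real j *\<^sub>R \<alpha> + v \<in> coarse" if "v \<in> shifts" for j v
  proof -
    obtain z1 z2 where v: "v $ 1 = of_int (s * z1)" "v $ 2 = of_int z2" using \<open>v \<in> shifts\<close> by (auto simp: shifts_def)
    have "(real j *\<^sub>R \<alpha> + v) $ 1 = of_int (s * (int j * x * a1 + int p * z1)) / real p"
      using p_ge_2 by (simp add: \<alpha>_def v field_simps)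
    moreover have "(real j *\<^sub>R \<alpha> + v) $ 2 = of_int (int j * a2 + int p * z2) / real p"
      using p_ge_2 by (simp add: \<alpha>_def v field_simps)
    ultimately show ?thesis unfolding coarse_def by blast
  qed
  ultimately show thesis using that by blast
qed

text \<open>The level of a zero is determined by its first coordinate, since \<open>b\<close> is an integer divisible by \<open>p\<close>.
So both zeros have the same level \<open>n\<close>, their images under \<open>T (- n)\<close> have the same residue, and the
difference of the images would be a lattice vector; its second coordinate is \<open>1 / b ^ n\<close>.\<close>

lemma no_common_zero:
  assumes "\<phi> y = 0" "\<phi> (y - axis 2 1) = 0"
  shows False
proof -
  obtain n where n: "n \<ge> 1" "level n y" using phi_zero_level[OF assms(1)] by blast
  obtain n' where n': "n' \<ge> 1" "level n' (y - axis 2 1)" using phi_zero_level[OF assms(2)] by blast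
  obtain l where l: "real p * y $ 1 = b ^ n * of_int l" "\<not> int p dvd l" using level_first[OF n(2)] by blast
  obtain l' where l': "real p * (y - axis 2 1) $ 1 = b ^ n' * of_int l'" "\<not> int p dvd l'"
    using level_first[OF n'(2)] by blast
  have eq: "b ^ n * of_int l = b ^ n' * of_int l'" using l(1) l'(1) by (simp add: axis_def)
  have bz: "b = of_int (int p * k)" using b_eq by simp
  have less: False if H: "b ^ i * of_int u = b ^ i' * of_int u'" "\<not> int p dvd u" "i < i'" for i i' u u'
  proof -
    define f where "f = i' - i"
    have f: "i' = i + f" "f \<ge> 1" using H(3) by (auto simp: f_def)
    have "of_int u = b ^ f * of_int u'" using H(1) b by (simp add: f power_add)
    also have "\<dots> = of_int ((int p * k) ^ f * u')" unfolding bz by simp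
    finally have "u = (int p * k) ^ f * u'" by linarith
    moreover have "int p dvd (int p * k) ^ f"
      using f(2) by (meson dvd_power dvd_trans dvd_triv_left less_le_trans zero_less_one)
    ultimately show False using H(2) by simp
  qed
  have nn: "n = n'" using less[OF eq l(2)] less[OF eq[symmetric] l'(2)] by (meson nat_neq_iff)
  have "T (- int n) y - T (- int n) (y - axis 2 1) \<in> int_lattice"
    using n(2) n'(2) nn by (intro m_zero_diff) (auto simp: level_def axis_def)
  moreover have "T (- int n) y - T (- int n) (y - axis 2 1) = T (- int n) (axis 2 1)"
    by (simp add: shear_diff)
  ultimately have "T (- int n) (axis 2 1) $ 2 \<in> \<int>" by (simp add: int_lattice_iff)
  then have "1 / b ^ n \<in> \<int>" by (simp add: shear_2 axis_def power_int_minus divide_inverse)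
  then obtain z where z: "1 / b ^ n = of_int z" by (rule Ints_cases)
  have "1 < b ^ n" using b n(1) by (simp add: one_less_power)
  then have "0 < 1 / b ^ n" "1 / b ^ n < 1" by auto
  then have "0 < real_of_int z" "real_of_int z < 1" unfolding z by auto
  then show False by simp
qed

text \<open>The translations in \<open>shifts\<close> bring every point into a compact rectangle, and there one of the two
values in the preceding lemma is bounded away from 0.\<close>

lemma uniform_nonvanishing:
  obtains \<epsilon> where "0 < \<epsilon>" "\<epsilon> \<le> 1" "\<And>x. \<exists>\<kappa>\<in>shifts. \<epsilon> \<le> cmod (\<phi> (x - \<kappa>))"
proof -
  define K where "K = cbox 0 (vector [of_int s, 1] :: real^2)"
  define f where "f x = max (cmod (\<phi> x)) (cmod (\<phi> (x - axis 2 1)))" for x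
  have mem: "x \<in> K \<longleftrightarrow> 0 \<le> x $ 1 \<and> x $ 1 \<le> of_int s \<and> 0 \<le> x $ 2 \<and> x $ 2 \<le> 1" for x
    by (auto simp: K_def mem_box_cart forall_2)
  have "continuous_on K f"
    unfolding f_def
    by (intro continuous_on_max continuous_on_norm continuous_on_compose2[OF continuous_phi] continuous_intros) auto
  moreover have "0 \<in> K" using s_pos by (simp add: mem)
  then have "K \<noteq> {}" by blast
  moreover have "compact K" by (simp add: K_def compact_cbox)
  ultimately obtain x0 where x0: "x0 \<in> K" "\<And>x. x \<in> K \<Longrightarrow> f x0 \<le> f x"
    using continuous_attains_inf[of K f] by blast
  have "f x0 > 0"
  proof (rule ccontr)
    assume "\<not> ?thesis"
    moreover have "cmod (\<phi> x0) \<le> f x0" "cmod (\<phi> (x0 - axis 2 1)) \<le> f x0" by (simp_all add: f_def)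
    ultimately have "cmod (\<phi> x0) \<le> 0" "cmod (\<phi> (x0 - axis 2 1)) \<le> 0" by linarith+
    then show False using no_common_zero[of x0] by simp
  qed
  moreover have "f x0 \<le> 1" by (simp add: f_def norm_phi_le)
  moreover have "\<exists>\<kappa>\<in>shifts. f x0 \<le> cmod (\<phi> (x - \<kappa>))" for x
  proof -
    define z1 where "z1 = \<lfloor>x $ 1 / of_int s\<rfloor>"
    define z2 where "z2 = \<lfloor>x $ 2\<rfloor>"
    define \<kappa> :: "real^2" where "\<kappa> = vector [of_int (s * z1), of_int z2]"
    have k1: "\<kappa> \<in> shifts" by (auto simp: shifts_def \<kappa>_def)
    have "\<kappa> + axis 2 1 = vector [of_int (s * z1), of_int (z2 + 1)]"
      by (rule vec2_eqI) (simp_all add: \<kappa>_def axis_def)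
    then have "(\<kappa> + axis 2 1) $ 1 = of_int (s * z1)" "(\<kappa> + axis 2 1) $ 2 = of_int (z2 + 1)" by simp_all
    then have k2: "\<kappa> + axis 2 1 \<in> shifts" unfolding shifts_def by blast
    have "of_int z1 \<le> x $ 1 / of_int s" "x $ 1 / of_int s \<le> of_int z1 + 1" unfolding z1_def by linarith+
    then have "of_int s * of_int z1 \<le> x $ 1" "x $ 1 \<le> of_int s * of_int z1 + of_int s"
      using s_pos by (simp_all add: le_divide_eq divide_le_eq algebra_simps)
    moreover have "of_int z2 \<le> x $ 2" "x $ 2 \<le> of_int z2 + 1" unfolding z2_def by linarith+
    ultimately have "x - \<kappa> \<in> K" unfolding mem by (simp add: \<kappa>_def)
    then have "f x0 \<le> f (x - \<kappa>)" by (rule x0(2))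
    then have "f x0 \<le> cmod (\<phi> (x - \<kappa>)) \<or> f x0 \<le> cmod (\<phi> (x - (\<kappa> + axis 2 1)))"
      unfolding f_def[of "x - \<kappa>"] by (auto simp: le_max_iff_disj diff_diff_eq)
    then show ?thesis using k1 k2 by blast
  qed
  ultimately show thesis using that by blast
qed

text \<open>The spectrum is the union of the finite sets \<open>L n\<close>. Each point \<open>r\<close> of \<open>L n\<close> is replaced by \<open>p\<close> points
\<open>r + T (n + 1) (j \<alpha> + \<kappa>)\<close>. The first \<open>n\<close> factors of the product do not see this change, and in the next
factor the values \<open>j\<close> share the mass of \<open>r\<close> by \<open>mask_hadamard\<close>. The shift \<open>\<kappa>\<close> is invisible to all
these factors; it is used to keep \<open>\<phi> (- T (- n) l)\<close> away from 0 for all \<open>l\<close> in \<open>L n\<close>. For \<open>j = 0\<close> no shift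
is needed, because the refinement equation only increases the absolute value, so the sets increase.
The lower bound compares the \<open>n\<close>-th product with \<open>\<phi>\<close> uniformly on \<open>L n\<close>, and the total mass 1 survives
in the limit by domination.\<close>

theorem exists_spectrum:
  "\<exists>\<Lambda>. countable \<Lambda> \<and> orthogonal_for \<phi> \<Lambda> \<and> complete_for \<phi> \<Lambda>"
proof -
  obtain \<alpha> where alpha: "real p *\<^sub>R \<alpha> \<in> int_lattice"
    and zero: "\<And>j. 1 \<le> j \<Longrightarrow> j < p \<Longrightarrow> m (real j *\<^sub>R \<alpha>) = 0"
    and coarse: "\<And>j x. x \<in> shifts \<Longrightarrow> real j *\<^sub>R \<alpha> + x \<in> coarse" using exists_step by blast
  obtain \<epsilon> where \<epsilon>: "0 < \<epsilon>" "\<epsilon> \<le> 1" "\<And>x. \<exists>\<kappa>\<in>shifts. \<epsilon> \<le> cmod (\<phi> (x - \<kappa>))"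
    using uniform_nonvanishing by blast
  then obtain \<kappa> where \<kappa>: "\<And>x. \<kappa> x \<in> shifts" "\<And>x. \<epsilon> \<le> cmod (\<phi> (x - \<kappa> x))" by metis
  (* The argument of \<kappa> is chosen so that - T (- (n + 1)) (child n r j) is this
     argument minus its shift. *)
  define inc where "inc n r j = real j *\<^sub>R \<alpha> +
    (if j = 0 then 0 else \<kappa> (- (T (- int (Suc n)) r + real j *\<^sub>R \<alpha>)))" for n r and j :: nat
  define child where "child n r j = r + T (int (Suc n)) (inc n r j)" for n r and j :: nat
  define L where "L = rec_nat {0} (\<lambda>n S. (\<lambda>(r, j). child n r j) ` (S \<times> {..<p}))"
  have L0: "L 0 = {0}" and LS: "L (Suc n) = (\<lambda>(r, j). child n r j) ` (L n \<times> {..<p})" for n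
    by (simp_all add: L_def)
  have inc_shift: "\<exists>x\<in>shifts. inc n r j = real j *\<^sub>R \<alpha> + x" for n r j
    using \<kappa>(1) shifts_0 unfolding inc_def by auto
  have inc_coarse: "inc n r j \<in> coarse" for n r j using inc_shift[of n r j] coarse by auto
  have low: "m (T (- int i) (\<xi> - child n r j)) = m (T (- int i) (\<xi> - r))" if "i \<le> n" for i n r j \<xi>
  proof -
    define e where "e = Suc n - i"
    have e: "int e = int (Suc n) - int i" "e \<ge> 1" using that by (auto simp: e_def)
    have "T (- int i) (\<xi> - r) = T (- int i) (\<xi> - child n r j) + T (int e) (inc n r j)"
      unfolding e child_def by (simp add: shear_diff shear_add T_T)
    then show ?thesis using m_periodic[OF T_coarse[OF inc_coarse e(2)]] by metis
  qed
  have M_child: "M n (\<xi> - child n r j) = M n (\<xi> - r)" for n \<xi> r j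
    unfolding M_def by (intro prod.cong refl low) auto
  have m_child: "m (T (- int (Suc n)) (\<xi> - child n r j)) = m (T (- int (Suc n)) (\<xi> - r) - real j *\<^sub>R \<alpha>)" for n \<xi> r j
  proof -
    obtain x where x: "x \<in> shifts" "inc n r j = real j *\<^sub>R \<alpha> + x" using inc_shift by blast
    have "T (- int (Suc n)) (\<xi> - r) - real j *\<^sub>R \<alpha> = T (- int (Suc n)) (\<xi> - child n r j) + x"
      unfolding child_def by (simp add: shear_diff shear_add T_T x(2) del: of_nat_Suc)
    then show ?thesis using m_periodic[OF shifts_int_lattice[OF x(1)]] by metis
  qed
  have hadamard: "(\<Sum>j<p. (cmod (m (y - real j *\<^sub>R \<alpha>)))\<^sup>2) = 1" for y
    by (rule mask_hadamard[OF alpha]) (rule zero)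
  have zero': "m (real j *\<^sub>R \<alpha> - real i *\<^sub>R \<alpha>) = 0" if "i < p" "j < p" "i \<noteq> j" for i j :: nat
  proof (cases "i < j")
    case True
    then have "real j *\<^sub>R \<alpha> - real i *\<^sub>R \<alpha> = real (j - i) *\<^sub>R \<alpha>"
      by (simp add: of_nat_diff flip: scaleR_diff_left)
    then show ?thesis using zero[of "j - i"] that True by simp
  next
    case False
    then have "real j *\<^sub>R \<alpha> - real i *\<^sub>R \<alpha> = - (real (i - j) *\<^sub>R \<alpha>)"
      by (simp add: of_nat_diff scaleR_diff_left)
    then show ?thesis using zero[of "i - j"] that False by (simp add: mask_minus)
  qed
  have orth: "M n (r - r') = 0" if "finite S" "\<And>\<xi>. (\<Sum>l\<in>S. (cmod (M n (\<xi> - l)))\<^sup>2) = 1"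
    "r \<in> S" "r' \<in> S" "r \<noteq> r'" for n S r r'
  proof -
    have "(\<Sum>l\<in>{r, r'}. (cmod (M n (r - l)))\<^sup>2) \<le> (\<Sum>l\<in>S. (cmod (M n (r - l)))\<^sup>2)"
      using that by (intro sum_mono2) auto
    also have "\<dots> = 1" by (rule that(2))
    finally have "(cmod (M n (r - r')))\<^sup>2 \<le> 0" using that(5) by simp
    then show ?thesis by simp
  qed
  have L: "finite (L n) \<and> (\<forall>\<xi>. (\<Sum>l\<in>L n. (cmod (M n (\<xi> - l)))\<^sup>2) = 1)" for n
  proof (induction n)
    case 0 then show ?case by (simp add: L0)
  next
    case (Suc n)
    have inj: "inj_on (\<lambda>(r, j). child n r j) (L n \<times> {..<p})"
    proof (rule inj_onI)
      fix z z' assume zz: "z \<in> L n \<times> {..<p}" "z' \<in> L n \<times> {..<p}"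
        "(case z of (r, j) \<Rightarrow> child n r j) = (case z' of (r, j) \<Rightarrow> child n r j)"
      obtain r j r' j' where z: "z = (r, j)" "z' = (r', j')" by (metis surj_pair)
      have H: "r \<in> L n" "r' \<in> L n" "child n r j = child n r' j'" "j \<in> {..<p}" "j' \<in> {..<p}"
        using zz by (simp_all add: z)
      have "M n (r - r') = M n (r - child n r' j')" by (rule M_child[symmetric])
      also have "\<dots> = M n (r - child n r j)" by (simp add: H(3))
      also have "\<dots> = 1" by (simp add: M_child)
      finally have rr: "r = r'" using orth[of "L n" n r r'] Suc H by fastforce
      have "T (int (Suc n)) (inc n r j) = T (int (Suc n)) (inc n r j')"
        using H(3) unfolding child_def rr by simp
      then have "T (- int (Suc n)) (T (int (Suc n)) (inc n r j)) = T (- int (Suc n)) (T (int (Suc n)) (inc n r j'))"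
        by simp
      then have ie: "inc n r j = inc n r j'" unfolding T_T by simp
      obtain x where x: "x \<in> shifts" "inc n r j = real j *\<^sub>R \<alpha> + x" using inc_shift by blast
      obtain x' where x': "x' \<in> shifts" "inc n r j' = real j' *\<^sub>R \<alpha> + x'" using inc_shift by blast
      have "real j *\<^sub>R \<alpha> - real j' *\<^sub>R \<alpha> = 0 + (x' - x)" using ie x x' by (simp add: algebra_simps)
      moreover have "x' - x \<in> int_lattice" using x x' by (intro int_lattice_diff shifts_int_lattice)
      ultimately have "m (real j *\<^sub>R \<alpha> - real j' *\<^sub>R \<alpha>) = 1" using m_periodic[of "x' - x" 0] by simp
      then have "j = j'" using zero'[of j' j] H by fastforce
      then show "z = z'" using rr z by simp
    qed
    have "(\<Sum>l\<in>L (Suc n). (cmod (M (Suc n) (\<xi> - l)))\<^sup>2) = 1" for \<xi>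
    proof -
      have "(\<Sum>l\<in>L (Suc n). (cmod (M (Suc n) (\<xi> - l)))\<^sup>2)
        = (\<Sum>(r, j)\<in>L n \<times> {..<p}. (cmod (M (Suc n) (\<xi> - child n r j)))\<^sup>2)"
        unfolding LS sum.reindex[OF inj] by (simp add: case_prod_beta)
      also have "\<dots> = (\<Sum>r\<in>L n. \<Sum>j<p. (cmod (M (Suc n) (\<xi> - child n r j)))\<^sup>2)"
        by (rule sum.cartesian_product[symmetric])
      also have "\<dots> = (\<Sum>r\<in>L n. (cmod (M n (\<xi> - r)))\<^sup>2 *
          (\<Sum>j<p. (cmod (m (T (- int (Suc n)) (\<xi> - r) - real j *\<^sub>R \<alpha>)))\<^sup>2))"
        unfolding M_Suc M_child m_child norm_mult power_mult_distrib sum_distrib_left ..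
      also have "\<dots> = (\<Sum>r\<in>L n. (cmod (M n (\<xi> - r)))\<^sup>2)"
        unfolding hadamard by simp
      finally show ?thesis using Suc by simp
    qed
    then show ?case using Suc by (simp add: LS)
  qed
  have L_fin: "finite (L n)" and L_sum: "(\<Sum>l\<in>L n. (cmod (M n (\<xi> - l)))\<^sup>2) = 1" for n \<xi>
    using L by blast+
  have child0: "child n r 0 = r" for n r by (simp add: child_def inc_def)
  have L_Suc: "L n \<subseteq> L (Suc n)" for n
  proof
    fix r assume "r \<in> L n"
    then have "(r, 0) \<in> L n \<times> {..<p}" using p_ge_2 by simp
    then have "(\<lambda>(r, j). child n r j) (r, 0) \<in> L (Suc n)" unfolding LS by (rule imageI)
    then show "r \<in> L (Suc n)" by (simp add: child0)
  qed
  have L_mono: "L n \<subseteq> L n'" if "n \<le> n'" for n n'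
    using that by (rule lift_Suc_mono_le[of L, rotated]) (rule L_Suc)
  have lower: "\<epsilon> \<le> cmod (\<phi> (- T (- int n) l))" if "l \<in> L n" for n l
    using that
  proof (induction n arbitrary: l)
    case 0 then show ?case using \<epsilon> by (simp add: L0 phi_0)
  next
    case (Suc n)
    then obtain r j where rj: "r \<in> L n" "j < p" "l = child n r j" unfolding LS by auto
    show ?case
    proof (cases "j = 0")
      case True
      then have l: "l = r" using rj child0 by simp
      have "\<epsilon> \<le> cmod (\<phi> (- T (- int n) r))" by (rule Suc.IH[OF rj(1)])
      also have "\<dots> = cmod (m (- T (- int (Suc n)) r)) * cmod (\<phi> (- T (- int (Suc n)) r))"
        by (subst refine) (simp add: norm_mult shear_minus T_T)
      also have "\<dots> \<le> 1 * cmod (\<phi> (- T (- int (Suc n)) r))"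
        by (intro mult_right_mono norm_mask_le) simp
      finally show ?thesis using l by simp
    next
      case False
      let ?x = "- (T (- int (Suc n)) r + real j *\<^sub>R \<alpha>)"
      have "- T (- int (Suc n)) l = ?x - \<kappa> ?x"
        unfolding rj(3) child_def inc_def using False by (simp add: shear_add T_T del: of_nat_Suc)
      then show ?thesis using \<kappa>(2)[of ?x] by simp
    qed
  qed
  define \<Lambda> where "\<Lambda> = (\<Union>n. L n)"
  have "countable \<Lambda>" unfolding \<Lambda>_def by (rule countable_UN) (simp_all add: countable_finite L_fin)
  moreover have "orthogonal_for \<phi> \<Lambda>"
    unfolding orthogonal_for_def
  proof (intro ballI impI)
    fix x y assume xy: "x \<in> \<Lambda>" "y \<in> \<Lambda>" "x \<noteq> y"
    then obtain n n' where "x \<in> L n" "y \<in> L n'" by (auto simp: \<Lambda>_def)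
    then have "x \<in> L (max n n')" "y \<in> L (max n n')"
      using L_mono[of n "max n n'"] L_mono[of n' "max n n'"] by auto
    then have "M (max n n') (x - y) = 0" using orth[OF L_fin L_sum] xy(3) by blast
    then show "\<phi> (x - y) = 0" using phi_M[of "x - y" "max n n'"] by simp
  qed
  moreover have "complete_for \<phi> \<Lambda>"
    unfolding complete_for_def
  proof (intro allI impI)
    fix \<xi> :: "real^2" and \<delta> :: real assume \<delta>: "\<delta> > 0"
    obtain d where d: "d > 0" "\<And>x y. dist x y < d \<Longrightarrow> dist (\<phi> x) (\<phi> y) < \<epsilon> / 2"
      using uniformly_continuous_phi \<epsilon>(1) unfolding uniformly_continuous_on_def
      by (metis UNIV_I half_gt_zero)
    have "eventually (\<lambda>n. dist (T (- int n) \<xi>) 0 < d) sequentially"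
      using shear_contracts[OF b] d(1) by (rule tendstoD)
    then obtain n1 where n1: "\<And>n. n \<ge> n1 \<Longrightarrow> norm (T (- int n) \<xi>) < d"
      by (auto simp: eventually_sequentially)
    have half: "\<epsilon> / 2 \<le> cmod (\<phi> (T (- int n) (\<xi> - l)))" if "n \<ge> n1" "l \<in> L n" for n l
    proof -
      have "dist (\<phi> (T (- int n) (\<xi> - l))) (\<phi> (- T (- int n) l)) < \<epsilon> / 2"
        using n1[OF that(1)] by (intro d(2)) (simp add: dist_norm shear_diff)
      then have "cmod (\<phi> (- T (- int n) l)) - cmod (\<phi> (T (- int n) (\<xi> - l))) < \<epsilon> / 2"
        unfolding dist_norm using norm_triangle_ineq2[of "\<phi> (- T (- int n) l)" "\<phi> (T (- int n) (\<xi> - l))"]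
        by (simp add: norm_minus_commute)
      then show ?thesis using lower[OF that(2)] by simp
    qed
    have dom: "(cmod (M n (\<xi> - l)))\<^sup>2 \<le> 4 / \<epsilon>\<^sup>2 * (cmod (\<phi> (\<xi> - l)))\<^sup>2" if "n \<ge> n1" "l \<in> L n" for n l
    proof -
      have "(\<epsilon> / 2)\<^sup>2 \<le> (cmod (\<phi> (T (- int n) (\<xi> - l))))\<^sup>2"
        using half[OF that] \<epsilon>(1) by (intro power_mono) auto
      then have "(cmod (M n (\<xi> - l)))\<^sup>2 * (\<epsilon> / 2)\<^sup>2 \<le> (cmod (M n (\<xi> - l)))\<^sup>2 * (cmod (\<phi> (T (- int n) (\<xi> - l))))\<^sup>2"
        by (rule mult_left_mono) simp
      also have "\<dots> = (cmod (\<phi> (\<xi> - l)))\<^sup>2"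
        using arg_cong[OF phi_M[of "\<xi> - l" n], of cmod] by (simp only: norm_mult power_mult_distrib)
      finally show ?thesis using \<epsilon>(1) by (simp add: field_simps power_divide)
    qed
    define S where "S n = (\<Sum>l\<in>L n. (cmod (\<phi> (\<xi> - l)))\<^sup>2)" for n
    have S_mono: "S n \<le> S n'" if "n \<le> n'" for n n'
      unfolding S_def by (rule sum_mono2[OF L_fin L_mono[OF that]]) simp
    have S_le: "S n \<le> 1" for n
    proof -
      have "S n \<le> (\<Sum>l\<in>L n. (cmod (M n (\<xi> - l)))\<^sup>2)"
        unfolding S_def by (intro sum_mono norm_phi_le_M)
      then show ?thesis by (simp add: L_sum)
    qed
    (* Chosen so that the domination constant 4 / \<epsilon>^2 turns it into \<delta> / 2. *)
    define \<delta>' where "\<delta>' = \<delta> * \<epsilon>\<^sup>2 / 8"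
    have \<delta>': "\<delta>' > 0" using \<delta> \<epsilon>(1) by (simp add: \<delta>'_def)
    have S_ge: "0 \<le> S n" for n unfolding S_def by (intro sum_nonneg) simp
    have "Bseq S" by (rule BseqI'[of _ 1]) (use S_le S_ge in simp)
    then have "convergent S" using S_mono by (intro Bseq_mono_convergent) auto
    then have "Cauchy S" by (simp add: Cauchy_convergent_iff)
    then obtain n2 where n2: "\<And>n n'. n \<ge> n2 \<Longrightarrow> n' \<ge> n2 \<Longrightarrow> dist (S n) (S n') < \<delta>'"
      using \<delta>' unfolding Cauchy_def by blast
    define N where "N = max n1 n2"
    have bound: "1 - 4 / \<epsilon>\<^sup>2 * \<delta>' \<le> (\<Sum>l\<in>L N. (cmod (M n (\<xi> - l)))\<^sup>2)" if n: "n \<ge> N" for n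
    proof -
      have "1 = (\<Sum>l\<in>L n - L N. (cmod (M n (\<xi> - l)))\<^sup>2) + (\<Sum>l\<in>L N. (cmod (M n (\<xi> - l)))\<^sup>2)"
        using sum.subset_diff[OF L_mono[OF n] L_fin, of "\<lambda>l. (cmod (M n (\<xi> - l)))\<^sup>2"] by (simp add: L_sum)
      also have "(\<Sum>l\<in>L n - L N. (cmod (M n (\<xi> - l)))\<^sup>2) \<le> (\<Sum>l\<in>L n - L N. 4 / \<epsilon>\<^sup>2 * (cmod (\<phi> (\<xi> - l)))\<^sup>2)"
        by (rule sum_mono, rule dom) (use n in \<open>auto simp: N_def\<close>)
      also have "\<dots> = 4 / \<epsilon>\<^sup>2 * (S n - S N)"
        unfolding S_def sum.subset_diff[OF L_mono[OF n] L_fin, of "\<lambda>l. (cmod (\<phi> (\<xi> - l)))\<^sup>2"]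
        by (simp add: sum_distrib_left)
      also have "\<dots> \<le> 4 / \<epsilon>\<^sup>2 * \<delta>'"
        using n2[of n N] n by (intro mult_left_mono) (auto simp: N_def dist_real_def)
      finally show ?thesis by simp
    qed
    have "(\<lambda>n. \<Sum>l\<in>L N. (cmod (M n (\<xi> - l)))\<^sup>2) \<longlonglongrightarrow> S N"
      unfolding S_def by (intro tendsto_sum tendsto_power tendsto_norm M_tendsto)
    then have "1 - 4 / \<epsilon>\<^sup>2 * \<delta>' \<le> S N" using bound by (intro LIMSEQ_le_const) auto
    moreover have "4 / \<epsilon>\<^sup>2 * \<delta>' = \<delta> / 2" using \<epsilon>(1) by (simp add: \<delta>'_def)
    ultimately have "1 - \<delta> < S N" using \<delta> by simp
    then show "\<exists>F. finite F \<and> F \<subseteq> \<Lambda> \<and> 1 - \<delta> < (\<Sum>l\<in>F. (cmod (\<phi> (\<xi> - l)))\<^sup>2)"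
      by (intro exI[of _ "L N"]) (auto simp: L_fin \<Lambda>_def S_def)
  qed
  ultimately show ?thesis by blast
qed

end

section \<open>Fourier transforms of plane probability measures\<close>

lemma fourier_delta_measure:
  assumes "finite D"
  shows "fourier (delta_measure D) = mask D"
proof
  fix \<xi>
  have "fourier (delta_measure D) \<xi> = (\<integral>x. exp_char \<xi> x \<partial>uniform_count_measure D)"
    unfolding fourier_def delta_measure_def
  proof (rule integral_distr)
    show "(\<lambda>x. x) \<in> measurable (uniform_count_measure D) borel"
      by (simp add: measurable_def space_uniform_count_measure sets_uniform_count_measure)
    have "continuous_on UNIV (exp_char \<xi>)" unfolding exp_char_def by (intro continuous_intros)
    then show "exp_char \<xi> \<in> borel_measurable borel" by (rule borel_measurable_continuous_onI)
  qed
  also have "\<dots> = (\<Sum>d\<in>D. (1 / card D) *\<^sub>R exp_char \<xi> d)"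
    unfolding uniform_count_measure_def using assms
    by (intro lebesgue_integral_point_measure_finite) auto
  also have "\<dots> = mask D \<xi>"
    by (simp add: mask_def scaleR_conv_of_real sum_divide_distrib)
  finally show "fourier (delta_measure D) \<xi> = mask D \<xi>" .
qed

locale plane_probability = prob_space \<mu> for \<mu> :: "(real^2) measure" +
  assumes sets_mu: "sets \<mu> = sets borel"
begin

lemma space_mu [simp]: "space \<mu> = UNIV"
  using sets_eq_imp_space_eq[OF sets_mu] by simp

lemma prob_UNIV [simp]: "prob UNIV = 1"
  using prob_space by simp

lemma borel_measurable_mu: "f \<in> borel_measurable borel \<Longrightarrow> f \<in> borel_measurable \<mu>"
  using measurable_cong_sets[OF sets_mu refl] by blast

lemma continuous_measurable: "continuous_on UNIV f \<Longrightarrow> f \<in> borel_measurable \<mu>"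
  by (intro borel_measurable_mu borel_measurable_continuous_onI)

lemma continuous_exp_char: "continuous_on UNIV (exp_char \<xi>)"
  unfolding exp_char_def by (intro continuous_intros)

lemma exp_char_measurable [measurable]: "exp_char \<xi> \<in> borel_measurable \<mu>"
  by (rule continuous_measurable[OF continuous_exp_char])

lemma bounded_integrable:
  fixes f :: "real^2 \<Rightarrow> 'b :: {banach, second_countable_topology}"
  assumes "f \<in> borel_measurable \<mu>" "\<And>x. norm (f x) \<le> B"
  shows "integrable \<mu> f"
  by (rule integrable_const_bound[of _ B]) (use assms in auto)

lemma exp_char_integrable: "integrable \<mu> (exp_char \<xi>)"
  by (rule bounded_integrable[of _ 1]) (auto simp: exp_char_measurable)

lemma fourier_zero: "fourier \<mu> 0 = 1"
  by (simp add: fourier_def prob_space)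

lemma norm_fourier_le: "cmod (fourier \<mu> \<xi>) \<le> 1"
proof -
  have "cmod (fourier \<mu> \<xi>) \<le> (\<integral>x. cmod (exp_char \<xi> x) \<partial>\<mu>)"
    unfolding fourier_def by (rule integral_norm_bound)
  then show ?thesis by (simp add: prob_space)
qed

lemma fourier_minus: "fourier \<mu> (- \<xi>) = cnj (fourier \<mu> \<xi>)"
  by (simp add: fourier_def exp_char_minus)

lemma norm_square_exp_sum:
  fixes x :: "'i \<Rightarrow> real^2"
  assumes "finite I"
  shows "(\<Sum>i\<in>I. \<Sum>j\<in>I. w i * cnj (w j) * fourier \<mu> (x i - x j))
    = of_real (\<integral>y. (cmod (\<Sum>i\<in>I. w i * exp_char (x i) y))\<^sup>2 \<partial>\<mu>)"
proof -
  have e: "complex_of_real ((cmod (\<Sum>i\<in>I. w i * exp_char (x i) y))\<^sup>2)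
    = (\<Sum>i\<in>I. \<Sum>j\<in>I. w i * cnj (w j) * exp_char (x i - x j) y)" for y
    unfolding complex_norm_square cnj_sum sum_product
    by (simp add: exp_char_diff mult_ac)
  have "(\<Sum>i\<in>I. \<Sum>j\<in>I. w i * cnj (w j) * fourier \<mu> (x i - x j))
    = (\<Sum>i\<in>I. \<Sum>j\<in>I. (\<integral>y. w i * cnj (w j) * exp_char (x i - x j) y \<partial>\<mu>))"
    by (simp add: fourier_def)
  also have "\<dots> = (\<Sum>i\<in>I. (\<integral>y. (\<Sum>j\<in>I. w i * cnj (w j) * exp_char (x i - x j) y) \<partial>\<mu>))"
    by (intro sum.cong refl, subst Bochner_Integration.integral_sum)
       (auto intro!: integrable_mult_right exp_char_integrable)
  also have "\<dots> = (\<integral>y. (\<Sum>i\<in>I. \<Sum>j\<in>I. w i * cnj (w j) * exp_char (x i - x j) y) \<partial>\<mu>)"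
    by (subst Bochner_Integration.integral_sum)
       (auto intro!: integrable_mult_right exp_char_integrable Bochner_Integration.integrable_sum)
  also have "\<dots> = (\<integral>y. complex_of_real ((cmod (\<Sum>i\<in>I. w i * exp_char (x i) y))\<^sup>2) \<partial>\<mu>)"
    unfolding e ..
  also have "\<dots> = of_real (\<integral>y. (cmod (\<Sum>i\<in>I. w i * exp_char (x i) y))\<^sup>2 \<partial>\<mu>)"
    by (rule integral_complex_of_real)
  finally show ?thesis .
qed

lemma pos_def_fourier: "pos_def (fourier \<mu>)"
proof (rule pos_defI)
  show "fourier \<mu> (- x) = cnj (fourier \<mu> x)" for x by (rule fourier_minus)
  show "0 \<le> Re (\<Sum>i\<in>I. \<Sum>j\<in>I. w i * cnj (w j) * fourier \<mu> (x i - x j))"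
    if "finite I" for I :: "(real^2) option set" and w x
    unfolding norm_square_exp_sum[OF that] by simp
qed

lemma uniformly_continuous_fourier: "uniformly_continuous_on UNIV (fourier \<mu>)"
  unfolding uniformly_continuous_on_sequentially
proof (intro allI impI, elim conjE)
  fix x y :: "nat \<Rightarrow> real^2" assume lim: "(\<lambda>n. dist (x n) (y n)) \<longlonglongrightarrow> 0"
  define u where "u n z = exp_char (x n - y n) z - 1" for n z
  have h0: "(\<lambda>n. x n - y n) \<longlonglongrightarrow> 0" using lim by (simp add: dist_norm tendsto_norm_zero_iff)
  have u0: "(\<lambda>n. u n z) \<longlonglongrightarrow> 0" for z
  proof -
    have "continuous_on UNIV (\<lambda>\<xi>. exp_char \<xi> z)" unfolding exp_char_def by (intro continuous_intros)
    then have "isCont (\<lambda>\<xi>. exp_char \<xi> z) 0" by (simp add: continuous_on_eq_continuous_at)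
    then have "(\<lambda>n. exp_char (x n - y n) z) \<longlonglongrightarrow> exp_char 0 z" by (rule isCont_tendsto_compose[OF _ h0])
    then have "(\<lambda>n. exp_char (x n - y n) z - 1) \<longlonglongrightarrow> exp_char 0 z - 1" by (intro tendsto_diff tendsto_const)
    then show ?thesis by (simp add: u_def)
  qed
  have u_meas: "u n \<in> borel_measurable \<mu>" for n unfolding u_def by measurable
  have u_le: "cmod (u n z) \<le> 2" for n z
    using norm_triangle_ineq4[of "exp_char (x n - y n) z" 1] by (simp add: u_def)
  have "(\<lambda>n. \<integral>z. cmod (u n z) \<partial>\<mu>) \<longlonglongrightarrow> (\<integral>z. 0 \<partial>\<mu>)"
  proof (rule integral_dominated_convergence[where w = "\<lambda>_. 2"])
    show "AE z in \<mu>. (\<lambda>n. cmod (u n z)) \<longlonglongrightarrow> 0" using u0 by (simp add: tendsto_norm_zero)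
  qed (use u_meas u_le in auto)
  then have lim0: "(\<lambda>n. \<integral>z. cmod (u n z) \<partial>\<mu>) \<longlonglongrightarrow> 0" by simp
  have le: "dist (fourier \<mu> (x n)) (fourier \<mu> (y n)) \<le> (\<integral>z. cmod (u n z) \<partial>\<mu>)" for n
  proof -
    have "dist (fourier \<mu> (x n)) (fourier \<mu> (y n)) = cmod (\<integral>z. exp_char (x n) z - exp_char (y n) z \<partial>\<mu>)"
      unfolding dist_norm fourier_def
      by (subst Bochner_Integration.integral_diff) (auto intro: exp_char_integrable)
    also have "\<dots> \<le> (\<integral>z. cmod (exp_char (x n) z - exp_char (y n) z) \<partial>\<mu>)" by (rule integral_norm_bound)
    also have "\<dots> = (\<integral>z. cmod (u n z) \<partial>\<mu>)"
    proof (rule Bochner_Integration.integral_cong[OF refl])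
      fix z
      have "exp_char (x n) z - exp_char (y n) z = exp_char (y n) z * u n z"
        using exp_char_add[of "y n" "x n - y n" z] by (simp add: u_def right_diff_distrib)
      then show "cmod (exp_char (x n) z - exp_char (y n) z) = cmod (u n z)" by (simp add: norm_mult)
    qed
    finally show ?thesis .
  qed
  show "(\<lambda>n. dist (fourier \<mu> (x n)) (fourier \<mu> (y n))) \<longlonglongrightarrow> 0"
    by (rule tendsto_sandwich[OF _ _ tendsto_const lim0]) (use le in auto)
qed

text \<open>The invariance says that \<open>\<mu>\<close> is the image of the product of the uniform measure on \<open>D\<close> and \<open>\<mu>\<close> under
\<open>(d, x) \<mapsto> \<psi> d x\<close>; Fubini's theorem turns this into an identity of integrals.\<close>

lemma self_affine_integral:
  fixes f :: "real^2 \<Rightarrow> complex" and \<psi> :: "real^2 \<Rightarrow> real^2 \<Rightarrow> real^2"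
  assumes D: "finite D" "D \<noteq> {}" and \<psi>: "\<And>d. \<psi> d \<in> borel_measurable borel"
    and self: "\<And>A. A \<in> sets borel \<Longrightarrow>
      measure \<mu> A = 1 / real (card D) * (\<Sum>d\<in>D. measure (distr \<mu> borel (\<psi> d)) A)"
    and f: "f \<in> borel_measurable borel" "\<And>x. cmod (f x) \<le> B"
  shows "(\<integral>x. f x \<partial>\<mu>) = (\<Sum>d\<in>D. \<integral>x. f (\<psi> d x) \<partial>\<mu>) / of_nat (card D)"
proof -
  let ?U = "uniform_count_measure D"
  let ?N = "?U \<Otimes>\<^sub>M \<mu>"
  have em: "emeasure \<mu> A = ennreal (measure \<mu> A)" for A by (rule emeasure_eq_measure)
  interpret U: prob_space ?U by (rule prob_space_uniform_count_measure[OF D])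
  interpret pair_prob_space ?U \<mu> ..
  define g where "g = (\<lambda>(d, x). \<psi> d x)"
  have psi_mu: "\<psi> d \<in> measurable \<mu> borel" for d by (rule borel_measurable_mu[OF \<psi>])
  have sets_N: "sets ?N = sets (count_space D \<Otimes>\<^sub>M \<mu>)"
    by (intro sets_pair_measure_cong sets_uniform_count_measure_count_space refl)
  have g: "g \<in> measurable ?N borel"
    unfolding measurable_cong_sets[OF sets_N refl]
    by (rule measurable_pair_measure_countable1) (use D psi_mu in \<open>auto simp: g_def countable_finite\<close>)
  interpret N: prob_space "distr ?N borel g" by (rule prob_space_distr[OF g])
  have "\<mu> = distr ?N borel g"
  proof (rule measure_eqI)
    show "sets \<mu> = sets (distr ?N borel g)" by (simp add: sets_mu)
    fix A assume "A \<in> sets \<mu>"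
    then have A: "A \<in> sets borel" by (simp add: sets_mu)
    let ?h = "indicator A :: real^2 \<Rightarrow> real"
    have int: "integrable ?N (\<lambda>z. ?h (g z))"
      by (rule P.integrable_const_bound[of _ 1]) (use measurable_compose[OF g, of ?h borel] A in auto)
    have "measure (distr ?N borel g) A = (\<integral>z. ?h z \<partial>distr ?N borel g)" using A by simp
    also have "\<dots> = (\<integral>z. ?h (g z) \<partial>?N)" using A by (intro integral_distr[OF g]) auto
    also have "\<dots> = (\<integral>d. (\<integral>x. ?h (g (d, x)) \<partial>\<mu>) \<partial>?U)" by (rule integral_fst'[OF int, symmetric])
    also have "\<dots> = (\<Sum>d\<in>D. (\<integral>x. ?h (\<psi> d x) \<partial>\<mu>)) / card D"
      by (simp add: integral_uniform_count_measure[OF D(1)] g_def)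
    also have "\<dots> = (\<Sum>d\<in>D. measure (distr \<mu> borel (\<psi> d)) A) / card D"
    proof -
      have "(\<integral>x. ?h (\<psi> d x) \<partial>\<mu>) = measure (distr \<mu> borel (\<psi> d)) A" for d
      proof -
        have "(\<integral>x. ?h (\<psi> d x) \<partial>\<mu>) = (\<integral>x. ?h x \<partial>distr \<mu> borel (\<psi> d))"
          using A by (intro integral_distr[symmetric] psi_mu) auto
        then show ?thesis using A by simp
      qed
      then show ?thesis by simp
    qed
    also have "\<dots> = measure \<mu> A" using self[OF A] by simp
    finally show "emeasure \<mu> A = emeasure (distr ?N borel g) A"
      by (simp add: em N.emeasure_eq_measure)
  qed
  then have "(\<integral>x. f x \<partial>\<mu>) = (\<integral>z. f z \<partial>distr ?N borel g)" by simp
  also have "\<dots> = (\<integral>z. f (g z) \<partial>?N)" by (rule integral_distr[OF g f(1)])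
  also have "\<dots> = (\<integral>d. (\<integral>x. f (g (d, x)) \<partial>\<mu>) \<partial>?U)"
  proof (rule integral_fst'[symmetric])
    show "integrable ?N (\<lambda>z. f (g z))"
      by (rule P.integrable_const_bound[of _ B]) (use measurable_compose[OF g f(1)] f(2) in auto)
  qed
  also have "\<dots> = (\<Sum>d\<in>D. (1 / card D) *\<^sub>R (\<integral>x. f (g (d, x)) \<partial>\<mu>))"
    unfolding uniform_count_measure_def using D(1)
    by (intro lebesgue_integral_point_measure_finite) auto
  also have "\<dots> = (\<Sum>d\<in>D. \<integral>x. f (\<psi> d x) \<partial>\<mu>) / of_nat (card D)"
    by (simp add: g_def scaleR_conv_of_real sum_divide_distrib)
  finally show ?thesis .
qed

end

section \<open>Density of exponentials and the description of spectra\<close>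

text \<open>Trigonometric polynomials, generated inductively so that closure under sums and products does not need
a merging of index sets.\<close>

inductive_set trig :: "(real^2 \<Rightarrow> complex) set" where
  base: "(\<lambda>x. w * exp_char \<xi> x) \<in> trig"
| add: "f \<in> trig \<Longrightarrow> g \<in> trig \<Longrightarrow> (\<lambda>x. f x + g x) \<in> trig"

lemma trig_continuous: "f \<in> trig \<Longrightarrow> continuous_on UNIV f"
proof (induction rule: trig.induct)
  case (base w \<xi>)
  then show ?case unfolding exp_char_def by (intro continuous_intros)
qed (rule continuous_on_add)

lemma trig_mult_exp: "f \<in> trig \<Longrightarrow> (\<lambda>x. w * exp_char \<xi> x * f x) \<in> trig"
proof (induction rule: trig.induct)
  case (base v \<eta>)
  have "(\<lambda>x. w * exp_char \<xi> x * (v * exp_char \<eta> x)) = (\<lambda>x. (w * v) * exp_char (\<xi> + \<eta>) x)"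
    by (simp add: exp_char_add mult_ac)
  then show ?case using trig.base by simp
next
  case (add f g)
  then show ?case using trig.add[OF add.IH] by (simp add: distrib_left)
qed

lemma trig_mult: "f \<in> trig \<Longrightarrow> g \<in> trig \<Longrightarrow> (\<lambda>x. f x * g x) \<in> trig"
proof (induction rule: trig.induct)
  case (base w \<xi>)
  then show ?case by (rule trig_mult_exp)
next
  case (add f1 f2)
  then show ?case using trig.add[of "\<lambda>x. f1 x * g x" "\<lambda>x. f2 x * g x"] by (simp add: distrib_right)
qed

lemma trig_const: "(\<lambda>x. w) \<in> trig"
  using trig.base[of w 0] by simp

lemma trig_Re: "(\<lambda>x. of_real (Re (exp_char \<xi> x))) \<in> trig"
proof -
  have "of_real (Re (exp_char \<xi> x)) = (1 / 2) * exp_char \<xi> x + (1 / 2) * exp_char (- \<xi>) x" for x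
    by (simp add: exp_char_minus complex_eq_iff)
  then show ?thesis using trig.add[OF trig.base[of "1/2" \<xi>] trig.base[of "1/2" "- \<xi>"]] by simp
qed

lemma trig_Im: "(\<lambda>x. of_real (Im (exp_char \<xi> x))) \<in> trig"
proof -
  have "of_real (Im (exp_char \<xi> x)) = (- \<i> / 2) * exp_char \<xi> x + (\<i> / 2) * exp_char (- \<xi>) x" for x
    by (simp add: exp_char_minus complex_eq_iff)
  then show ?thesis using trig.add[OF trig.base[of "- \<i> / 2" \<xi>] trig.base[of "\<i> / 2" "- \<xi>"]] by simp
qed

text \<open>Choose the frequency along \<open>x - y\<close> so that the character takes opposite values at the two points.\<close>

lemma trig_separates:
  assumes "x \<noteq> y"
  shows "\<exists>f. (\<lambda>z. complex_of_real (f z)) \<in> trig \<and> f x \<noteq> f y"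
proof -
  define \<xi> where "\<xi> = (1 / (2 * (norm (x - y))\<^sup>2)) *\<^sub>R (x - y)"
  have half: "\<xi> \<bullet> (x - y) = 1 / 2"
    using assms by (simp add: \<xi>_def dot_square_norm)
  have "exp_char \<xi> (x - y) = cis (- pi)" unfolding exp_char_cis half by simp
  then have "exp_char \<xi> (x - y) = - 1" by (simp add: complex_eq_iff)
  then have "exp_char \<xi> x = - exp_char \<xi> y"
    using exp_char_add_right[of \<xi> "x - y" y] by simp
  moreover have "exp_char \<xi> y \<noteq> 0" using norm_exp_char[of \<xi> y] by force
  ultimately have "exp_char \<xi> x \<noteq> exp_char \<xi> y" by (auto simp: complex_eq_iff)
  then have "Re (exp_char \<xi> x) \<noteq> Re (exp_char \<xi> y) \<or> Im (exp_char \<xi> x) \<noteq> Im (exp_char \<xi> y)"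
    by (simp add: complex_eq_iff)
  then show ?thesis
  proof
    assume "Re (exp_char \<xi> x) \<noteq> Re (exp_char \<xi> y)"
    then show ?thesis using trig_Re[of \<xi>] by (intro exI[of _ "\<lambda>z. Re (exp_char \<xi> z)"]) simp
  next
    assume "Im (exp_char \<xi> x) \<noteq> Im (exp_char \<xi> y)"
    then show ?thesis using trig_Im[of \<xi>] by (intro exI[of _ "\<lambda>z. Im (exp_char \<xi> z)"]) simp
  qed
qed

lemma trig_dense_compact:
  fixes f :: "real^2 \<Rightarrow> real"
  assumes K: "compact K" and f: "continuous_on K f" and e: "e > 0"
  obtains g where "g \<in> trig" "\<And>x. x \<in> K \<Longrightarrow> cmod (of_real (f x) - g x) < e"
proof -
  define R where "R = {h. (\<lambda>x. complex_of_real (h x)) \<in> trig}"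
  interpret function_ring_on R K
  proof
    show "compact K" by (rule K)
    show "continuous_on K h" if "h \<in> R" for h
    proof -
      have "continuous_on UNIV (\<lambda>x. complex_of_real (h x))"
        using trig_continuous that unfolding R_def by blast
      from continuous_on_Re[OF this] have "continuous_on UNIV h" by simp
      then show ?thesis by (auto intro: continuous_on_subset)
    qed
    show "(\<lambda>x. h x + h' x) \<in> R" if "h \<in> R" "h' \<in> R" for h h'
      using trig.add that unfolding R_def by fastforce
    show "(\<lambda>x. h x * h' x) \<in> R" if "h \<in> R" "h' \<in> R" for h h'
      using trig_mult that unfolding R_def by fastforce
    show "(\<lambda>_. r) \<in> R" for r by (simp add: R_def trig_const)
    show "\<exists>h\<in>R. h x \<noteq> h y" if "x \<noteq> y" for x y using trig_separates[OF that] by (auto simp: R_def)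
  qed
  obtain g where g: "g \<in> R" "\<forall>x\<in>K. \<bar>f x - g x\<bar> < e" using Stone_Weierstrass_basic[OF f e] by blast
  have "cmod (of_real (f x) - of_real (g x)) < e" if "x \<in> K" for x
    using g(2) that by (simp flip: of_real_diff)
  with g(1) that show thesis unfolding R_def by blast
qed

context plane_probability
begin

lemma L2_char: "f \<in> L2 \<mu> \<longleftrightarrow> f \<in> borel_measurable \<mu> \<and> integrable \<mu> (\<lambda>x. (cmod (f x))\<^sup>2)"
  by (simp add: L2_def)

lemma L2_bounded:
  assumes "f \<in> borel_measurable \<mu>" "\<And>x. cmod (f x) \<le> B"
  shows "f \<in> L2 \<mu>"
proof -
  have "integrable \<mu> (\<lambda>x. (cmod (f x))\<^sup>2)"
  proof (rule bounded_integrable)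
    show "norm ((cmod (f x))\<^sup>2) \<le> B\<^sup>2" for x using assms(2)[of x] by (simp add: power_mono)
  qed (use assms in measurable)
  then show ?thesis using assms by (simp add: L2_char)
qed

lemma norm_add_square_le: "(cmod (z + z'))\<^sup>2 \<le> 2 * (cmod z)\<^sup>2 + 2 * (cmod z')\<^sup>2"
proof -
  have "(cmod (z + z'))\<^sup>2 \<le> (cmod z + cmod z')\<^sup>2" by (intro power_mono norm_triangle_ineq) simp
  also have "\<dots> \<le> 2 * (cmod z)\<^sup>2 + 2 * (cmod z')\<^sup>2"
    using sum_squares_bound[of "cmod z" "cmod z'"] by (simp add: power2_sum)
  finally show ?thesis .
qed

lemma L2_add:
  assumes "f \<in> L2 \<mu>" "g \<in> L2 \<mu>"
  shows "(\<lambda>x. f x + g x) \<in> L2 \<mu>"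
proof -
  have [measurable]: "f \<in> borel_measurable \<mu>" "g \<in> borel_measurable \<mu>" using assms by (auto simp: L2_char)
  have "integrable \<mu> (\<lambda>x. 2 * (cmod (f x))\<^sup>2 + 2 * (cmod (g x))\<^sup>2)" using assms by (auto simp: L2_char)
  then have "integrable \<mu> (\<lambda>x. (cmod (f x + g x))\<^sup>2)"
    by (rule Bochner_Integration.integrable_bound) (auto intro!: order_trans[OF norm_add_square_le])
  then show ?thesis by (simp add: L2_char)
qed

lemma L2_scale: "f \<in> L2 \<mu> \<Longrightarrow> (\<lambda>x. w * f x) \<in> L2 \<mu>"
  by (auto simp: L2_char norm_mult power_mult_distrib)

lemma L2_diff: "f \<in> L2 \<mu> \<Longrightarrow> g \<in> L2 \<mu> \<Longrightarrow> (\<lambda>x. f x - g x) \<in> L2 \<mu>"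
  using L2_add[of f "\<lambda>x. (- 1) * g x"] L2_scale[of g "- 1"] by simp

lemma L2_exp_char: "exp_char \<xi> \<in> L2 \<mu>"
  by (rule L2_bounded[of _ 1]) (auto simp: exp_char_measurable)

lemma L2_exp_sum: "(\<lambda>x. \<Sum>l\<in>F. w l * exp_char l x) \<in> L2 \<mu>"
proof (rule L2_bounded)
  show "cmod (\<Sum>l\<in>F. w l * exp_char l x) \<le> (\<Sum>l\<in>F. cmod (w l))" for x
    by (rule order_trans[OF norm_sum]) (simp add: norm_mult)
qed measurable

text \<open>Members are functions, not classes; the squared norm is used because it avoids square roots in the
estimates.\<close>

definition closed_span :: "(real^2) set \<Rightarrow> (real^2 \<Rightarrow> complex) set" where
  "closed_span \<Lambda> = {f \<in> L2 \<mu>. \<forall>e>0. \<exists>F w. finite F \<and> F \<subseteq> \<Lambda> \<and>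
     (\<integral>x. (cmod (f x - (\<Sum>l\<in>F. w l * exp_char l x)))\<^sup>2 \<partial>\<mu>) < e}"

lemma closed_spanE:
  assumes "f \<in> closed_span \<Lambda>" "e > 0"
  obtains F w where "finite F" "F \<subseteq> \<Lambda>" "(\<integral>x. (cmod (f x - (\<Sum>l\<in>F. w l * exp_char l x)))\<^sup>2 \<partial>\<mu>) < e"
  using assms unfolding closed_span_def by blast

lemma closed_span_L2: "f \<in> closed_span \<Lambda> \<Longrightarrow> f \<in> L2 \<mu>"
  by (simp add: closed_span_def)

lemma square_integral_add_le:
  assumes "f \<in> L2 \<mu>" "g \<in> L2 \<mu>"
  shows "(\<integral>x. (cmod (f x + g x))\<^sup>2 \<partial>\<mu>) \<le> 2 * (\<integral>x. (cmod (f x))\<^sup>2 \<partial>\<mu>) + 2 * (\<integral>x. (cmod (g x))\<^sup>2 \<partial>\<mu>)"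
proof -
  have i: "integrable \<mu> (\<lambda>x. (cmod (f x))\<^sup>2)" "integrable \<mu> (\<lambda>x. (cmod (g x))\<^sup>2)"
    "integrable \<mu> (\<lambda>x. (cmod (f x + g x))\<^sup>2)"
    using assms L2_add[OF assms] by (auto simp: L2_char)
  have "(\<integral>x. (cmod (f x + g x))\<^sup>2 \<partial>\<mu>) \<le> (\<integral>x. 2 * (cmod (f x))\<^sup>2 + 2 * (cmod (g x))\<^sup>2 \<partial>\<mu>)"
    using i by (intro integral_mono norm_add_square_le) auto
  also have "\<dots> = 2 * (\<integral>x. (cmod (f x))\<^sup>2 \<partial>\<mu>) + 2 * (\<integral>x. (cmod (g x))\<^sup>2 \<partial>\<mu>)"
    using i by simp
  finally show ?thesis .
qed

lemma closed_span_add: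
  assumes f: "f \<in> closed_span \<Lambda>" and g: "g \<in> closed_span \<Lambda>"
  shows "(\<lambda>x. f x + g x) \<in> closed_span \<Lambda>"
  unfolding closed_span_def
proof (intro CollectI conjI allI impI)
  show "(\<lambda>x. f x + g x) \<in> L2 \<mu>" using f g by (intro L2_add closed_span_L2)
  fix e :: real assume "e > 0"
  then have e: "e / 4 > 0" by simp
  obtain F w where F: "finite F" "F \<subseteq> \<Lambda>" "(\<integral>x. (cmod (f x - (\<Sum>l\<in>F. w l * exp_char l x)))\<^sup>2 \<partial>\<mu>) < e / 4"
    by (rule closed_spanE[OF f e])
  obtain G v where G: "finite G" "G \<subseteq> \<Lambda>" "(\<integral>x. (cmod (g x - (\<Sum>l\<in>G. v l * exp_char l x)))\<^sup>2 \<partial>\<mu>) < e / 4"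
    by (rule closed_spanE[OF g e])
  define u where "u l = (if l \<in> F then w l else 0) + (if l \<in> G then v l else 0)" for l
  have ext: "(\<Sum>l\<in>H. h l) = (\<Sum>l\<in>F \<union> G. if l \<in> H then h l else 0)" if "H \<subseteq> F \<union> G" for H and h :: "real^2 \<Rightarrow> complex"
    using F(1) G(1) that by (subst sum.inter_restrict[symmetric]) (auto intro!: sum.cong)
  have sum: "(\<Sum>l\<in>F \<union> G. u l * exp_char l x) = (\<Sum>l\<in>F. w l * exp_char l x) + (\<Sum>l\<in>G. v l * exp_char l x)" for x
    by (subst ext[of F], simp, subst ext[of G], simp)
       (simp add: u_def sum.distrib[symmetric] distrib_right, intro sum.cong refl, simp)
  let ?f = "\<lambda>x. f x - (\<Sum>l\<in>F. w l * exp_char l x)" and ?g = "\<lambda>x. g x - (\<Sum>l\<in>G. v l * exp_char l x)"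
  have "(\<integral>x. (cmod (f x + g x - (\<Sum>l\<in>F \<union> G. u l * exp_char l x)))\<^sup>2 \<partial>\<mu>) = (\<integral>x. (cmod (?f x + ?g x))\<^sup>2 \<partial>\<mu>)"
    unfolding sum by (simp add: algebra_simps)
  also have "\<dots> \<le> 2 * (\<integral>x. (cmod (?f x))\<^sup>2 \<partial>\<mu>) + 2 * (\<integral>x. (cmod (?g x))\<^sup>2 \<partial>\<mu>)"
    by (intro square_integral_add_le L2_diff L2_exp_sum closed_span_L2[OF f] closed_span_L2[OF g])
  also have "\<dots> < e" using F G by simp
  finally show "\<exists>F w. finite F \<and> F \<subseteq> \<Lambda> \<and> (\<integral>x. (cmod (f x + g x - (\<Sum>l\<in>F. w l * exp_char l x)))\<^sup>2 \<partial>\<mu>) < e"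
    using F G by (intro exI[of _ "F \<union> G"] exI[of _ u]) auto
qed

lemma closed_span_scale:
  assumes f: "f \<in> closed_span \<Lambda>"
  shows "(\<lambda>x. v * f x) \<in> closed_span \<Lambda>"
  unfolding closed_span_def
proof (intro CollectI conjI allI impI)
  show "(\<lambda>x. v * f x) \<in> L2 \<mu>" by (intro L2_scale closed_span_L2[OF f])
  fix e :: real assume e: "e > 0"
  define B where "B = (cmod v)\<^sup>2 + 1"
  have B: "B > 0" "(cmod v)\<^sup>2 \<le> B" by (auto simp: B_def add_nonneg_pos)
  have "e / B > 0" using e B by simp
  then obtain F w where F: "finite F" "F \<subseteq> \<Lambda>" "(\<integral>x. (cmod (f x - (\<Sum>l\<in>F. w l * exp_char l x)))\<^sup>2 \<partial>\<mu>) < e / B"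
    by (rule closed_spanE[OF f])
  let ?I = "\<integral>x. (cmod (f x - (\<Sum>l\<in>F. w l * exp_char l x)))\<^sup>2 \<partial>\<mu>"
  have "v * f x - (\<Sum>l\<in>F. v * w l * exp_char l x) = v * (f x - (\<Sum>l\<in>F. w l * exp_char l x))" for x
    by (simp add: right_diff_distrib sum_distrib_left mult.assoc)
  then have "(\<integral>x. (cmod (v * f x - (\<Sum>l\<in>F. v * w l * exp_char l x)))\<^sup>2 \<partial>\<mu>) = (cmod v)\<^sup>2 * ?I"
    by (simp add: norm_mult power_mult_distrib)
  also have "\<dots> \<le> B * ?I" using B by (intro mult_right_mono) auto
  also have "\<dots> < e" using F(3) B by (simp add: less_divide_eq mult.commute)
  finally show "\<exists>F w. finite F \<and> F \<subseteq> \<Lambda> \<and> (\<integral>x. (cmod (v * f x - (\<Sum>l\<in>F. w l * exp_char l x)))\<^sup>2 \<partial>\<mu>) < e"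
    using F by (intro exI[of _ F] exI[of _ "\<lambda>l. v * w l"]) auto
qed

lemma closed_span_closed:
  assumes f: "f \<in> L2 \<mu>"
    and approx: "\<And>e. e > 0 \<Longrightarrow> \<exists>g\<in>closed_span \<Lambda>. (\<integral>x. (cmod (f x - g x))\<^sup>2 \<partial>\<mu>) < e"
  shows "f \<in> closed_span \<Lambda>"
  unfolding closed_span_def
proof (intro CollectI conjI allI impI)
  show "f \<in> L2 \<mu>" by (rule f)
  fix e :: real assume "e > 0"
  then have e: "e / 4 > 0" by simp
  obtain g where g: "g \<in> closed_span \<Lambda>" "(\<integral>x. (cmod (f x - g x))\<^sup>2 \<partial>\<mu>) < e / 4" using approx[OF e] by blast
  obtain F w where F: "finite F" "F \<subseteq> \<Lambda>" "(\<integral>x. (cmod (g x - (\<Sum>l\<in>F. w l * exp_char l x)))\<^sup>2 \<partial>\<mu>) < e / 4"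
    by (rule closed_spanE[OF g(1) e])
  let ?g = "\<lambda>x. g x - (\<Sum>l\<in>F. w l * exp_char l x)"
  have "(\<integral>x. (cmod (f x - (\<Sum>l\<in>F. w l * exp_char l x)))\<^sup>2 \<partial>\<mu>) = (\<integral>x. (cmod ((f x - g x) + ?g x))\<^sup>2 \<partial>\<mu>)"
    by simp
  also have "\<dots> \<le> 2 * (\<integral>x. (cmod (f x - g x))\<^sup>2 \<partial>\<mu>) + 2 * (\<integral>x. (cmod (?g x))\<^sup>2 \<partial>\<mu>)"
    by (intro square_integral_add_le L2_diff L2_exp_sum closed_span_L2[OF g(1)] f)
  also have "\<dots> < e" using F g by simp
  finally show "\<exists>F w. finite F \<and> F \<subseteq> \<Lambda> \<and> (\<integral>x. (cmod (f x - (\<Sum>l\<in>F. w l * exp_char l x)))\<^sup>2 \<partial>\<mu>) < e"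
    using F by blast
qed

text \<open>Dominated convergence in the square mean.\<close>

lemma closed_span_limit:
  assumes f: "f \<in> borel_measurable \<mu>" and s: "\<And>n. s n \<in> closed_span \<Lambda>"
    and lim: "\<And>x. (\<lambda>n. s n x) \<longlonglongrightarrow> f x" and dom: "\<And>n x. cmod (f x - s n x) \<le> w x"
    and w: "w \<in> borel_measurable \<mu>" "integrable \<mu> (\<lambda>x. (w x)\<^sup>2)" and f2: "f \<in> L2 \<mu>"
  shows "f \<in> closed_span \<Lambda>"
proof (rule closed_span_closed[OF f2])
  fix e :: real assume e: "e > 0"
  have sm: "s n \<in> borel_measurable \<mu>" for n using closed_span_L2[OF s] by (simp add: L2_char)
  have "(\<lambda>n. \<integral>x. (cmod (f x - s n x))\<^sup>2 \<partial>\<mu>) \<longlonglongrightarrow> (\<integral>x. 0 \<partial>\<mu>)"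
  proof (rule integral_dominated_convergence[where w = "\<lambda>x. (w x)\<^sup>2"])
    show "(\<lambda>x. (cmod (f x - s n x))\<^sup>2) \<in> borel_measurable \<mu>" for n using f sm by measurable
    have "(\<lambda>n. (cmod (f x - s n x))\<^sup>2) \<longlonglongrightarrow> (cmod (f x - f x))\<^sup>2" for x
      by (intro tendsto_intros lim)
    then show "AE x in \<mu>. (\<lambda>n. (cmod (f x - s n x))\<^sup>2) \<longlonglongrightarrow> 0" by simp
    have "(cmod (f x - s n x))\<^sup>2 \<le> (w x)\<^sup>2" for n x by (rule power_mono[OF dom]) simp
    then show "AE x in \<mu>. norm ((cmod (f x - s n x))\<^sup>2) \<le> (w x)\<^sup>2" for n by simp
  qed (use w in auto)
  then have "eventually (\<lambda>n. (\<integral>x. (cmod (f x - s n x))\<^sup>2 \<partial>\<mu>) < e) sequentially"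
    using e by (intro order_tendstoD(2)) auto
  then show "\<exists>g\<in>closed_span \<Lambda>. (\<integral>x. (cmod (f x - g x))\<^sup>2 \<partial>\<mu>) < e"
    using s by (auto simp: eventually_sequentially)
qed

text \<open>The closed span contains the trigonometric polynomials, by the Stone-Weierstrass theorem on \<open>K\<close> the
bounded continuous functions, by approximation the indicators of closed sets, by a Dynkin argument the
indicators of all Borel sets, and finally all square integrable functions.\<close>

lemma closed_span_eq_L2:
  assumes supp: "compact K" "emeasure \<mu> (- K) = 0" and exps: "\<And>\<xi>. exp_char \<xi> \<in> closed_span \<Lambda>"
  shows "closed_span \<Lambda> = L2 \<mu>"
proof
  show "closed_span \<Lambda> \<subseteq> L2 \<mu>" using closed_span_L2 by blast
  have trig: "f \<in> closed_span \<Lambda>" if "f \<in> trig" for f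
    using that by induction (auto intro: closed_span_add closed_span_scale exps)
  have AE_K: "AE x in \<mu>. x \<in> K"
  proof (rule AE_I)
    show "{x \<in> space \<mu>. x \<notin> K} \<subseteq> - K" by auto
    show "- K \<in> sets \<mu>" using supp(1) by (simp add: sets_mu compact_imp_closed borel_open)
  qed (rule supp(2))
  have cont: "(\<lambda>x. complex_of_real (f x)) \<in> closed_span \<Lambda>"
    if f: "continuous_on UNIV f" "\<And>x. \<bar>f x\<bar> \<le> 1" for f :: "real^2 \<Rightarrow> real"
  proof (rule closed_span_closed)
    have fm: "(\<lambda>x. complex_of_real (f x)) \<in> borel_measurable \<mu>"
      by (rule continuous_measurable) (intro continuous_on_of_real f(1))
    show "(\<lambda>x. complex_of_real (f x)) \<in> L2 \<mu>" by (rule L2_bounded[OF fm, of 1]) (simp add: f(2))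
    fix e :: real assume e: "e > 0"
    define d where "d = sqrt (e / 2)"
    have d: "d > 0" "d\<^sup>2 < e" using e by (auto simp: d_def)
    obtain g where g: "g \<in> trig" "\<And>x. x \<in> K \<Longrightarrow> cmod (of_real (f x) - g x) < d"
      using trig_dense_compact[OF supp(1) continuous_on_subset[OF f(1)] d(1)] by auto
    have gm: "g \<in> borel_measurable \<mu>" by (rule continuous_measurable[OF trig_continuous[OF g(1)]])
    have bd: "AE x in \<mu>. (cmod (of_real (f x) - g x))\<^sup>2 \<le> d\<^sup>2"
      using AE_K by eventually_elim (use g(2) in \<open>auto intro!: power_mono simp: less_imp_le\<close>)
    have "(\<integral>x. (cmod (of_real (f x) - g x))\<^sup>2 \<partial>\<mu>) \<le> (\<integral>x. d\<^sup>2 \<partial>\<mu>)"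
    proof (rule integral_mono_AE)
      show "integrable \<mu> (\<lambda>x. (cmod (of_real (f x) - g x))\<^sup>2)"
        by (rule integrable_const_bound[of _ "d\<^sup>2"]) (use bd fm gm in auto)
    qed (use bd in auto)
    also have "\<dots> < e" using d by simp
    finally show "\<exists>g\<in>closed_span \<Lambda>. (\<integral>x. (cmod (of_real (f x) - g x))\<^sup>2 \<partial>\<mu>) < e"
      using trig[OF g(1)] by blast
  qed
  have ind_L2: "(\<lambda>x. indicator A x :: complex) \<in> L2 \<mu>" if "A \<in> sets borel" for A
  proof (rule L2_bounded[of _ 1])
    show "(\<lambda>x. indicator A x :: complex) \<in> borel_measurable \<mu>"
      by (rule borel_measurable_indicator) (simp add: sets_mu that)
  qed (simp add: indicator_def)
  have closed: "(\<lambda>x. indicator C x :: complex) \<in> closed_span \<Lambda>" if C: "closed C" for C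
  proof (cases "C = {}")
    case True
    then show ?thesis using closed_span_scale[OF exps, of 0 0] by simp
  next
    case False
    define s where "s n x = max 0 (1 - real n * infdist x C)" for n x
    have s01: "0 \<le> s n x" "s n x \<le> 1" for n x by (auto simp: s_def infdist_nonneg)
    show ?thesis
    proof (rule closed_span_limit[where s = "\<lambda>n x. complex_of_real (s n x)" and w = "\<lambda>_. 1"])
      show "(\<lambda>x. indicator C x :: complex) \<in> borel_measurable \<mu>"
        by (rule borel_measurable_indicator) (simp add: sets_mu C)
      show "(\<lambda>x. indicator C x :: complex) \<in> L2 \<mu>" using C by (intro ind_L2) simp
      show "(\<lambda>x. complex_of_real (s n x)) \<in> closed_span \<Lambda>" for n
      proof (rule cont)
        show "continuous_on UNIV (s n)" unfolding s_def by (intro continuous_intros)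
        show "\<bar>s n x\<bar> \<le> 1" for x using s01[of n x] by simp
      qed
      show "(\<lambda>n. complex_of_real (s n x)) \<longlonglongrightarrow> indicator C x" for x
      proof (cases "x \<in> C")
        case True then show ?thesis by (simp add: s_def)
      next
        case False
        then have pos: "infdist x C > 0"
          using C \<open>C \<noteq> {}\<close> by (metis infdist_pos_not_in_closed)
        obtain N where N: "1 < real N * infdist x C" using reals_Archimedean3[OF pos] by blast
        have "s n x = 0" if "n \<ge> N" for n
        proof -
          have "real N * infdist x C \<le> real n * infdist x C" using that pos by (intro mult_right_mono) auto
          then show ?thesis using N by (simp add: s_def)
        qed
        then have "eventually (\<lambda>n. complex_of_real (s n x) = 0) sequentially"
          by (auto simp: eventually_sequentially)
        then show ?thesis using False by (simp add: tendsto_eventually)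
      qed
      show "cmod (indicator C x - complex_of_real (s n x)) \<le> 1" for n x
      proof -
        have "indicator C x - complex_of_real (s n x) = complex_of_real (indicator C x - s n x)"
          by (simp add: indicator_def)
        then show ?thesis using s01[of n x] by (simp only: norm_of_real) (auto simp: indicator_def)
      qed
    qed auto
  qed
  have ind: "(\<lambda>x. indicator A x :: complex) \<in> closed_span \<Lambda>" if "A \<in> sets borel" for A
  proof -
    have "Int_stable (Collect (closed :: (real^2) set \<Rightarrow> bool))" by (auto simp: Int_stable_def)
    moreover have "Collect closed \<subseteq> Pow (UNIV :: (real^2) set)" by simp
    moreover have "A \<in> sigma_sets UNIV (Collect closed)"
      using that unfolding borel_eq_closed by (simp add: sets_measure_of)
    ultimately show ?thesis
    proof (induction rule: sigma_sets_induct_disjoint)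
      case (basic A) then show ?case by (simp add: closed)
    next
      case empty then show ?case using closed[of "{}"] by simp
    next
      case (compl A)
      have "(\<lambda>x. indicator (UNIV - A) x :: complex) = (\<lambda>x. indicator UNIV x + (- 1) * indicator A x)"
        by (auto simp: indicator_def)
      then show ?case using closed_span_add[OF closed[of UNIV] closed_span_scale[OF compl(2), of "- 1"]] by simp
    next
      case (union A)
      have sets_A: "A i \<in> sets borel" for i
        using union(2) unfolding borel_eq_closed by (auto simp: sets_measure_of)
      have fin: "(\<lambda>x. \<Sum>i<n. indicator (A i) x :: complex) \<in> closed_span \<Lambda>" for n
      proof (induction n)
        case 0 then show ?case using closed[of "{}"] by simp
      next
        case (Suc n) then show ?case using closed_span_add[OF Suc union(3)[of n]] by simp
      qed
      have part: "(\<Sum>i<n. indicator (A i) x :: complex) = indicator (\<Union>i<n. A i) x" for n x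
        by (rule indicator_UN_disjoint[symmetric]) (use union(1) in \<open>auto simp: disjoint_family_on_def\<close>)
      have UA: "(\<Union>i. A i) \<in> sets borel" using sets_A by auto
      show ?case
      proof (rule closed_span_limit[where s = "\<lambda>n x. \<Sum>i<n. indicator (A i) x" and w = "\<lambda>_. 1"])
        show "(\<lambda>x. indicator (\<Union>i. A i) x :: complex) \<in> borel_measurable \<mu>"
          by (rule borel_measurable_indicator) (simp add: sets_mu UA)
        show "(\<lambda>x. indicator (\<Union>i. A i) x :: complex) \<in> L2 \<mu>" by (rule ind_L2[OF UA])
        show "(\<lambda>n. \<Sum>i<n. indicator (A i) x :: complex) \<longlonglongrightarrow> indicator (\<Union>i. A i) x" for x
          unfolding part by (rule LIMSEQ_indicator_UN)
        show "cmod (indicator (\<Union>i. A i) x - (\<Sum>i<n. indicator (A i) x)) \<le> 1" for n x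
          unfolding part by (auto simp: indicator_def)
      qed (use fin in auto)
    qed
  qed
  show "L2 \<mu> \<subseteq> closed_span \<Lambda>"
  proof
    fix f assume f2: "f \<in> L2 \<mu>"
    then have f: "f \<in> borel_measurable \<mu>" "integrable \<mu> (\<lambda>x. (cmod (f x))\<^sup>2)" by (auto simp: L2_char)
    obtain s where s: "\<And>i. simple_function \<mu> (s i)" "\<And>x. (\<lambda>i. s i x) \<longlonglongrightarrow> f x"
      "\<And>i x. dist (s i x) 0 \<le> 2 * dist (f x) 0"
      using borel_measurable_implies_sequence_metric[OF f(1), of 0] by auto
    show "f \<in> closed_span \<Lambda>"
    proof (rule closed_span_limit[OF f(1) _ s(2) _ _ _ f2, where w = "\<lambda>x. 3 * cmod (f x)"])
      show "s i \<in> closed_span \<Lambda>" for i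
      proof -
        have fin: "finite (range (s i))" using simple_functionD(1)[OF s(1)[of i]] by simp
        have "(\<lambda>x. \<Sum>y\<in>Y. y * indicator (s i -` {y}) x) \<in> closed_span \<Lambda>" if "finite Y" for Y
          using that
        proof (induction Y rule: finite_induct)
          case empty then show ?case using closed[of "{}"] by simp
        next
          case (insert y Y)
          have "s i -` {y} \<in> sets borel" using simple_functionD(2)[OF s(1)[of i], of "{y}"] by (simp add: sets_mu)
          then have "(\<lambda>x. y * indicator (s i -` {y}) x) \<in> closed_span \<Lambda>" by (intro closed_span_scale ind)
          from closed_span_add[OF this insert.IH] show ?case unfolding sum.insert[OF insert(1,2)] .
        qed
        from this[OF fin] have "(\<lambda>x. \<Sum>y\<in>range (s i). y * indicator (s i -` {y}) x) \<in> closed_span \<Lambda>" .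
        moreover have "(\<Sum>y\<in>range (s i). y * indicator (s i -` {y}) x) = s i x" for x
        proof -
          have "(\<Sum>y\<in>range (s i). y * indicator (s i -` {y}) x) = (\<Sum>y\<in>range (s i). if y = s i x then y else 0)"
            by (intro sum.cong refl) (auto simp: indicator_def)
          then show ?thesis using fin by simp
        qed
        ultimately show ?thesis by simp
      qed
      show "cmod (f x - s i x) \<le> 3 * cmod (f x)" for i x
        using norm_triangle_ineq4[of "f x" "s i x"] s(3)[of i x] by simp
      show "integrable \<mu> (\<lambda>x. (3 * cmod (f x))\<^sup>2)" using f(2) by (simp add: power_mult_distrib)
      show "(\<lambda>x. 3 * cmod (f x)) \<in> borel_measurable \<mu>" using f(1) by measurable
    qed
  qed
qed

lemma L2_inner_exp: "L2_inner \<mu> (exp_char \<xi>) (exp_char \<eta>) = fourier \<mu> (\<xi> - \<eta>)"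
  by (simp add: L2_inner_def fourier_def exp_char_diff)

lemma projection_error:
  assumes F: "finite F" and orth: "orthogonal_for (fourier \<mu>) F"
  shows "(\<integral>x. (cmod (exp_char \<xi> x - (\<Sum>l\<in>F. v l * exp_char l x)))\<^sup>2 \<partial>\<mu>)
    = 1 - (\<Sum>l\<in>F. (cmod (fourier \<mu> (\<xi> - l)))\<^sup>2) + (\<Sum>l\<in>F. (cmod (v l - fourier \<mu> (\<xi> - l)))\<^sup>2)"
proof -
  let ?I = "insert None (Some ` F)"
  let ?x = "case_option \<xi> (\<lambda>l. l)" and ?w = "case_option 1 (\<lambda>l. - v l)"
  have I: "finite ?I" using F by simp
  have orth': "fourier \<mu> (x - y) = 0" if "x \<in> F" "y \<in> F" "x \<noteq> y" for x y
    using orth that by (simp add: orthogonal_for_def)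
  have e: "(\<Sum>i\<in>?I. ?w i * exp_char (?x i) y) = exp_char \<xi> y - (\<Sum>l\<in>F. v l * exp_char l y)" for y
    using F by (simp add: sum.reindex sum_negf)
  have "complex_of_real (\<integral>y. (cmod (\<Sum>i\<in>?I. ?w i * exp_char (?x i) y))\<^sup>2 \<partial>\<mu>)
    = of_real (1 - (\<Sum>l\<in>F. (cmod (fourier \<mu> (\<xi> - l)))\<^sup>2) + (\<Sum>l\<in>F. (cmod (v l - fourier \<mu> (\<xi> - l)))\<^sup>2))"
    unfolding norm_square_exp_sum[OF I, symmetric]
    by (rule quadratic_form_orthonormal[OF fourier_minus fourier_zero F orth'])
  then show ?thesis unfolding e of_real_eq_iff .
qed

text \<open>Orthonormality is a statement about the Fourier transform at differences. By Pythagoras, completeness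
of the sum at \<open>\<xi>\<close> means that the character at \<open>\<xi>\<close> lies in the closed span of the characters at \<open>\<Lambda>\<close>; if
this holds for all \<open>\<xi>\<close>, the closed span is everything.\<close>

theorem spectrum_iff:
  assumes supp: "compactly_supported \<mu>"
  shows "is_spectrum \<mu> \<Lambda> \<longleftrightarrow>
    countable \<Lambda> \<and> orthogonal_for (fourier \<mu>) \<Lambda> \<and> complete_for (fourier \<mu>) \<Lambda>"
proof
  assume spec: "is_spectrum \<mu> \<Lambda>"
  have onb: "L2_orthonormal_basis \<mu> \<Lambda> exp_char" using spec by (simp add: is_spectrum_def)
  have orth: "orthogonal_for (fourier \<mu>) \<Lambda>"
    using onb unfolding L2_orthonormal_basis_def orthogonal_for_def L2_inner_exp by simp
  moreover have "complete_for (fourier \<mu>) \<Lambda>"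
    unfolding complete_for_def
  proof (intro allI impI)
    fix \<xi> :: "real^2" and \<epsilon> :: real assume e: "\<epsilon> > 0"
    have "\<forall>\<epsilon>>0. \<exists>F v. finite F \<and> F \<subseteq> \<Lambda> \<and> L2_norm \<mu> (\<lambda>x. exp_char \<xi> x - (\<Sum>l\<in>F. v l * exp_char l x)) < \<epsilon>"
      using onb L2_exp_char unfolding L2_orthonormal_basis_def by blast
    moreover have "sqrt \<epsilon> > 0" using e by simp
    ultimately obtain F v where F: "finite F" "F \<subseteq> \<Lambda>"
      "L2_norm \<mu> (\<lambda>x. exp_char \<xi> x - (\<Sum>l\<in>F. v l * exp_char l x)) < sqrt \<epsilon>" by blast
    have "orthogonal_for (fourier \<mu>) F" using orth F(2) by (auto simp: orthogonal_for_def)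
    note err = projection_error[OF F(1) this, of \<xi> v]
    have "(\<integral>x. (cmod (exp_char \<xi> x - (\<Sum>l\<in>F. v l * exp_char l x)))\<^sup>2 \<partial>\<mu>) < \<epsilon>"
      using F(3) unfolding L2_norm_def by simp
    moreover have "0 \<le> (\<Sum>l\<in>F. (cmod (v l - fourier \<mu> (\<xi> - l)))\<^sup>2)" by (intro sum_nonneg) simp
    ultimately have "1 - \<epsilon> < (\<Sum>l\<in>F. (cmod (fourier \<mu> (\<xi> - l)))\<^sup>2)" unfolding err by linarith
    then show "\<exists>F. finite F \<and> F \<subseteq> \<Lambda> \<and> 1 - \<epsilon> < (\<Sum>l\<in>F. (cmod (fourier \<mu> (\<xi> - l)))\<^sup>2)" using F by blast
  qed
  ultimately show "countable \<Lambda> \<and> orthogonal_for (fourier \<mu>) \<Lambda> \<and> complete_for (fourier \<mu>) \<Lambda>"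
    using spec by (simp add: is_spectrum_def)
next
  assume H: "countable \<Lambda> \<and> orthogonal_for (fourier \<mu>) \<Lambda> \<and> complete_for (fourier \<mu>) \<Lambda>"
  obtain K where K: "compact K" "emeasure \<mu> (- K) = 0" using supp by (auto simp: compactly_supported_def)
  have "exp_char \<xi> \<in> closed_span \<Lambda>" for \<xi>
    unfolding closed_span_def
  proof (intro CollectI conjI allI impI L2_exp_char)
    fix e :: real assume "e > 0"
    then obtain F where F: "finite F" "F \<subseteq> \<Lambda>" "1 - e < (\<Sum>l\<in>F. (cmod (fourier \<mu> (\<xi> - l)))\<^sup>2)"
      using H unfolding complete_for_def by blast
    have "orthogonal_for (fourier \<mu>) F" using H F(2) by (auto simp: orthogonal_for_def)
    from projection_error[OF F(1) this, of \<xi> "\<lambda>l. fourier \<mu> (\<xi> - l)"]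
    have "(\<integral>x. (cmod (exp_char \<xi> x - (\<Sum>l\<in>F. fourier \<mu> (\<xi> - l) * exp_char l x)))\<^sup>2 \<partial>\<mu>) < e"
      using F(3) by simp
    then show "\<exists>F w. finite F \<and> F \<subseteq> \<Lambda> \<and> (\<integral>x. (cmod (exp_char \<xi> x - (\<Sum>l\<in>F. w l * exp_char l x)))\<^sup>2 \<partial>\<mu>) < e"
      using F by (intro exI[of _ F] exI[of _ "\<lambda>l. fourier \<mu> (\<xi> - l)"]) auto
  qed
  then have full: "closed_span \<Lambda> = L2 \<mu>" by (rule closed_span_eq_L2[OF K])
  have "\<exists>F a. finite F \<and> F \<subseteq> \<Lambda> \<and> L2_norm \<mu> (\<lambda>x. f x - (\<Sum>l\<in>F. a l * exp_char l x)) < \<epsilon>"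
    if f: "f \<in> L2 \<mu>" and e: "\<epsilon> > 0" for f \<epsilon>
  proof -
    have "f \<in> closed_span \<Lambda>" "\<epsilon>\<^sup>2 > 0" using f e full by auto
    then obtain F w where F: "finite F" "F \<subseteq> \<Lambda>" "(\<integral>x. (cmod (f x - (\<Sum>l\<in>F. w l * exp_char l x)))\<^sup>2 \<partial>\<mu>) < \<epsilon>\<^sup>2"
      by (rule closed_spanE)
    have "L2_norm \<mu> (\<lambda>x. f x - (\<Sum>l\<in>F. w l * exp_char l x)) < sqrt (\<epsilon>\<^sup>2)"
      unfolding L2_norm_def using F(3) by (rule real_sqrt_less_mono)
    then have "L2_norm \<mu> (\<lambda>x. f x - (\<Sum>l\<in>F. w l * exp_char l x)) < \<epsilon>" using e by simp
    then show ?thesis using F by blast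
  qed
  then show "is_spectrum \<mu> \<Lambda>"
    using H unfolding is_spectrum_def L2_orthonormal_basis_def L2_inner_exp orthogonal_for_def
    by (simp add: L2_exp_char fourier_zero)
qed

end

section \<open>Compact support, and the characterisation\<close>

context plane_probability
begin

text \<open>All maps contract a weighted norm \<open>N\<close>, in
which the second coordinate is heavy enough to absorb the shear, up to a bounded translation. Let
\<open>out r\<close> be the outside of the ball of radius \<open>r\<close>. Invariance gives that the mass of \<open>out (\<theta> * (r + R))\<close>
is at most that of \<open>out r\<close>. Iteration brings every large radius close to the fixed radius \<open>r\<close>, while
the mass outside large balls tends to 0.\<close>

lemma self_affine_compactly_supported:
  fixes \<psi> :: "real^2 \<Rightarrow> real^2 \<Rightarrow> real^2"
  assumes \<rho>: "0 < \<rho>" "\<rho> < 1" and D: "finite D" "D \<noteq> {}" and \<psi>: "\<And>d. \<psi> d \<in> borel_measurable borel"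
    and psi_eq: "\<And>d x. \<psi> d x = vector [\<rho> * (x + d) $ 1 - c * \<rho>\<^sup>2 * (x + d) $ 2, \<rho> * (x + d) $ 2]"
    and self: "\<And>A. A \<in> sets borel \<Longrightarrow>
      measure \<mu> A = 1 / real (card D) * (\<Sum>d\<in>D. measure (distr \<mu> borel (\<psi> d)) A)"
  shows "compactly_supported \<mu>"
proof -
  (* The weight makes the norm of the linear part at most \<theta>, halfway between \<rho>
     and 1. *)
  define K where "K = 2 * \<bar>c\<bar> * \<rho>\<^sup>2 / (1 - \<rho>) + 1"
  have K1: "K \<ge> 1" using \<rho> by (simp add: K_def)
  define N where "N x = \<bar>x $ 1\<bar> + K * \<bar>x $ 2\<bar>" for x :: "real^2"
  define \<theta> where "\<theta> = (1 + \<rho>) / 2"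
  have \<theta>: "0 < \<theta>" "\<theta> < 1" using \<rho> by (auto simp: \<theta>_def)
  have N0: "0 \<le> N x" for x using K1 by (simp add: N_def)
  have N_add: "N (x + y) \<le> N x + N y" for x y
  proof -
    have "K * \<bar>x $ 2 + y $ 2\<bar> \<le> K * (\<bar>x $ 2\<bar> + \<bar>y $ 2\<bar>)" using K1 by (intro mult_left_mono) auto
    then show ?thesis unfolding N_def using abs_triangle_ineq[of "x $ 1" "y $ 1"] by (simp add: distrib_left)
  qed
  have Kc: "\<bar>c\<bar> * \<rho>\<^sup>2 \<le> K * (\<theta> - \<rho>)"
  proof -
    have "K * (\<theta> - \<rho>) = (2 * \<bar>c\<bar> * \<rho>\<^sup>2 / (1 - \<rho>) + 1) * ((1 - \<rho>) / 2)"
      by (simp add: K_def \<theta>_def field_simps)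
    also have "\<dots> = \<bar>c\<bar> * \<rho>\<^sup>2 + (1 - \<rho>) / 2" using \<rho> by (simp add: field_simps)
    finally show ?thesis using \<rho> by simp
  qed
  have N_lin: "\<bar>\<rho> * u - c * \<rho>\<^sup>2 * v\<bar> + K * \<bar>\<rho> * v\<bar> \<le> \<theta> * (\<bar>u\<bar> + K * \<bar>v\<bar>)" for u v
  proof -
    have "\<bar>\<rho> * u - c * \<rho>\<^sup>2 * v\<bar> \<le> \<bar>\<rho> * u\<bar> + \<bar>c * \<rho>\<^sup>2 * v\<bar>" by (rule abs_triangle_ineq4)
    also have "\<dots> = \<rho> * \<bar>u\<bar> + \<bar>c\<bar> * \<rho>\<^sup>2 * \<bar>v\<bar>" using \<rho> by (simp add: abs_mult)
    finally have 1: "\<bar>\<rho> * u - c * \<rho>\<^sup>2 * v\<bar> \<le> \<rho> * \<bar>u\<bar> + \<bar>c\<bar> * \<rho>\<^sup>2 * \<bar>v\<bar>" .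
    have 2: "\<rho> * \<bar>u\<bar> \<le> \<theta> * \<bar>u\<bar>" using \<rho> by (intro mult_right_mono) (auto simp: \<theta>_def)
    have 3: "\<bar>c\<bar> * \<rho>\<^sup>2 * \<bar>v\<bar> \<le> K * (\<theta> - \<rho>) * \<bar>v\<bar>" using Kc by (intro mult_right_mono) auto
    have 4: "K * \<bar>\<rho> * v\<bar> = K * \<rho> * \<bar>v\<bar>" using \<rho> by (simp add: abs_mult)
    have "\<theta> * (\<bar>u\<bar> + K * \<bar>v\<bar>) = \<theta> * \<bar>u\<bar> + (K * (\<theta> - \<rho>) * \<bar>v\<bar> + K * \<rho> * \<bar>v\<bar>)"
      by (simp add: algebra_simps)
    then show ?thesis using 1 2 3 4 by linarith
  qed
  define R where "R = (\<Sum>d\<in>D. N d)"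
  have R: "N d \<le> R" if "d \<in> D" for d unfolding R_def using D that N0 by (intro member_le_sum) auto
  have R0: "R \<ge> 0" unfolding R_def by (intro sum_nonneg N0)
  have N_psi: "N (\<psi> d x) \<le> \<theta> * (N x + R)" if "d \<in> D" for d x
  proof -
    have "N (\<psi> d x) \<le> \<theta> * N (x + d)" unfolding psi_eq N_def vector_2 by (rule N_lin)
    also have "\<dots> \<le> \<theta> * (N x + R)"
      using N_add[of x d] R[OF that] \<theta> by (intro mult_left_mono) auto
    finally show ?thesis .
  qed
  define out where "out r = {x. r < N x}" for r
  have open_out: "open (out r)" for r
    unfolding out_def N_def by (intro open_Collect_less continuous_intros)
  have out_anti: "r \<le> r' \<Longrightarrow> measure \<mu> (out r') \<le> measure \<mu> (out r)" for r r'
    by (rule finite_measure_mono) (auto simp: out_def sets_mu borel_open[OF open_out, unfolded out_def])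
  have step: "measure \<mu> (out (\<theta> * (r + R))) \<le> measure \<mu> (out r)" for r
  proof -
    have "measure (distr \<mu> borel (\<psi> d)) (out (\<theta> * (r + R))) \<le> measure \<mu> (out r)" if "d \<in> D" for d
    proof -
      have "measure (distr \<mu> borel (\<psi> d)) (out (\<theta> * (r + R))) = measure \<mu> (\<psi> d -` out (\<theta> * (r + R)))"
        using borel_measurable_mu[OF \<psi>] open_out by (subst measure_distr) auto
      also have "\<dots> \<le> measure \<mu> (out r)"
      proof (rule finite_measure_mono)
        show "\<psi> d -` out (\<theta> * (r + R)) \<subseteq> out r"
        proof
          fix x assume "x \<in> \<psi> d -` out (\<theta> * (r + R))"
          then have "\<theta> * (r + R) < \<theta> * (N x + R)" using N_psi[OF that, of x] by (simp add: out_def)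
          then show "x \<in> out r" using \<theta> by (simp add: out_def)
        qed
      qed (simp add: sets_mu open_out)
      finally show ?thesis .
    qed
    then have "(\<Sum>d\<in>D. measure (distr \<mu> borel (\<psi> d)) (out (\<theta> * (r + R)))) \<le> (\<Sum>d\<in>D. measure \<mu> (out r))"
      by (rule sum_mono)
    then have "measure \<mu> (out (\<theta> * (r + R))) \<le> 1 / real (card D) * (\<Sum>d\<in>D. measure \<mu> (out r))"
      unfolding self[OF borel_open[OF open_out], of "\<theta> * (r + R)"] by (intro mult_left_mono) auto
    also have "\<dots> = measure \<mu> (out r)" using D by simp
    finally show ?thesis .
  qed
  define r where "r = \<theta> * R / (1 - \<theta>)"
  have r: "\<theta> * (r + R) = r" using \<theta> by (simp add: r_def field_simps)
  have iter: "measure \<mu> (out (r + \<theta> ^ n * s)) \<le> measure \<mu> (out (r + s))" for n s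
  proof (induction n)
    case (Suc n)
    have "r + \<theta> ^ Suc n * s = \<theta> * ((r + \<theta> ^ n * s) + R)"
      by (subst (1) r[symmetric]) (simp add: algebra_simps)
    then have "measure \<mu> (out (r + \<theta> ^ Suc n * s)) \<le> measure \<mu> (out (r + \<theta> ^ n * s))"
      using step[of "r + \<theta> ^ n * s"] by simp
    then show ?case using Suc by simp
  qed simp
  have le: "measure \<mu> (out (r + 1)) \<le> measure \<mu> (out (r + s))" for s
  proof -
    have "(\<lambda>n. \<theta> ^ n * s) \<longlonglongrightarrow> 0 * s" using \<theta> by (intro tendsto_mult LIMSEQ_power_zero tendsto_const) auto
    then have "eventually (\<lambda>n. \<theta> ^ n * s < 1) sequentially" by (intro order_tendstoD(2)) auto
    then obtain n where "\<theta> ^ n * s < 1" by (auto simp: eventually_sequentially)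
    then have "measure \<mu> (out (r + 1)) \<le> measure \<mu> (out (r + \<theta> ^ n * s))" by (intro out_anti) simp
    then show ?thesis using iter[of n s] by linarith
  qed
  have "(\<lambda>n. measure \<mu> (out (r + real n))) \<longlonglongrightarrow> measure \<mu> (\<Inter>n. out (r + real n))"
  proof (rule finite_Lim_measure_decseq)
    show "range (\<lambda>n. out (r + real n)) \<subseteq> sets \<mu>" by (auto simp: sets_mu open_out)
    show "decseq (\<lambda>n. out (r + real n))" by (auto simp: decseq_def out_def)
  qed
  moreover have "(\<Inter>n. out (r + real n)) = {}"
  proof -
    have "\<exists>n. \<not> r + real n < N x" for x
      using real_arch_simple[of "N x - r"] by (auto simp: algebra_simps not_less)
    then show ?thesis unfolding out_def by blast
  qed
  ultimately have lim: "(\<lambda>n. measure \<mu> (out (r + real n))) \<longlonglongrightarrow> 0" by simp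
  have "measure \<mu> (out (r + 1)) \<le> 0" by (rule LIMSEQ_le_const[OF lim]) (use le in blast)
  then have zero: "measure \<mu> (out (r + 1)) = 0" using measure_nonneg[of \<mu> "out (r + 1)"] by linarith
  define C where "C = - out (r + 1)"
  have "bounded C"
  proof (rule boundedI)
    fix x assume "x \<in> C"
    then have "N x \<le> r + 1" by (simp add: C_def out_def not_less)
    moreover have "\<bar>x $ 2\<bar> \<le> K * \<bar>x $ 2\<bar>" using K1 by (simp add: mult_le_cancel_right1)
    moreover have "norm x \<le> (\<Sum>i\<in>UNIV. \<bar>x $ i\<bar>)" by (rule norm_le_l1_cart)
    ultimately show "norm x \<le> r + 1" by (simp add: sum_2 N_def)
  qed
  moreover have "closed C" unfolding C_def using open_out by (simp add: closed_Compl)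
  ultimately have "compact C" by (simp add: compact_eq_bounded_closed)
  moreover have "emeasure \<mu> (- C) = 0" using zero by (simp add: C_def emeasure_eq_measure)
  ultimately show ?thesis unfolding compactly_supported_def by blast
qed

end

lemma upper_triangular_inverse:
  fixes c \<rho> :: real
  assumes "\<rho> \<noteq> 0"
  shows "matrix_inv (vector [vector [1 / \<rho>, c], vector [0, 1 / \<rho>]] :: real^2^2) *v y
    = vector [\<rho> * y $ 1 - c * \<rho>\<^sup>2 * y $ 2, \<rho> * y $ 2]"
proof -
  let ?M = "vector [vector [1 / \<rho>, c], vector [0, 1 / \<rho>]] :: real^2^2"
  let ?N = "vector [vector [\<rho>, - c * \<rho>\<^sup>2], vector [0, \<rho>]] :: real^2^2"
  have 1: "?M ** ?N = mat 1" and 2: "?N ** ?M = mat 1"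
    using assms by (simp_all add: vec_eq_iff forall_2 matrix_matrix_mult_def sum_2 mat_def power2_eq_square)
  have "invertible ?M" unfolding invertible_def using 1 2 by blast
  then have inv: "matrix_inv ?M ** ?M = mat 1"
    unfolding invertible_def matrix_inv_def by (rule someI2_ex) blast
  have "matrix_inv ?M = matrix_inv ?M ** (?M ** ?N)" unfolding 1 by simp
  also have "\<dots> = (matrix_inv ?M ** ?M) ** ?N" by (rule matrix_mul_assoc)
  also have "\<dots> = ?N" unfolding inv by simp
  finally have "matrix_inv ?M = ?N" .
  then show ?thesis by (simp add: vec_eq_iff forall_2 matrix_vector_mult_def sum_2)
qed

theorem theorem1p3:
  fixes p :: nat and \<rho> c :: real and M :: "real^2^2"
    and D :: "(real^2) set" and \<mu> :: "(real^2) measure"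
  assumes "prime p"
    and "0 < \<rho>" and "\<rho> < 1"
    and "M = vector [vector [1 / \<rho>, c], vector [0, 1 / \<rho>]]"
    and "D \<subseteq> int_lattice" and "card D = p"
    and "\<exists>a\<in>E_set p. zero_set (fourier (delta_measure D)) =
           (\<Union>j\<in>{1..p - 1}. {(real j / real p) *\<^sub>R a + z | z. z \<in> int_lattice})"
    and "is_self_affine_measure M D \<mu>"
  shows "spectral_measure \<mu> \<longleftrightarrow>
           1 / \<rho> \<in> {real_of_int (int p * k) | k. True} \<and>
           c \<in> {real_of_int t / real_of_int s | s t. s \<noteq> 0 \<and> int p dvd t \<and> gcd t s = 1} \<union> {0}"
proof -
  define b where "b = 1 / \<rho>"
  have b: "b > 1" using assms(2,3) by (simp add: b_def)
  have p2: "p \<ge> 2" using assms(1) by (rule prime_ge_2_nat)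
  have D: "finite D" "D \<noteq> {}" using assms(6) p2 by (auto intro: card_ge_0_finite)
  obtain a where a: "a \<in> E_set p" "zero_set (fourier (delta_measure D)) =
      (\<Union>j\<in>{1..p - 1}. {(real j / real p) *\<^sub>R a + z | z. z \<in> int_lattice})" using assms(7) by blast
  obtain i1 i2 where i: "a = vector [real i1, real i2]" "i1 \<in> {1..p - 1}" using a(1) by (auto simp: E_set_def)
  have a_lattice: "a \<in> int_lattice" by (simp add: i int_lattice_iff)
  have "\<not> p dvd i1" using i(2) p2 by (auto dest: dvd_imp_le)
  then have a1: "\<exists>k. a $ 1 = of_int k \<and> \<not> int p dvd k"
    by (intro exI[of _ "int i1"]) (simp add: i)
  have bp: "borel_prob \<mu>" and self: "\<And>A. A \<in> sets borel \<Longrightarrow>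
      measure \<mu> A = 1 / real (card D) * (\<Sum>d\<in>D. measure (distr \<mu> borel (affine_branch M d)) A)"
    using assms(8) unfolding is_self_affine_measure_def by blast+
  have branch: "affine_branch M d x = vector [\<rho> * (x + d) $ 1 - c * \<rho>\<^sup>2 * (x + d) $ 2, \<rho> * (x + d) $ 2]" for d x
    unfolding affine_branch_def assms(4) using assms(2) by (intro upper_triangular_inverse) simp
  have branch_cont: "continuous_on UNIV (affine_branch M d)" for d
    unfolding affine_branch_def by (intro continuous_intros linear_continuous_on matrix_vector_mul_bounded_linear continuous_on_compose2[where g = "\<lambda>x. matrix_inv M *v x"]) auto
  have branch_meas: "affine_branch M d \<in> borel_measurable borel" for d
    by (rule borel_measurable_continuous_onI[OF branch_cont])
  interpret prob_space \<mu> using bp by (simp add: borel_prob_def)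
  interpret plane_probability \<mu> by unfold_locales (use bp in \<open>simp add: borel_prob_def\<close>)
  have supp: "compactly_supported \<mu>"
    by (rule self_affine_compactly_supported[OF assms(2,3) D branch_meas branch self])
  have char_branch: "exp_char \<xi> (affine_branch M d x) = exp_char (shear b c (- 1) \<xi>) (x + d)" for \<xi> d x
  proof -
    have "\<xi> \<bullet> affine_branch M d x = shear b c (- 1) \<xi> \<bullet> (x + d)"
      unfolding branch using assms(2)
      by (simp add: inner_vec_def sum_2 shear_2 b_def power2_eq_square algebra_simps)
    then show ?thesis by (simp add: exp_char_cis)
  qed
  have refine: "fourier \<mu> \<xi> = mask D (shear b c (- 1) \<xi>) * fourier \<mu> (shear b c (- 1) \<xi>)" for \<xi>
  proof -
    let ?\<eta> = "shear b c (- 1) \<xi>"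
    have "fourier \<mu> \<xi> = (\<Sum>d\<in>D. \<integral>x. exp_char \<xi> (affine_branch M d x) \<partial>\<mu>) / of_nat (card D)"
      unfolding fourier_def
      by (rule self_affine_integral[OF D branch_meas self _ , where B = 1])
         (auto intro: borel_measurable_continuous_onI[OF continuous_exp_char])
    also have "\<dots> = (\<Sum>d\<in>D. exp_char ?\<eta> d * fourier \<mu> ?\<eta>) / of_nat (card D)"
      unfolding char_branch exp_char_add_right by (simp add: fourier_def mult.commute)
    also have "\<dots> = mask D ?\<eta> * fourier \<mu> ?\<eta>" by (simp add: mask_def sum_distrib_right)
    finally show ?thesis .
  qed
  interpret refinable p b c D a "fourier \<mu>"
  proof
    show "{\<xi>. mask D \<xi> = 0} = (\<Union>j\<in>{1..p - 1}. {(real j / real p) *\<^sub>R a + z | z. z \<in> int_lattice})"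
      using a(2) by (simp add: zero_set_def fourier_delta_measure[OF D(1)])
  qed (fact assms(1,5,6) b a_lattice a1 uniformly_continuous_fourier fourier_zero norm_fourier_le
      pos_def_fourier refine)+
  show ?thesis
  proof
    assume "spectral_measure \<mu>"
    then obtain \<Lambda> where "is_spectrum \<mu> \<Lambda>" unfolding spectral_measure_def by blast
    then have spec: "orthogonal_for (fourier \<mu>) \<Lambda>" "complete_for (fourier \<mu>) \<Lambda>"
      using spectrum_iff[OF supp] by auto
    interpret refinable_spectrum p b c D a "fourier \<mu>" \<Lambda> by unfold_locales (fact spec)+
    obtain q h where qh: "h > 0" "coprime q h" "int p dvd q" "b = of_int q / of_int h"
      using base_rational by blast
    interpret rational_spectrum p b c D a "fourier \<mu>" \<Lambda> q h by unfold_locales (fact qh)+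
    have h: "h = 1" by (rule base_integral)
    obtain k where k: "q = int p * k" using qh(3) by blast
    have inv: "1 / \<rho> = real_of_int (int p * k)" using qh(4) by (simp add: h k b_def)
    obtain w l where wl: "c * of_int l = real p * of_int w" "\<not> int p dvd l"
      using shear_entry[OF h] by blast
    have l0: "l \<noteq> 0" using wl(2) by auto
    define g where "g = gcd w l"
    define w' where "w' = w div g"
    define l' where "l' = l div g"
    have g: "g \<noteq> 0" "w = g * w'" "l = g * l'" using l0 by (auto simp: g_def w'_def l'_def)
    have l'0: "l' \<noteq> 0" using l0 g by auto
    have "\<not> int p dvd l'" using wl(2) g(3) by auto
    then have "coprime (int p) l'" by (rule prime_imp_coprime[OF prime_int_p])
    moreover have "coprime w' l'" unfolding w'_def l'_def g_def by (rule div_gcd_coprime) (use l0 in simp)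
    ultimately have "gcd (int p * w') l' = 1" by (simp add: coprime_iff_gcd_eq_1[symmetric])
    moreover have "c = real_of_int (int p * w') / real_of_int l'"
      using wl(1) g l'0 by (simp add: field_simps)
    moreover have "int p dvd int p * w'" by simp
    ultimately have "c \<in> {real_of_int t / real_of_int s | s t. s \<noteq> 0 \<and> int p dvd t \<and> gcd t s = 1}"
      unfolding mem_Collect_eq using l'0 by (intro exI[of _ l'] exI[of _ "int p * w'"] conjI)
    moreover have "1 / \<rho> \<in> {real_of_int (int p * k) | k. True}" using inv by blast
    ultimately show "1 / \<rho> \<in> {real_of_int (int p * k) | k. True} \<and>
       c \<in> {real_of_int t / real_of_int s | s t. s \<noteq> 0 \<and> int p dvd t \<and> gcd t s = 1} \<union> {0}"
      by blast
  next
    assume H: "1 / \<rho> \<in> {real_of_int (int p * k) | k. True} \<and>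
       c \<in> {real_of_int t / real_of_int s | s t. s \<noteq> 0 \<and> int p dvd t \<and> gcd t s = 1} \<union> {0}"
    then obtain k where k: "b = real p * of_int k" unfolding b_def by auto
    have "\<exists>s t. s > 0 \<and> \<not> int p dvd s \<and> c * of_int s = real p * of_int t"
    proof (cases "c = 0")
      case True
      then show ?thesis using p2 by (intro exI[of _ 1] exI[of _ 0]) simp
    next
      case False
      then obtain s t where st: "c = real_of_int t / real_of_int s" "s \<noteq> 0" "int p dvd t" "gcd t s = 1"
        using H by auto
      obtain t0 where t0: "t = int p * t0" using st(3) by blast
      have "\<not> int p dvd s"
      proof
        assume "int p dvd s"
        then have "int p dvd gcd t s" using st(3) by simp
        then show False using st(4) p2 by simp
      qed
      moreover have "c * of_int s = real p * of_int t0" using st(1,2) t0 by simp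
      then have "c * of_int \<bar>s\<bar> = real p * of_int (sgn s * t0)" using st(2) by (cases "s > 0") auto
      ultimately show ?thesis using st(2) by (intro exI[of _ "\<bar>s\<bar>"] exI[of _ "sgn s * t0"]) simp
    qed
    then obtain s t where st: "s > 0" "\<not> int p dvd s" "c * of_int s = real p * of_int t" by blast
    interpret integral_refinable p b c D a "fourier \<mu>" k s t by unfold_locales (fact k st)+
    obtain \<Lambda> where "is_spectrum \<mu> \<Lambda>" using exists_spectrum spectrum_iff[OF supp] by blast
    then show "spectral_measure \<mu>" unfolding spectral_measure_def using bp supp by blast
  qed
qed

end
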